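(* Let $X$ be a separable Hilbert space and let $A:D(A)\subset X\to X$ be a densely defined linear operator such that: (a) $A$ is self-adjoint; (b) $A$ is accretive, i.e. $\langle Ax,x\rangle\ge 0$ for all $x\in D(A)$; (c) there exists $\lambda>0$ such that $(\lambda I+A)^{-1}:X\to X$ is compact. Let $\{\lambda_k\}_{k\in\mathbb{N}^*}$ be the eigenvalues of $A$ and $\{\varphi_k\}_{k\in\mathbb{N}^*}$ the corresponding eigenfunctions, and suppose that there exists $\alpha>0$ such that $\sqrt{\lambda_{k+1}}-\sqrt{\lambda_k}\ge\alpha$ for all $k\in\mathbb{N}^*$. Let $B:X\to X$ be a bounded linear operator for which there exist $b,q>0$ such that $\langle B\varphi_1,\varphi_1\rangle\ne0$ and $\lambda_k^q|\langle B\varphi_1,\varphi_k\rangle|\ge b$ for all $k>1$. Then for any $R>0$ there exists $T_R>0$ such that for all $u_0\in X$ satisfying $$\|u_0-\langle u_0,\varphi_1\rangle\varphi_1\|\le R\,|\langle u_0,\varphi_1\rangle|,$$ there exists a control $p\in L^2(0,T_R)$ such that the mild solution $u$ of $$u'(t)+Au(t)+p(t)Bu(t)=0,\quad t\in[0,T_R],\qquad u(0)=u_0,$$ satisfies $u(T_R)=\phi_1(T_R)$, where $\phi_1(t)=\langle u_0,\varphi_1\rangle\psi_1(t)$ and $\psi_1(t)=e^{-\lambda_1t}\varphi_1$ for $t\ge0$.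
   Context: $\mathbb{N}^*=\{1,2,\dots\}$. $X$ is infinite-dimensional; the eigenvalues are listed in increasing order and the eigenfunctions $\{\varphi_k\}_{k\in\mathbb{N}^*}$ form an orthonormal basis of $X$ with $A\varphi_k=\lambda_k\varphi_k$. The control $p$ is a scalar function of time (with values in the scalar field of $X$). The mild solution on $[0,T]$ of the control problem is the unique $u\in C([0,T];X)$ with $u(t)=e^{-tA}u_0-\int_0^te^{-(t-s)A}p(s)Bu(s)\,ds$ for all $t\in[0,T]$. *)

theory Defs
  imports "HOL-Analysis.Analysis"
begin

text \<open>
  The scalar field of a Hilbert space is either the reals or the complex numbers. The class lets one
  statement cover both cases: a member type is identified, through \<open>to_complex\<close>, with
  the subfield \<open>\<real>\<close> of \<open>\<complex>\<close> or with \<open>\<complex>\<close> itself.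
\<close>

class real_or_complex = real_normed_field +
  fixes to_complex :: "'a \<Rightarrow> complex"
  assumes to_complex_add: "to_complex (x + y) = to_complex x + to_complex y"
    and to_complex_mult: "to_complex (x * y) = to_complex x * to_complex y"
    and to_complex_scaleR: "to_complex (r *\<^sub>R x) = r *\<^sub>R to_complex x"
    and norm_to_complex: "cmod (to_complex x) = norm x"
    and range_to_complex: "range to_complex = \<real> \<or> range to_complex = UNIV"

instantiation real :: real_or_complex
begin

definition to_complex_real_def: "to_complex (x :: real) = complex_of_real x"

instance
  by standard (auto simp: to_complex_real_def Reals_def scaleR_conv_of_real)

end

instantiation complex :: real_or_complex
begin

definition to_complex_complex_def: "to_complex (z :: complex) = z"

instance
  by standard (auto simp: to_complex_complex_def)

end

text \<open>
  A separable Hilbert space over the scalar field \<open>'k\<close>. The class \<open>real_inner\<close> supplies the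
  underlying real Hilbert space, whose inner product is the real part of the \<open>'k\<close>-valued one
  and whose norm is therefore the Hilbert norm. Separability is \<open>second_countable_topology\<close>.
  The inner product is linear in its first argument.
\<close>

locale hilbert_over = vector_space scl
  for scl :: "'k::real_or_complex \<Rightarrow> 'a::{real_inner, banach, second_countable_topology} \<Rightarrow> 'a" +
  fixes ip :: "'a \<Rightarrow> 'a \<Rightarrow> 'k"
  assumes scale_of_real: "scl (of_real r) x = r *\<^sub>R x"
    and ip_add_left: "ip (x + y) z = ip x z + ip y z"
    and ip_scale_left: "ip (scl c x) y = c * ip x y"
    and ip_conj_sym: "to_complex (ip y x) = cnj (to_complex (ip x y))"
    and Re_ip: "Re (to_complex (ip x y)) = x \<bullet> y"

lemma hilbert_over_real:
  "hilbert_over ((*\<^sub>R) :: real \<Rightarrow> 'a::{real_inner, banach, second_countable_topology} \<Rightarrow> 'a) (\<bullet>)"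
  by unfold_locales
    (auto simp: to_complex_real_def inner_commute inner_add_left algebra_simps)

lemma hilbert_over_complex: "hilbert_over ((*) :: complex \<Rightarrow> complex \<Rightarrow> complex) (\<lambda>x y. x * cnj y)"
  by unfold_locales
    (auto simp: to_complex_complex_def inner_complex_def scaleR_conv_of_real algebra_simps)

definition bounded_operator :: "('k::field \<Rightarrow> 'a::real_normed_vector \<Rightarrow> 'a) \<Rightarrow> ('a \<Rightarrow> 'a) \<Rightarrow> bool" where
  "bounded_operator scl F \<longleftrightarrow> Vector_Spaces.linear scl scl F \<and> bounded_linear F"

definition compact_operator :: "('k::field \<Rightarrow> 'a::real_normed_vector \<Rightarrow> 'a) \<Rightarrow> ('a \<Rightarrow> 'a) \<Rightarrow> bool" where
  "compact_operator scl F \<longleftrightarrow>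
     Vector_Spaces.linear scl scl F \<and> (\<forall>M. bounded M \<longrightarrow> compact (closure (F ` M)))"

text \<open>
  An unbounded operator is given by its domain \<open>D\<close> and a total function \<open>A\<close> of which
  only the values on \<open>D\<close> are used.
\<close>

definition op_graph :: "'a set \<Rightarrow> ('a \<Rightarrow> 'a) \<Rightarrow> ('a \<times> 'a) set" where
  "op_graph D A = {(x, A x) | x. x \<in> D}"

definition densely_defined_linear ::
    "('k::field \<Rightarrow> 'a::real_normed_vector \<Rightarrow> 'a) \<Rightarrow> 'a set \<Rightarrow> ('a \<Rightarrow> 'a) \<Rightarrow> bool" where
  "densely_defined_linear scl D A \<longleftrightarrow>
     module.subspace scl D \<and> closure D = UNIV \<and>
     (\<forall>x\<in>D. \<forall>y\<in>D. A (x + y) = A x + A y) \<and> (\<forall>c. \<forall>x\<in>D. A (scl c x) = scl c (A x))"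

definition adjoint_graph :: "('a \<Rightarrow> 'a \<Rightarrow> 'k) \<Rightarrow> 'a set \<Rightarrow> ('a \<Rightarrow> 'a) \<Rightarrow> ('a \<times> 'a) set" where
  "adjoint_graph ip D A = {(y, z). \<forall>x\<in>D. ip (A x) y = ip x z}"

definition self_adjoint :: "('a \<Rightarrow> 'a \<Rightarrow> 'k) \<Rightarrow> 'a set \<Rightarrow> ('a \<Rightarrow> 'a) \<Rightarrow> bool" where
  "self_adjoint ip D A \<longleftrightarrow> adjoint_graph ip D A = op_graph D A"

definition accretive :: "('a \<Rightarrow> 'a \<Rightarrow> 'k::real_algebra_1) \<Rightarrow> 'a set \<Rightarrow> ('a \<Rightarrow> 'a) \<Rightarrow> bool" where
  "accretive ip D A \<longleftrightarrow> (\<forall>x\<in>D. \<exists>r\<ge>0. ip (A x) x = of_real r)"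

definition compact_resolvent_at ::
    "('k::field \<Rightarrow> 'a::real_normed_vector \<Rightarrow> 'a) \<Rightarrow> 'a set \<Rightarrow> ('a \<Rightarrow> 'a) \<Rightarrow> real \<Rightarrow> bool" where
  "compact_resolvent_at scl D A \<mu> \<longleftrightarrow>
     bij_betw (\<lambda>x. \<mu> *\<^sub>R x + A x) D UNIV \<and>
     compact_operator scl (the_inv_into D (\<lambda>x. \<mu> *\<^sub>R x + A x))"

text \<open>Sequences indexed by the positive integers are functions on \<open>nat\<close>; the value at 0 is unused.\<close>

definition orthonormal_basis ::
    "('k::field \<Rightarrow> 'a::real_normed_vector \<Rightarrow> 'a) \<Rightarrow> ('a \<Rightarrow> 'a \<Rightarrow> 'k) \<Rightarrow> (nat \<Rightarrow> 'a) \<Rightarrow> bool" where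
  "orthonormal_basis scl ip \<phi> \<longleftrightarrow>
     (\<forall>j\<ge>1. \<forall>k\<ge>1. ip (\<phi> j) (\<phi> k) = (if j = k then 1 else 0)) \<and>
     closure (module.span scl (\<phi> ` {1..})) = UNIV"

definition eigen_basis ::
    "('k::field \<Rightarrow> 'a::real_normed_vector \<Rightarrow> 'a) \<Rightarrow> ('a \<Rightarrow> 'a \<Rightarrow> 'k) \<Rightarrow> 'a set \<Rightarrow> ('a \<Rightarrow> 'a) \<Rightarrow>
     (nat \<Rightarrow> real) \<Rightarrow> (nat \<Rightarrow> 'a) \<Rightarrow> bool" where
  "eigen_basis scl ip D A lam \<phi> \<longleftrightarrow>
     mono_on {1..} lam \<and> orthonormal_basis scl ip \<phi> \<and>
     (\<forall>k\<ge>1. \<phi> k \<in> D \<and> A (\<phi> k) = lam k *\<^sub>R \<phi> k)"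

text \<open>Only the values of \<open>S t\<close> for \<open>t \<ge> 0\<close> matter in what follows.\<close>

definition c0_semigroup ::
    "('k::field \<Rightarrow> 'a::real_normed_vector \<Rightarrow> 'a) \<Rightarrow> (real \<Rightarrow> 'a \<Rightarrow> 'a) \<Rightarrow> bool" where
  "c0_semigroup scl S \<longleftrightarrow>
     (\<forall>t\<ge>0. bounded_operator scl (S t)) \<and>
     S 0 = id \<and> (\<forall>s\<ge>0. \<forall>t\<ge>0. S (s + t) = S s \<circ> S t) \<and>
     (\<forall>x. ((\<lambda>t. S t x) \<longlongrightarrow> x) (at_right 0))"

definition generator_graph :: "(real \<Rightarrow> 'a::real_normed_vector \<Rightarrow> 'a) \<Rightarrow> ('a \<times> 'a) set" where
  "generator_graph S = {(x, y). ((\<lambda>t. (S t x - x) /\<^sub>R t) \<longlongrightarrow> y) (at_right 0)}"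

text \<open>
  \<open>exp_neg scl D A t x\<close> is \<open>e\<^bsup>-tA\<^esup> x\<close>, the value of the strongly continuous semigroup generated
  by \<open>-A\<close>. A semigroup is determined for \<open>t \<ge> 0\<close> by its generator, so for such \<open>t\<close> the
  description is definite whenever \<open>-A\<close> generates a semigroup.
\<close>

definition exp_neg ::
    "('k::field \<Rightarrow> 'a::real_normed_vector \<Rightarrow> 'a) \<Rightarrow> 'a set \<Rightarrow> ('a \<Rightarrow> 'a) \<Rightarrow> real \<Rightarrow> 'a \<Rightarrow> 'a" where
  "exp_neg scl D A t x =
     (THE y. \<exists>S. c0_semigroup scl S \<and> generator_graph S = op_graph D (\<lambda>z. - A z) \<and> y = S t x)"

definition L2_control :: "real \<Rightarrow> (real \<Rightarrow> 'k::real_normed_vector) \<Rightarrow> bool" where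
  "L2_control T p \<longleftrightarrow>
     set_borel_measurable lborel {0<..<T} p \<and>
     set_integrable lborel {0<..<T} (\<lambda>s. (norm (p s))\<^sup>2)"

definition mild_equation ::
    "('k::field \<Rightarrow> 'a::{banach, second_countable_topology} \<Rightarrow> 'a) \<Rightarrow> 'a set \<Rightarrow> ('a \<Rightarrow> 'a) \<Rightarrow>
     ('a \<Rightarrow> 'a) \<Rightarrow> (real \<Rightarrow> 'k) \<Rightarrow> 'a \<Rightarrow> real \<Rightarrow> (real \<Rightarrow> 'a) \<Rightarrow> bool" where
  "mild_equation scl D A B p u\<^sub>0 T u \<longleftrightarrow>
     continuous_on {0..T} u \<and>
     (\<forall>t\<in>{0..T}.
        set_integrable lborel {0..t} (\<lambda>s. exp_neg scl D A (t - s) (scl (p s) (B (u s)))) \<and>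
        u t = exp_neg scl D A t u\<^sub>0 -
          set_lebesgue_integral lborel {0..t} (\<lambda>s. exp_neg scl D A (t - s) (scl (p s) (B (u s)))))"

text \<open>
  The mild solution is the unique solution of the mild equation; uniqueness concerns
  the values on \<open>[0,T]\<close> only.
\<close>

definition is_the_mild_solution ::
    "('k::field \<Rightarrow> 'a::{banach, second_countable_topology} \<Rightarrow> 'a) \<Rightarrow> 'a set \<Rightarrow> ('a \<Rightarrow> 'a) \<Rightarrow>
     ('a \<Rightarrow> 'a) \<Rightarrow> (real \<Rightarrow> 'k) \<Rightarrow> 'a \<Rightarrow> real \<Rightarrow> (real \<Rightarrow> 'a) \<Rightarrow> bool" where
  "is_the_mild_solution scl D A B p u\<^sub>0 T u \<longleftrightarrow>
     mild_equation scl D A B p u\<^sub>0 T u \<and>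
     (\<forall>v. mild_equation scl D A B p u\<^sub>0 T v \<longrightarrow> (\<forall>t\<in>{0..T}. v t = u t))"

end

theory Submission
  imports Defs
begin

text \<open>
  Write \<open>\<psi>\<close> for the first eigenfunction. If \<open>\<langle>u\<^sub>0, \<psi>\<rangle> = 0\<close>, then \<open>u\<^sub>0 = 0\<close>.
  Otherwise, as the equation is linear in \<open>u\<close>, dividing by \<open>\<langle>u\<^sub>0, \<psi>\<rangle>\<close> and
  multiplying by \<open>exp (\<lambda>\<^bsub>1\<^esub> t)\<close> turns the problem into the following one: the semigroup now has the exponents \<open>\<mu> k = \<lambda>\<^bsub>k+1\<^esub> - \<lambda>\<^bsub>1\<^esub> \<ge> 0\<close>, it fixes \<open>\<psi>\<close>, and \<open>\<psi> + w\<close> with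
  \<open>w \<bottom> \<psi>\<close> and \<open>\<parallel>w\<parallel> \<le> R\<close> has to be steered to \<open>\<psi>\<close> in a time that depends only on \<open>R\<close>.

  The system linearised at \<open>\<psi>\<close> is steered from \<open>w\<close> to \<open>0\<close> in time \<open>\<tau>\<close> by \<open>p\<close> if and only if
  the moments of \<open>p\<close> against \<open>exp (- \<mu> k (\<tau> - s))\<close> are \<open>exp (- \<mu> k \<tau>) \<langle>w, \<phi>\<^bsub>k+1\<^esub>\<rangle> / \<langle>B \<psi>, \<phi>\<^bsub>k+1\<^esub>\<rangle>\<close>.
  The denominators decay at most polynomially in \<open>\<mu> k\<close>, so a family biorthogonal to the exponentials
  solves this moment problem once its members grow more slowly than \<open>exp (\<mu> k \<tau>)\<close>. Such a family
  (\<open>biorthogonal_family\<close>) is obtained by real-variable means: the measure \<open>\<delta>\<^bsub>a\<^esub> - exp (- a \<mu>) \<delta>\<^bsub>0\<^esub>\<close> has a Laplace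
  transform that vanishes at \<open>\<mu>\<close>, and an infinite convolution of such measures, one for each exponent
  except the \<open>k\<close>-th, converges and keeps its support in \<open>[0, \<tau>]\<close> when the shifts \<open>a\<close> have a small sum
  (\<open>convolution_kernel\<close>). The gap condition gives \<open>\<bar>\<mu> i - \<mu> k\<bar> \<ge> \<alpha>\<^sup>2 (i - k)\<^sup>2\<close>, which bounds the
  transform at \<open>\<mu> k\<close> from below. The resulting cost of control is \<open>exp (C / \<tau>\<^sup>4)\<close>
  (\<open>null_controllability_cost\<close>).

  Applied to the bilinear system, such a control leaves an error that is quadratic in \<open>\<parallel>w\<parallel>\<close>
  (\<open>control_step\<close>). Repeating the step on intervals of geometrically decreasing length loses
  \<open>exp (C / \<tau>\<^sup>4)\<close> each time, but the quadratic gain is faster: after finite total time the state is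
  exactly \<open>\<psi>\<close> (\<open>local_exact_controllability\<close>). For large \<open>R\<close> one first waits with control \<open>0\<close>
  until dissipation has made \<open>w\<close> small (\<open>steering_to_eigenvector\<close>).

  All controls constructed are continuous, so the vector-valued integrals are integrals of continuous
  functions. The link with the semigroup generated by \<open>-A\<close> is \<open>exp_neg_eq\<close>: this semigroup multiplies the
  \<open>k\<close>-th eigenfunction by \<open>exp (- \<lambda>\<^bsub>k\<^esub> t)\<close>.
\<close>

section \<open>Laplace transforms with prescribed zeros\<close>

lemma integral_uniform_limit:
  fixes f :: "nat \<Rightarrow> real \<Rightarrow> 'b::banach"
  assumes "uniform_limit {a..b} f g sequentially" and "\<And>n. continuous_on {a..b} (f n)"
  shows "(\<lambda>n. integral {a..b} (f n)) \<longlonglongrightarrow> integral {a..b} g"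
proof (rule uniform_limit_integral[OF assms trivial_limit_sequentially])
  fix I J
  assume *: "\<And>n. (f n has_integral I n) {a..b}" "(g has_integral J) {a..b}" "I \<longlonglongrightarrow> J"
  then have "(\<lambda>n. integral {a..b} (f n)) = I" by (intro ext integral_unique)
  then show ?thesis using * by (simp add: integral_unique)
qed

text \<open>
  The convolution of \<open>g\<close> with the measures \<open>\<delta>\<^bsub>a i\<^esub> - c i \<delta>\<^bsub>0\<^esub>\<close> for \<open>i < n\<close>. Each of them multiplies the
  Laplace transform at \<open>z\<close> by \<open>exp (- a i z) - c i\<close>, which vanishes at \<open>\<mu>\<close> when
  \<open>c i = exp (- a i \<mu>)\<close>.
\<close>

primrec shift_iter :: "(nat \<Rightarrow> real) \<Rightarrow> (nat \<Rightarrow> real) \<Rightarrow> (real \<Rightarrow> real) \<Rightarrow> nat \<Rightarrow> real \<Rightarrow> real" where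
  "shift_iter a c g 0 x = g x"
| "shift_iter a c g (Suc n) x = shift_iter a c g n (x - a n) - c n * shift_iter a c g n x"

text \<open>
  The measure \<open>\<delta>\<^bsub>a i\<^esub> - c i \<delta>\<^bsub>0\<^esub>\<close> has total variation \<open>1 + c i \<le> exp (c i)\<close>; this bounds the growth of
  the supremum here and of the Lipschitz constant in the next lemma.
\<close>

lemma shift_iter_bound:
  assumes "\<And>i. 0 \<le> c i" and "\<And>x. \<bar>g x\<bar> \<le> G"
  shows "\<bar>shift_iter a c g n x\<bar> \<le> G * exp (\<Sum>i<n. c i)"
proof (induction n arbitrary: x)
  case 0
  then show ?case using assms(2) by simp
next
  case (Suc n)
  let ?E = "G * exp (\<Sum>i<n. c i)"
  have "0 \<le> G" using assms(2)[of 0] by linarith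
  have "\<bar>shift_iter a c g (Suc n) x\<bar> \<le> ?E + c n * ?E"
    using Suc[of "x - a n"] mult_left_mono[OF Suc[of x] assms(1)[of n]] assms(1)[of n]
    by (auto simp: abs_mult intro!: order.trans[OF abs_triangle_ineq4])
  also have "\<dots> = ?E * (1 + c n)" by (simp add: algebra_simps)
  also have "\<dots> \<le> ?E * exp (c n)"
    using exp_ge_add_one_self[of "c n"] \<open>0 \<le> G\<close> by (intro mult_left_mono) auto
  finally show ?case by (simp add: exp_add mult.assoc)
qed

lemma shift_iter_lipschitz:
  assumes "\<And>i. 0 \<le> c i" and "\<And>x y. \<bar>g x - g y\<bar> \<le> L * \<bar>x - y\<bar>"
  shows "\<bar>shift_iter a c g n x - shift_iter a c g n y\<bar> \<le> L * exp (\<Sum>i<n. c i) * \<bar>x - y\<bar>"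
proof (induction n arbitrary: x y)
  case 0
  then show ?case using assms(2) by simp
next
  case (Suc n)
  let ?E = "L * exp (\<Sum>i<n. c i) * \<bar>x - y\<bar>"
  have "0 \<le> L" using order.trans[OF abs_ge_zero assms(2)[of 1 0]] by simp
  have "\<bar>shift_iter a c g (Suc n) x - shift_iter a c g (Suc n) y\<bar>
      = \<bar>(shift_iter a c g n (x - a n) - shift_iter a c g n (y - a n))
         - c n * (shift_iter a c g n x - shift_iter a c g n y)\<bar>"
    by (simp add: algebra_simps)
  also have "\<dots> \<le> ?E + c n * ?E"
    using Suc[of "x - a n" "y - a n"] mult_left_mono[OF Suc[of x y] assms(1)[of n]] assms(1)[of n]
    by (auto simp: abs_mult intro!: order.trans[OF abs_triangle_ineq4])
  also have "\<dots> = ?E * (1 + c n)" by (simp add: algebra_simps)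
  also have "\<dots> \<le> ?E * exp (c n)"
    using exp_ge_add_one_self[of "c n"] \<open>0 \<le> L\<close> by (intro mult_left_mono) auto
  finally show ?case by (simp add: exp_add mult_ac)
qed

lemma shift_iter_support:
  assumes "\<And>i. 0 \<le> a i" and "\<And>x. x \<le> 0 \<or> l \<le> x \<Longrightarrow> g x = 0"
    and "x \<le> 0 \<or> l + (\<Sum>i<n. a i) \<le> x"
  shows "shift_iter a c g n x = 0"
  using assms(3)
proof (induction n arbitrary: x)
  case 0
  then show ?case using assms(2) by simp
next
  case (Suc n)
  have "shift_iter a c g n (x - a n) = 0" "shift_iter a c g n x = 0"
    using Suc.prems assms(1)[of n] by (auto intro!: Suc.IH)
  then show ?case by simp
qed

lemma shift_iter_continuous:
  "continuous_on UNIV g \<Longrightarrow> continuous_on UNIV (shift_iter a c g n)"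
proof (induction n)
  case 0
  then show ?case by (simp add: continuous_on_eq)
next
  case (Suc n)
  have "continuous_on UNIV (\<lambda>x. shift_iter a c g n (x - a n))"
    by (rule continuous_on_compose2[OF Suc.IH[OF Suc.prems]]) (auto intro!: continuous_intros)
  then show ?case using Suc by (auto intro!: continuous_intros)
qed

text \<open>
  The support condition ensures that the shift moves nothing out of \<open>[0, T]\<close>.
\<close>

lemma laplace_shift:
  fixes f :: "real \<Rightarrow> real"
  assumes f: "continuous_on UNIV f" and a: "0 \<le> a" "a \<le> T"
    and supp: "\<And>x. x \<le> 0 \<or> T - a \<le> x \<Longrightarrow> f x = 0"
  shows "integral {0..T} (\<lambda>s. exp (- z * s) * f (s - a)) = exp (- a * z) * integral {0..T} (\<lambda>s. exp (- z * s) * f s)"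
proof -
  let ?F = "\<lambda>s. exp (- z * (s + a)) * f s"
  have int: "?F integrable_on {x..y}" for x y
    by (intro integrable_continuous_real continuous_intros continuous_on_subset[OF f]) auto
  have "integral {0..T} (\<lambda>s. exp (- z * s) * f (s - a)) = integral {-a..T-a} ?F"
    using integral_shift_real_ivl[of "-a" "-a" "T-a" ?F] by (simp add: algebra_simps)
  also have "\<dots> = integral {-a..0} ?F + integral {0..T-a} ?F"
    using a int by (intro Henstock_Kurzweil_Integration.integral_combine[symmetric]) auto
  also have "\<dots> = integral {0..T-a} ?F + integral {T-a..T} ?F"
  proof -
    have "integral {-a..0} ?F = integral {-a..0} (\<lambda>x. 0)"
      by (intro integral_cong) (auto simp: supp)
    moreover have "integral {T-a..T} ?F = integral {T-a..T} (\<lambda>x. 0)"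
      by (intro integral_cong) (auto simp: supp)
    ultimately show ?thesis by simp
  qed
  also have "\<dots> = integral {0..T} ?F"
    using a int by (intro Henstock_Kurzweil_Integration.integral_combine) auto
  also have "\<dots> = integral {0..T} (\<lambda>s. exp (- a * z) * (exp (- z * s) * f s))"
    by (intro integral_cong) (simp add: algebra_simps exp_add[symmetric] mult.assoc[symmetric] flip: exp_add)
  finally show ?thesis by simp
qed

lemma shift_iter_laplace:
  assumes a: "\<And>i. 0 \<le> a i" and g: "continuous_on UNIV g"
    and supp: "\<And>x. x \<le> 0 \<or> l \<le> x \<Longrightarrow> g x = 0" and l: "0 \<le> l"
    and T: "l + (\<Sum>i<n. a i) \<le> T"
  shows "integral {0..T} (\<lambda>s. exp (- z * s) * shift_iter a c g n s)
    = (\<Prod>i<n. exp (- a i * z) - c i) * integral {0..T} (\<lambda>s. exp (- z * s) * g s)"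
  using T
proof (induction n)
  case 0
  then show ?case by simp
next
  case (Suc n)
  let ?f = "shift_iter a c g n"
  have cf: "continuous_on UNIV ?f" by (rule shift_iter_continuous[OF g])
  have an: "0 \<le> a n" "l + (\<Sum>i<n. a i) \<le> T" "a n \<le> T"
    using a Suc.prems l sum_nonneg[of "{..<n}" a] by (auto intro: order.trans[OF _ Suc.prems])
  have int: "(\<lambda>s. exp (- z * s) * ?f (s - a n)) integrable_on {0..T}"
    by (intro integrable_continuous_real continuous_intros continuous_on_compose2[OF cf]) auto
  have int': "(\<lambda>s. c n * (exp (- z * s) * ?f s)) integrable_on {0..T}"
    by (intro integrable_continuous_real continuous_intros continuous_on_subset[OF cf]) auto
  have "integral {0..T} (\<lambda>s. exp (- z * s) * shift_iter a c g (Suc n) s)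
    = integral {0..T} (\<lambda>s. exp (- z * s) * ?f (s - a n) - c n * (exp (- z * s) * ?f s))"
    by (intro integral_cong) (simp add: algebra_simps)
  also have "\<dots> = integral {0..T} (\<lambda>s. exp (- z * s) * ?f (s - a n)) - c n * integral {0..T} (\<lambda>s. exp (- z * s) * ?f s)"
    using int int' by (simp add: Henstock_Kurzweil_Integration.integral_diff)
  also have "integral {0..T} (\<lambda>s. exp (- z * s) * ?f (s - a n)) = exp (- a n * z) * integral {0..T} (\<lambda>s. exp (- z * s) * ?f s)"
    using Suc.prems an by (intro laplace_shift cf shift_iter_support[OF a supp]) auto
  finally show ?case using Suc.IH an by (simp add: algebra_simps)
qed

text \<open>
  The infinite convolution. A shift by \<open>a n\<close> moves a Lipschitz function by \<open>O(a n)\<close> in the supremum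
  norm and the second term of a factor contributes \<open>O(c n)\<close>, so the partial convolutions converge
  uniformly as soon as both sequences are summable; this is why \<open>g\<close> is required to be Lipschitz.
  The product of the factors is kept as a limit, because at a zero of one factor it is eventually \<open>0\<close>
  and elsewhere it is estimated factor by factor.
\<close>

lemma convolution_kernel:
  fixes a c :: "nat \<Rightarrow> real" and g :: "real \<Rightarrow> real"
  assumes a: "\<And>i. 0 \<le> a i" and a_sum: "\<And>n. (\<Sum>i<n. a i) \<le> S"
    and c: "\<And>i. 0 \<le> c i" and c_sum: "\<And>n. (\<Sum>i<n. c i) \<le> K"
    and lip: "\<And>x y. \<bar>g x - g y\<bar> \<le> L * \<bar>x - y\<bar>" and G: "\<And>x. \<bar>g x\<bar> \<le> G"
    and supp: "\<And>x. x \<le> 0 \<or> l \<le> x \<Longrightarrow> g x = 0" and l: "0 \<le> l" and T: "l + S \<le> T"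
  obtains h where "continuous_on UNIV h" "\<And>x. \<bar>h x\<bar> \<le> G * exp K" "\<And>x. x \<le> 0 \<or> T \<le> x \<Longrightarrow> h x = 0"
    "\<And>z. (\<lambda>n. (\<Prod>i<n. exp (- a i * z) - c i) * integral {0..T} (\<lambda>s. exp (- z * s) * g s))
       \<longlonglongrightarrow> integral {0..T} (\<lambda>s. exp (- z * s) * h s)"
proof -
  define H where "H = shift_iter a c g"
  have L0: "0 \<le> L" using order.trans[OF abs_ge_zero lip[of 1 0]] by simp
  have G0: "0 \<le> G" using G[of 0] by linarith
  have gc: "continuous_on UNIV g"
    by (rule lipschitz_on_continuous_on[of L], rule lipschitz_onI) (use lip L0 in \<open>auto simp: dist_real_def\<close>)
  have Hc: "continuous_on UNIV (H n)" for n unfolding H_def by (rule shift_iter_continuous[OF gc])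
  have expK: "exp (\<Sum>i<n. c i) \<le> exp K" for n using c_sum by simp
  have HG: "\<bar>H n x\<bar> \<le> G * exp K" for n x
    unfolding H_def using shift_iter_bound[of c g G a n x, OF c G] mult_left_mono[OF expK[of n] G0] by linarith
  have HL: "\<bar>H n x - H n y\<bar> \<le> L * exp K * \<bar>x - y\<bar>" for n x y
    unfolding H_def
    using shift_iter_lipschitz[of c g L a n x y, OF c lip] mult_right_mono[OF mult_left_mono[OF expK[of n] L0], of "\<bar>x - y\<bar>"]
    by linarith
  have sa: "summable a" by (rule summableI_nonneg_bounded[OF a a_sum])
  have sc: "summable c" by (rule summableI_nonneg_bounded[OF c c_sum])
  define M where "M n = L * exp K * a n + c n * (G * exp K)" for n
  have sM: "summable M" unfolding M_def by (intro summable_add summable_mult summable_mult2 sa sc)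
  have step: "norm (H (Suc n) x - H n x) \<le> M n" for n x
  proof -
    have "H (Suc n) x - H n x = (H n (x - a n) - H n x) - c n * H n x" by (simp add: H_def)
    also have "norm \<dots> \<le> \<bar>H n (x - a n) - H n x\<bar> + c n * \<bar>H n x\<bar>"
      using c[of n] by (auto simp: abs_mult intro!: order.trans[OF abs_triangle_ineq4])
    also have "\<dots> \<le> M n" unfolding M_def
      using HL[of n "x - a n" x] mult_left_mono[OF HG[of n x] c[of n]] a[of n] by simp
    finally show ?thesis .
  qed
  define h where "h x = g x + (\<Sum>n. H (Suc n) x - H n x)" for x
  have tel: "g x + (\<Sum>i<n. H (Suc i) x - H i x) = H n x" for n x
    by (subst sum_lessThan_telescope) (simp add: H_def)
  have ul: "uniform_limit UNIV H h sequentially"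
  proof -
    have "uniform_limit UNIV (\<lambda>n x. g x + (\<Sum>i<n. H (Suc i) x - H i x)) (\<lambda>x. g x + (\<Sum>i. H (Suc i) x - H i x)) sequentially"
      using step sM by (intro uniform_limit_add uniform_limit_const Weierstrass_m_test) auto
    then show ?thesis unfolding tel h_def[symmetric, abs_def] by simp
  qed
  have ptw: "(\<lambda>n. H n x) \<longlonglongrightarrow> h x" for x
    using tendsto_uniform_limitI[OF ul] by simp
  have hc: "continuous_on UNIV h"
    by (rule uniform_limit_theorem[OF _ ul]) (use Hc in auto)
  have hb: "\<bar>h x\<bar> \<le> G * exp K" for x
    by (rule LIMSEQ_le_const2[OF tendsto_rabs[OF ptw]]) (use HG in auto)
  have T': "l + (\<Sum>i<n. a i) \<le> T" for n using a_sum[of n] T by linarith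
  have hs: "h x = 0" if "x \<le> 0 \<or> T \<le> x" for x
  proof -
    have "H n x = 0" for n unfolding H_def
      using that T'[of n] by (intro shift_iter_support[OF a supp]) auto
    then show ?thesis using ptw[of x] LIMSEQ_const_iff[of 0 "h x"] by simp
  qed
  have lim: "(\<lambda>n. (\<Prod>i<n. exp (- a i * z) - c i) * integral {0..T} (\<lambda>s. exp (- z * s) * g s))
       \<longlonglongrightarrow> integral {0..T} (\<lambda>s. exp (- z * s) * h s)" for z
  proof -
    have "bounded ((\<lambda>s. exp (- z * s)) ` {0..T})"
      by (intro compact_imp_bounded compact_continuous_image continuous_intros) auto
    moreover have "bounded (h ` {0..T})"
      using hb by (auto simp: bounded_iff)
    ultimately have ul2: "uniform_limit (cbox 0 T) (\<lambda>n s. exp (- z * s) * H n s) (\<lambda>s. exp (- z * s) * h s) sequentially"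
      using uniform_limit_on_subset[OF ul, of "cbox 0 T"]
      by (intro uniform_lim_mult uniform_limit_const) auto
    have "continuous_on (cbox 0 T) (\<lambda>s. exp (- z * s) * H n s)" for n
      by (intro continuous_intros continuous_on_subset[OF Hc]) auto
    then have "(\<lambda>n. integral {0..T} (\<lambda>s. exp (- z * s) * H n s)) \<longlonglongrightarrow> integral {0..T} (\<lambda>s. exp (- z * s) * h s)"
      using ul2 by (intro integral_uniform_limit) auto
    moreover have "integral {0..T} (\<lambda>s. exp (- z * s) * H n s)
      = (\<Prod>i<n. exp (- a i * z) - c i) * integral {0..T} (\<lambda>s. exp (- z * s) * g s)" for n
      unfolding H_def by (rule shift_iter_laplace[OF a gc supp l T'])
    ultimately show ?thesis by simp
  qed
  show ?thesis using that[of h] hc hb hs lim by blast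
qed

section \<open>A moment problem for exponentials\<close>

text \<open>
  The fourth power suits arguments \<open>x\<close> that grow like \<open>\<sigma> sqrt m\<close>: then \<open>64 / x\<^sup>4\<close> is summable over \<open>m\<close>,
  with a sum of order \<open>1 / \<sigma>\<^sup>4\<close>.
\<close>

lemma one_minus_exp_lower:
  fixes x :: real
  assumes "0 < x"
  shows "exp (- (64 / x ^ 4)) \<le> 1 - exp (- x)" and "exp (- x) \<le> 64 / x ^ 4"
proof -
  define y where "y = x ^ 4 / 64"
  have y: "0 < y" using assms by (simp add: y_def)
  have "1 + y \<le> (1 + x / 2 + (x / 2)\<^sup>2 / 2)\<^sup>2"
    using assms by (simp add: y_def power2_eq_square field_simps power4_eq_xxxx)
  also have "\<dots> \<le> (exp (x / 2))\<^sup>2"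
    using assms by (intro power_mono exp_lower_Taylor_quadratic) auto
  also have "\<dots> = exp x" by (simp flip: exp_double)
  finally have e: "1 + y \<le> exp x" .
  have "exp (- x) \<le> 1 / (1 + y)"
    using e y by (simp add: exp_minus field_simps)
  moreover have "1 / (1 + y) \<le> 1 / y" using y by (simp add: field_simps)
  moreover have "exp (- (1 / y)) \<le> 1 - 1 / (1 + y)"
  proof -
    have "1 + 1 / y \<le> exp (1 / y)" by (rule exp_ge_add_one_self)
    then have "1 / exp (1 / y) \<le> 1 / (1 + 1 / y)"
      using y by (intro divide_left_mono mult_pos_pos) (auto intro: add_pos_pos)
    also have "\<dots> = 1 - 1 / (1 + y)" using y by (simp add: field_simps)
    finally show ?thesis by (simp add: exp_minus inverse_eq_divide)
  qed
  ultimately show "exp (- (64 / x ^ 4)) \<le> 1 - exp (- x)" "exp (- x) \<le> 64 / x ^ 4"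
    by (auto simp: y_def)
qed

lemma exp_diff_lower:
  fixes u v :: real
  shows "exp (- u) * (1 - exp (- \<bar>u - v\<bar>)) \<le> \<bar>exp (- u) - exp (- v)\<bar>"
proof (cases "u \<le> v")
  case True
  then have "exp (- u) * exp (- \<bar>u - v\<bar>) = exp (- v)" by (simp flip: exp_add)
  then show ?thesis by (simp add: algebra_simps)
next
  case False
  then have *: "exp (- v) * exp (- \<bar>u - v\<bar>) = exp (- u)" by (simp flip: exp_add)
  have "exp (- u) * (1 - exp (- \<bar>u - v\<bar>)) \<le> exp (- v) * (1 - exp (- \<bar>u - v\<bar>))"
    using False by (intro mult_right_mono) auto
  also have "\<dots> = exp (- v) - exp (- u)" using * by (simp add: algebra_simps)
  finally show ?thesis by linarith
qed

text \<open>
  Because of truncated subtraction and \<open>f 0 = 0\<close>, the term \<open>f (k - i) + f (i - k)\<close> is \<open>f \<bar>i - k\<bar>\<close>.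
\<close>

lemma two_sided_sum_le:
  fixes f :: "nat \<Rightarrow> real"
  assumes f: "\<And>m. 0 \<le> f m" "f 0 = 0" "summable f"
  shows "(\<Sum>i<n. f (i - k)) \<le> suminf f" and "(\<Sum>i<n. f (k - i) + f (i - k)) \<le> 2 * suminf f"
proof -
  have "(\<Sum>i<n. f (i - k)) = (\<Sum>m<n - k. f m)"
  proof (induction n)
    case (Suc n)
    then show ?case by (cases "n < k") (auto simp: f(2) Suc_diff_le)
  qed simp
  then show 1: "(\<Sum>i<n. f (i - k)) \<le> suminf f"
    using f by (simp add: sum_le_suminf)
  have "(\<Sum>i<n. f (k - i)) \<le> (\<Sum>i<n + k. f (k - i))"
    using f by (intro sum_mono2) auto
  also have "\<dots> = (\<Sum>i<k. f (k - i))"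
    using f by (intro sum.mono_neutral_right) auto
  also have "\<dots> = (\<Sum>i<k. f (Suc (k - Suc i)))"
    by (intro sum.cong) (auto simp: Suc_diff_Suc)
  also have "\<dots> = (\<Sum>i<k. f (Suc i))"
    by (rule sum.nat_diff_reindex[of "\<lambda>i. f (Suc i)"])
  also have "\<dots> = (\<Sum>i<Suc k. f i)" using f(2) sum.lessThan_Suc_shift[of f k] by simp
  also have "\<dots> \<le> suminf f" using f by (intro sum_le_suminf) auto
  finally show "(\<Sum>i<n. f (k - i) + f (i - k)) \<le> 2 * suminf f"
    using 1 by (simp add: sum.distrib)
qed

text \<open>
  The tent is at least \<open>l / 4\<close> on the middle half of its support.
\<close>

lemma laplace_tent_lower:
  fixes z l T :: real
  assumes "0 \<le> z" "0 < l" "l \<le> T"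
  shows "exp (- (z * l)) * (l\<^sup>2 / 8) \<le> integral {0..T} (\<lambda>s. exp (- z * s) * max 0 (min s (l - s)))"
proof -
  let ?f = "\<lambda>s. exp (- z * s) * max 0 (min s (l - s))"
  have int: "?f integrable_on {x..y}" for x y
    by (intro integrable_continuous_real continuous_intros)
  have "exp (- (z * l)) * (l\<^sup>2 / 8) = integral {l/4..3*l/4} (\<lambda>s. exp (- (z * l)) * (l / 4))"
    using assms by (simp add: power2_eq_square field_simps)
  also have "\<dots> \<le> integral {l/4..3*l/4} ?f"
  proof (rule integral_le)
    fix s assume s: "s \<in> {l/4..3*l/4}"
    then have "z * s \<le> z * l" using assms by (intro mult_left_mono) auto
    then show "exp (- (z * l)) * (l / 4) \<le> ?f s"
      using s assms by (intro mult_mono) auto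
  qed (use int in auto)
  also have "\<dots> \<le> integral {0..T} ?f"
    using assms int by (intro integral_subset_le) auto
  finally show ?thesis .
qed

text \<open>
  For fixed \<open>k\<close>, convolve a tent with factors that vanish at \<open>\<mu> i\<close> for all \<open>i \<noteq> k\<close> and divide by the
  value of the Laplace transform at \<open>\<mu> k\<close>. The shifts \<open>a i\<close> are multiples of
  \<open>\<tau> \<bar>i - k\<bar> powr (- 3/2)\<close>. This decay is fast enough for the sum of the shifts to be at most \<open>\<tau> / 4\<close>
  and slow enough for \<open>a i \<bar>\<mu> i - \<mu> k\<bar>\<close> to grow like \<open>\<tau> sqrt \<bar>i - k\<bar>\<close>, by the gap condition. The first
  property costs at most \<open>exp (\<mu> k \<tau> / 4)\<close> in the transform at \<open>\<mu> k\<close>, and the second keeps the remaining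
  product above \<open>exp (- const / \<tau>\<^sup>4)\<close>. The numbers \<open>c i\<close> are at most \<open>1\<close> for \<open>i < k\<close>, which accounts for
  the factor \<open>exp k\<close>.
\<close>

lemma biorthogonal_family:
  fixes \<mu> :: "nat \<Rightarrow> real" and \<alpha> :: real
  assumes \<alpha>: "0 < \<alpha>" and pos: "\<And>k. 0 \<le> \<mu> k" and mono: "\<And>i k. i \<le> k \<Longrightarrow> \<mu> i \<le> \<mu> k"
    and gap: "\<And>i k. i \<le> k \<Longrightarrow> \<alpha> * (real (k - i))\<^sup>2 \<le> \<mu> k - \<mu> i"
  obtains K where "0 < K" "\<And>\<tau> k. 0 < \<tau> \<Longrightarrow> \<exists>q. continuous_on UNIV q \<and> (\<forall>x. x \<le> 0 \<or> \<tau> \<le> x \<longrightarrow> q x = 0) \<and>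
      (\<forall>x. \<bar>q x\<bar> \<le> 16 / \<tau> * exp (k + K / \<tau> ^ 4 + \<mu> k * \<tau> / 2)) \<and>
      (\<forall>j. integral {0..\<tau>} (\<lambda>s. exp (- \<mu> j * s) * q s) = (if j = k then 1 else 0))"
proof -
  define r where "r m = 1 / (real m * sqrt (real m))" for m
  define w where "w m = 1 / (real m)\<^sup>2" for m
  have r: "0 \<le> r m" "r 0 = 0" and w: "0 \<le> w m" "w 0 = 0" for m by (auto simp: r_def w_def)
  have rs: "summable r"
  proof -
    have "r m = 1 / real m powr (3/2)" for m
    proof (cases "m = 0")
      case False
      then have "real m powr (3/2) = real m powr 1 * real m powr (1/2)"
        using powr_add[of "real m" 1 "1/2"] by simp
      then show ?thesis using False by (simp add: r_def powr_half_sqrt)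
    qed (simp add: r_def)
    then have "r = (\<lambda>m. 1 / real m powr (3/2))" by blast
    then show ?thesis
      using summable_real_powr_iff[of "-(3/2)"] by (simp add: powr_minus inverse_eq_divide)
  qed
  have ws: "summable w" unfolding w_def using inverse_power_summable[of 2] by (simp add: inverse_eq_divide)
  define Z W where "Z = suminf r" and "W = suminf w"
  have Z: "0 < Z" unfolding Z_def using suminf_pos2[OF rs r(1), of 1] by (simp add: r_def[of "Suc 0"])
  have W: "0 < W" unfolding W_def using suminf_pos2[OF ws w(1), of 1] by (simp add: w_def[of "Suc 0"])
  define \<sigma> where "\<sigma> \<tau> = \<tau> / (8 * Z) * \<alpha>" for \<tau> :: real
  define K where "K = 192 * W / (\<alpha> / (8 * Z)) ^ 4"
  have "0 < K" unfolding K_def using W Z \<alpha> by simp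
  moreover have "\<exists>q. continuous_on UNIV q \<and> (\<forall>x. x \<le> 0 \<or> \<tau> \<le> x \<longrightarrow> q x = 0) \<and>
      (\<forall>x. \<bar>q x\<bar> \<le> 16 / \<tau> * exp (k + K / \<tau> ^ 4 + \<mu> k * \<tau> / 2)) \<and>
      (\<forall>j. integral {0..\<tau>} (\<lambda>s. exp (- \<mu> j * s) * q s) = (if j = k then 1 else 0))"
    if \<tau>: "0 < \<tau>" for \<tau> k
  proof -
    \<comment> \<open>At \<open>i = k\<close> both \<open>a i\<close> and \<open>c i\<close> are \<open>0\<close>, so the factor that would vanish at \<open>\<mu> k\<close> is \<open>1\<close>.\<close>
    define a where "a i = \<tau> / (8 * Z) * (r (k - i) + r (i - k))" for i
    define c where "c i = (if i = k then 0 else exp (- (a i * \<mu> i)))" for i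
    have \<sigma>: "0 < \<sigma> \<tau>" unfolding \<sigma>_def using \<tau> Z \<alpha> by simp
    have a0: "0 \<le> a i" for i unfolding a_def using r \<tau> Z by simp
    have c0: "0 \<le> c i" for i by (simp add: c_def)
    have a_sum: "(\<Sum>i<n. a i) \<le> \<tau> / 4" for n
    proof -
      have "(\<Sum>i<n. a i) = \<tau> / (8 * Z) * (\<Sum>i<n. r (k - i) + r (i - k))"
        by (simp add: a_def sum_distrib_left)
      also have "\<dots> \<le> \<tau> / (8 * Z) * (2 * Z)"
        using two_sided_sum_le(2)[OF r rs] \<tau> Z by (intro mult_left_mono) (auto simp: Z_def)
      finally show ?thesis using Z by simp
    qed
    have key: "\<sigma> \<tau> * sqrt (real m) \<le> \<tau> / (8 * Z) * r m * d"
      if "0 < m" "\<alpha> * (real m)\<^sup>2 \<le> d" for m d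
    proof -
      have "r m * (real m)\<^sup>2 = sqrt (real m)"
        using that by (simp add: r_def power2_eq_square field_simps flip: real_sqrt_mult)
      then have "\<sigma> \<tau> * sqrt (real m) = \<tau> / (8 * Z) * r m * (\<alpha> * (real m)\<^sup>2)"
        by (simp add: \<sigma>_def)
      also have "\<dots> \<le> \<tau> / (8 * Z) * r m * d"
        using that \<tau> Z r by (intro mult_left_mono) auto
      finally show ?thesis .
    qed
    have sep: "\<sigma> \<tau> * sqrt (real (k - i) + real (i - k)) \<le> a i * \<bar>\<mu> k - \<mu> i\<bar>" if "i \<noteq> k" for i
    proof (cases "i < k")
      case True
      then show ?thesis using key[of "k - i" "\<bar>\<mu> k - \<mu> i\<bar>"] gap[of i k] by (simp add: a_def r)
    next
      case False
      then show ?thesis using key[of "i - k" "\<bar>\<mu> k - \<mu> i\<bar>"] gap[of k i] that by (simp add: a_def r)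
    qed
    have pw: "(\<sigma> \<tau> * sqrt (real (k - i) + real (i - k))) ^ 4 = \<sigma> \<tau> ^ 4 / (w (k - i) + w (i - k))" for i
    proof -
      have "sqrt (real m) ^ 4 = (real m)\<^sup>2" for m :: nat
        by (metis of_nat_0_le_iff power_mult real_sqrt_pow2 numeral_Bit0 mult_2 numeral_plus_numeral semiring_norm(2))
      then show ?thesis
        by (cases "i < k") (auto simp: power_mult_distrib w_def simp del: of_nat_diff)
    qed
    define \<Sigma> where "\<Sigma> i = 64 * (w (k - i) + w (i - k)) / \<sigma> \<tau> ^ 4" for i
    have sepp: "0 < \<sigma> \<tau> * sqrt (real (k - i) + real (i - k))" if "i \<noteq> k" for i
      using that \<sigma> by auto
    have \<Sigma>: "64 / (\<sigma> \<tau> * sqrt (real (k - i) + real (i - k))) ^ 4 = \<Sigma> i" for i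
      unfolding pw \<Sigma>_def by simp
    have \<Sigma>_sum: "(\<Sum>i<n. \<Sigma> i) \<le> 128 * W / \<sigma> \<tau> ^ 4" for n
    proof -
      have "(\<Sum>i<n. \<Sigma> i) = 64 / \<sigma> \<tau> ^ 4 * (\<Sum>i<n. w (k - i) + w (i - k))"
        by (simp add: \<Sigma>_def sum_distrib_left)
      also have "\<dots> \<le> 64 / \<sigma> \<tau> ^ 4 * (2 * W)"
        using two_sided_sum_le(2)[OF w ws] \<sigma> by (intro mult_left_mono) (auto simp: W_def)
      finally show ?thesis by simp
    qed
    have fac: "exp (- (a i * \<mu> k)) * exp (- \<Sigma> i) \<le> \<bar>exp (- a i * \<mu> k) - c i\<bar>" for i
    proof (cases "i = k")
      case True
      then show ?thesis by (simp add: c_def a_def \<Sigma>_def r w)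
    next
      case False
      have "exp (- \<Sigma> i) \<le> 1 - exp (- (\<sigma> \<tau> * sqrt (real (k - i) + real (i - k))))"
        using one_minus_exp_lower(1)[OF sepp[OF False]] unfolding \<Sigma> by simp
      also have "\<dots> \<le> 1 - exp (- \<bar>a i * \<mu> k - a i * \<mu> i\<bar>)"
        using sep[OF False] a0[of i] by (simp add: abs_mult flip: right_diff_distrib)
      finally have "exp (- (a i * \<mu> k)) * exp (- \<Sigma> i) \<le> exp (- (a i * \<mu> k)) * (1 - exp (- \<bar>a i * \<mu> k - a i * \<mu> i\<bar>))"
        by (intro mult_left_mono) auto
      also have "\<dots> \<le> \<bar>exp (- a i * \<mu> k) - c i\<bar>"
        using exp_diff_lower[of "a i * \<mu> k" "a i * \<mu> i"] False by (simp add: c_def)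
      finally show ?thesis .
    qed
    have c_sum: "(\<Sum>i<n. c i) \<le> k + 64 * W / \<sigma> \<tau> ^ 4" for n
    proof -
      have "c i \<le> (if i < k then 1 else 0) + 64 / \<sigma> \<tau> ^ 4 * w (i - k)" for i
      proof (cases "i \<le> k")
        case True
        then show ?thesis using a0[of i] pos[of i] w \<sigma> by (auto simp: c_def)
      next
        case False
        have "c i = exp (- (a i * \<mu> i))" using False by (simp add: c_def)
        also have "\<dots> \<le> exp (- (\<sigma> \<tau> * sqrt (real (k - i) + real (i - k))))"
        proof -
          have "a i * \<bar>\<mu> k - \<mu> i\<bar> \<le> a i * \<mu> i"
            using a0[of i] pos[of k] mono[of k i] False by (intro mult_left_mono) auto
          then show ?thesis using sep[of i] False by simp
        qed
        also have "\<dots> \<le> \<Sigma> i"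
          using one_minus_exp_lower(2)[OF sepp, of i] False unfolding \<Sigma> by simp
        finally show ?thesis using False by (simp add: \<Sigma>_def w)
      qed
      then have "(\<Sum>i<n. c i) \<le> (\<Sum>i<n. (if i < k then 1 else 0) + 64 / \<sigma> \<tau> ^ 4 * w (i - k))"
        by (intro sum_mono) auto
      also have "\<dots> = real (card ({..<n} \<inter> {..<k})) + 64 / \<sigma> \<tau> ^ 4 * (\<Sum>i<n. w (i - k))"
        by (simp add: sum.distrib sum_distrib_left flip: sum.inter_filter) (auto intro!: arg_cong[of _ _ card])
      also have "\<dots> \<le> k + 64 / \<sigma> \<tau> ^ 4 * W"
      proof (intro add_mono mult_left_mono)
        show "real (card ({..<n} \<inter> {..<k})) \<le> real k"
          using card_mono[of "{..<k}" "{..<n} \<inter> {..<k}"] by simp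
      qed (use two_sided_sum_le(1)[OF w ws] \<sigma> in \<open>auto simp: W_def\<close>)
      finally show ?thesis by simp
    qed
    \<comment> \<open>The tent on \<open>[0, \<tau> / 4]\<close> and shifts of total length at most \<open>\<tau> / 4\<close> leave the support inside \<open>[0, \<tau>]\<close>.\<close>
    define l where "l = \<tau> / 4"
    define g where "g s = max 0 (min s (l - s))" for s :: real
    have l: "0 < l" using \<tau> by (simp add: l_def)
    have gL: "\<bar>g x - g y\<bar> \<le> 1 * \<bar>x - y\<bar>" for x y
      by (auto simp: g_def max_def min_def)
    have gG: "\<bar>g x\<bar> \<le> l / 2" for x
      using l by (auto simp: g_def max_def min_def)
    have gs: "g x = 0" if "x \<le> 0 \<or> l \<le> x" for x
      using l that by (auto simp: g_def max_def min_def)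
    have l': "0 \<le> l" "l + \<tau> / 4 \<le> \<tau>" using \<tau> by (auto simp: l_def)
    obtain h where h: "continuous_on UNIV h"
      "\<And>x. \<bar>h x\<bar> \<le> l / 2 * exp (k + 64 * W / \<sigma> \<tau> ^ 4)" "\<And>x. x \<le> 0 \<or> \<tau> \<le> x \<Longrightarrow> h x = 0"
      and lim: "\<And>z. (\<lambda>n. (\<Prod>i<n. exp (- a i * z) - c i) * integral {0..\<tau>} (\<lambda>s. exp (- z * s) * g s))
       \<longlonglongrightarrow> integral {0..\<tau>} (\<lambda>s. exp (- z * s) * h s)"
      by (rule convolution_kernel[OF a0 a_sum c0 c_sum gL gG gs l']) (assumption, rule that, blast+)
    define I where "I j = integral {0..\<tau>} (\<lambda>s. exp (- \<mu> j * s) * h s)" for j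
    have I0: "I j = 0" if "j \<noteq> k" for j
    proof -
      have "\<forall>\<^sub>F n in sequentially. (\<Prod>i<n. exp (- a i * \<mu> j) - c i) * integral {0..\<tau>} (\<lambda>s. exp (- \<mu> j * s) * g s) = 0"
        using eventually_gt_at_top[of j]
      proof eventually_elim
        case (elim n)
        have "exp (- a j * \<mu> j) - c j = 0" using that by (simp add: c_def)
        then have "(\<Prod>i<n. exp (- a i * \<mu> j) - c i) = 0"
          using elim by (intro prod_zero) auto
        then show ?case by simp
      qed
      from LIMSEQ_unique[OF lim tendsto_eventually[OF this]] show ?thesis
        unfolding I_def .
    qed
    define low where "low = exp (- (\<mu> k * \<tau> / 2) - 128 * W / \<sigma> \<tau> ^ 4) * (l\<^sup>2 / 8)"
    have lowpos: "0 < low" using l by (simp add: low_def)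
    have "low \<le> \<bar>(\<Prod>i<n. exp (- a i * \<mu> k) - c i) * integral {0..\<tau>} (\<lambda>s. exp (- \<mu> k * s) * g s)\<bar>" for n
    proof -
      have "exp (- (\<mu> k * (\<tau> / 4)) - 128 * W / \<sigma> \<tau> ^ 4) \<le> exp (- (\<mu> k * (\<Sum>i<n. a i)) - (\<Sum>i<n. \<Sigma> i))"
        using \<Sigma>_sum[of n] mult_left_mono[OF a_sum[of n] pos[of k]] by simp
      also have "\<dots> = exp (\<Sum>i<n. - (a i * \<mu> k) + - \<Sigma> i)"
        by (simp add: sum.distrib sum_negf sum_subtractf sum_distrib_left mult.commute)
      also have "\<dots> = (\<Prod>i<n. exp (- (a i * \<mu> k)) * exp (- \<Sigma> i))"
        by (simp only: exp_sum[OF finite_lessThan] exp_add)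
      also have "\<dots> \<le> (\<Prod>i<n. \<bar>exp (- a i * \<mu> k) - c i\<bar>)"
        using fac by (intro prod_mono) auto
      finally have "exp (- (\<mu> k * (\<tau> / 4)) - 128 * W / \<sigma> \<tau> ^ 4) * (exp (- (\<mu> k * l)) * (l\<^sup>2 / 8))
          \<le> (\<Prod>i<n. \<bar>exp (- a i * \<mu> k) - c i\<bar>) * \<bar>integral {0..\<tau>} (\<lambda>s. exp (- \<mu> k * s) * g s)\<bar>"
        using laplace_tent_lower[of "\<mu> k" l \<tau>] pos[of k] l \<tau>
        by (intro mult_mono prod_nonneg) (auto simp: g_def l_def intro: order.trans)
      moreover have "low = exp (- (\<mu> k * (\<tau> / 4)) - 128 * W / \<sigma> \<tau> ^ 4) * (exp (- (\<mu> k * l)) * (l\<^sup>2 / 8))"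
        unfolding low_def l_def mult.assoc[symmetric] exp_add[symmetric] by (simp add: algebra_simps)
      ultimately show ?thesis by (simp add: abs_mult abs_prod)
    qed
    then have Ik: "low \<le> \<bar>I k\<bar>"
      unfolding I_def by (intro LIMSEQ_le_const[OF tendsto_rabs[OF lim[of "\<mu> k"]]]) auto
    have Kk: "64 * W / \<sigma> \<tau> ^ 4 + 128 * W / \<sigma> \<tau> ^ 4 = K / \<tau> ^ 4"
      using \<tau> Z \<alpha> by (simp add: K_def \<sigma>_def field_simps)
    have bd: "\<bar>h x / I k\<bar> \<le> 16 / \<tau> * exp (k + K / \<tau> ^ 4 + \<mu> k * \<tau> / 2)" for x
    proof -
      have "\<bar>h x / I k\<bar> \<le> (l / 2 * exp (k + 64 * W / \<sigma> \<tau> ^ 4)) / low"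
        unfolding abs_divide using h(2) Ik lowpos l by (intro frac_le) auto
      also have "\<dots> = 4 / l * (exp (k + 64 * W / \<sigma> \<tau> ^ 4) / exp (- (\<mu> k * \<tau> / 2) - 128 * W / \<sigma> \<tau> ^ 4))"
        using l by (simp add: low_def field_simps power2_eq_square)
      also have "\<dots> = 16 / \<tau> * exp (k + K / \<tau> ^ 4 + \<mu> k * \<tau> / 2)"
        unfolding exp_diff[symmetric] Kk[symmetric] by (simp add: l_def algebra_simps)
      finally show ?thesis .
    qed
    have ne: "I k \<noteq> 0" using Ik lowpos by auto
    have "integral {0..\<tau>} (\<lambda>s. exp (- \<mu> j * s) * (h s / I k)) = (if j = k then 1 else 0)" for j
    proof -
      have "integral {0..\<tau>} (\<lambda>s. exp (- \<mu> j * s) * (h s / I k)) = I j / I k"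
        by (simp add: I_def)
      then show ?thesis using I0 ne by auto
    qed
    then show ?thesis
      using h bd ne by (intro exI[of _ "\<lambda>x. h x / I k"]) (auto intro!: continuous_intros)
  qed
  ultimately show ?thesis using that[of K] by blast
qed

text \<open>
  The free decay \<open>exp (- \<mu> \<tau>)\<close> is split into quarters: two compensate the growth \<open>exp (\<mu> \<tau> / 2)\<close> of the
  biorthogonal family, one absorbs the polynomial weight, and the last one, by \<open>\<mu> \<ge> \<alpha> k\<^sup>2\<close>, absorbs
  \<open>exp k\<close> with room for a summable factor. Everything that remains depends on \<open>\<tau>\<close> only and is at most
  \<open>exp (const / \<tau>\<^sup>4)\<close> for \<open>\<tau> \<le> 1\<close>.
\<close>

lemma moment_weight_bound:
  fixes \<mu> \<tau> q \<alpha> K :: real and k :: nat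
  assumes \<tau>: "0 < \<tau>" "\<tau> \<le> 1" and \<alpha>: "0 < \<alpha>" and q: "0 < q" and K: "0 < K" and \<mu>: "\<alpha> * (real k)\<^sup>2 \<le> \<mu>"
  shows "exp (- \<mu> * \<tau>) * (1 + \<mu>) powr q * (16 / \<tau> * exp (k + K / \<tau> ^ 4 + \<mu> * \<tau> / 2))
    \<le> exp ((K + 17 + 4 * q\<^sup>2 + 4 / \<alpha>) / \<tau> ^ 4) * (1/2) ^ k"
proof -
  have \<mu>0: "0 \<le> \<mu>" using \<mu> \<alpha> by (meson order.trans mult_nonneg_nonneg less_imp_le zero_le_power2)
  have inv: "1 / \<tau> \<le> 1 / \<tau> ^ 4" "1 \<le> 1 / \<tau> ^ 4"
  proof -
    have "\<tau> ^ 4 \<le> \<tau> ^ 1" using \<tau> by (intro power_decreasing) auto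
    then show "1 / \<tau> \<le> 1 / \<tau> ^ 4" using \<tau> by (intro divide_left_mono) auto
    then show "1 \<le> 1 / \<tau> ^ 4" using \<tau> by (smt (verit) le_divide_eq_1)
  qed
  have "16 / \<tau> \<le> exp (16 / \<tau>)" using exp_ge_add_one_self[of "16 / \<tau>"] by linarith
  have "q * ln (1 + \<mu>) \<le> (1 + \<mu>) * \<tau> / 4 + 4 * q\<^sup>2 / \<tau>"
  proof -
    have "ln (1 + \<mu>) = ln ((1 + \<mu>) * \<tau> / (4 * q)) + ln (4 * q / \<tau>)"
      using \<mu>0 \<tau> q ln_mult_pos[of "(1 + \<mu>) * \<tau> / (4 * q)" "4 * q / \<tau>"] by simp
    also have "\<dots> \<le> (1 + \<mu>) * \<tau> / (4 * q) + 4 * q / \<tau>"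
      using \<mu>0 \<tau> q by (intro add_mono ln_bound) auto
    finally have "q * ln (1 + \<mu>) \<le> q * ((1 + \<mu>) * \<tau> / (4 * q) + 4 * q / \<tau>)"
      using q by (intro mult_left_mono) auto
    also have "\<dots> = (1 + \<mu>) * \<tau> / 4 + 4 * q\<^sup>2 / \<tau>"
      using q \<tau> by (simp add: field_simps power2_eq_square)
    finally show ?thesis .
  qed
  then have pw: "(1 + \<mu>) powr q \<le> exp ((1 + \<mu>) * \<tau> / 4 + 4 * q\<^sup>2 / \<tau>)"
    using \<mu>0 by (simp add: powr_def mult.commute)
  \<comment> \<open>The square in the proof is completed so that its mixed term is \<open>2 k\<close>.\<close>
  have k2: "2 * real k \<le> \<mu> * \<tau> / 4 + 4 / (\<alpha> * \<tau>)"
  proof -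
    have "0 \<le> (\<alpha> * \<tau> * real k - 4)\<^sup>2 / (4 * (\<alpha> * \<tau>))" using \<alpha> \<tau> by simp
    also have "\<dots> = \<alpha> * (real k)\<^sup>2 * \<tau> / 4 + 4 / (\<alpha> * \<tau>) - 2 * real k"
      using \<alpha> \<tau> by (simp add: field_simps power2_eq_square)
    finally show ?thesis using mult_right_mono[OF \<mu>, of \<tau>] \<tau> by linarith
  qed
  have half: "exp (- real k) \<le> (1/2) ^ k"
  proof -
    have "exp (- 1) \<le> (1/2 :: real)"
      using exp_ge_add_one_self[of 1] by (simp add: exp_minus field_simps)
    then have "exp (- 1) ^ k \<le> (1/2 :: real) ^ k" by (intro power_mono) auto
    then show ?thesis by (simp flip: exp_of_nat_mult)
  qed
  have "exp (- \<mu> * \<tau>) * (1 + \<mu>) powr q * (16 / \<tau> * exp (k + K / \<tau> ^ 4 + \<mu> * \<tau> / 2))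
    \<le> exp (- \<mu> * \<tau>) * exp ((1 + \<mu>) * \<tau> / 4 + 4 * q\<^sup>2 / \<tau>) * (exp (16 / \<tau>) * exp (k + K / \<tau> ^ 4 + \<mu> * \<tau> / 2))"
    using pw \<open>16 / \<tau> \<le> exp (16 / \<tau>)\<close> \<tau> by (intro mult_mono) auto
  also have "\<dots> = exp (- \<mu> * \<tau> + ((1 + \<mu>) * \<tau> / 4 + 4 * q\<^sup>2 / \<tau>) + (16 / \<tau> + (k + K / \<tau> ^ 4 + \<mu> * \<tau> / 2)))"
    by (simp only: exp_add)
  also have "\<dots> \<le> exp ((K + 17 + 4 * q\<^sup>2 + 4 / \<alpha>) / \<tau> ^ 4 - real k)"
  proof -
    have "16 / \<tau> \<le> 16 / \<tau> ^ 4" "4 * q\<^sup>2 / \<tau> \<le> 4 * q\<^sup>2 / \<tau> ^ 4" "4 / (\<alpha> * \<tau>) \<le> 4 / \<alpha> / \<tau> ^ 4"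
      using mult_left_mono[OF inv(1), of 16] mult_left_mono[OF inv(1), of "4 * q\<^sup>2"]
        mult_left_mono[OF inv(1), of "4 / \<alpha>"] \<alpha> by auto
    moreover have "\<tau> / 4 \<le> 1 / \<tau> ^ 4" using inv(2) \<tau> by linarith
    moreover have "(K + 17 + 4 * q\<^sup>2 + 4 / \<alpha>) / \<tau> ^ 4
      = K / \<tau> ^ 4 + 16 / \<tau> ^ 4 + 1 / \<tau> ^ 4 + 4 * q\<^sup>2 / \<tau> ^ 4 + 4 / \<alpha> / \<tau> ^ 4"
      by (simp add: add_divide_distrib)
    moreover have "- \<mu> * \<tau> + ((1 + \<mu>) * \<tau> / 4) + \<mu> * \<tau> / 2 = \<tau> / 4 - \<mu> * \<tau> / 4"
      by (simp add: field_simps)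
    ultimately have "- \<mu> * \<tau> + ((1 + \<mu>) * \<tau> / 4 + 4 * q\<^sup>2 / \<tau>) + (16 / \<tau> + (k + K / \<tau> ^ 4 + \<mu> * \<tau> / 2))
      \<le> (K + 17 + 4 * q\<^sup>2 + 4 / \<alpha>) / \<tau> ^ 4 - real k"
      using k2 by linarith
    then show ?thesis by simp
  qed
  also have "\<dots> = exp ((K + 17 + 4 * q\<^sup>2 + 4 / \<alpha>) / \<tau> ^ 4) * exp (- real k)"
    by (simp flip: exp_add)
  also have "\<dots> \<le> exp ((K + 17 + 4 * q\<^sup>2 + 4 / \<alpha>) / \<tau> ^ 4) * (1/2) ^ k"
    using half by (intro mult_left_mono) auto
  finally show ?thesis .
qed

text \<open>
  The solution is the series of the biorthogonal functions weighted with the prescribed moments, read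
  backwards in time. It converges uniformly by the preceding bound.
\<close>

lemma moment_problem:
  fixes \<mu> :: "nat \<Rightarrow> real" and \<alpha> q :: real
  assumes \<alpha>: "0 < \<alpha>" and pos: "\<And>k. 0 \<le> \<mu> k" and mono: "\<And>i k. i \<le> k \<Longrightarrow> \<mu> i \<le> \<mu> k"
    and gap: "\<And>i k. i \<le> k \<Longrightarrow> \<alpha> * (real (k - i))\<^sup>2 \<le> \<mu> k - \<mu> i" and q: "0 < q"
  obtains C where "0 < C" "\<And>\<tau> v M. 0 < \<tau> \<Longrightarrow> \<tau> \<le> 1 \<Longrightarrow> (\<And>k. \<bar>v k\<bar> \<le> M * (1 + \<mu> k) powr q) \<Longrightarrow>
    \<exists>p. continuous_on UNIV p \<and> (\<forall>x. x \<le> 0 \<or> \<tau> \<le> x \<longrightarrow> p x = 0) \<and> (\<forall>x. \<bar>p x\<bar> \<le> M * exp (C / \<tau> ^ 4)) \<and>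
      (\<forall>k. integral {0..\<tau>} (\<lambda>s. exp (- \<mu> k * (\<tau> - s)) * p s) = exp (- \<mu> k * \<tau>) * v k)"
proof -
  obtain K where K: "0 < K" and bio: "\<And>\<tau> k. 0 < \<tau> \<Longrightarrow> \<exists>q. continuous_on UNIV q \<and> (\<forall>x. x \<le> 0 \<or> \<tau> \<le> x \<longrightarrow> q x = 0) \<and>
      (\<forall>x. \<bar>q x\<bar> \<le> 16 / \<tau> * exp (k + K / \<tau> ^ 4 + \<mu> k * \<tau> / 2)) \<and>
      (\<forall>j. integral {0..\<tau>} (\<lambda>s. exp (- \<mu> j * s) * q s) = (if j = k then 1 else 0))"
    by (rule biorthogonal_family[OF \<alpha> pos mono gap]) (assumption, assumption, rule that, blast+)
  define C1 where "C1 = K + 17 + 4 * q\<^sup>2 + 4 / \<alpha>"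
  define C where "C = C1 + 1"
  have C: "0 < C" 
  proof -
    have "0 < 4 / \<alpha>" "0 \<le> 4 * q\<^sup>2" using \<alpha> by auto
    then show ?thesis unfolding C_def C1_def using K by linarith
  qed
  have "\<exists>p. continuous_on UNIV p \<and> (\<forall>x. x \<le> 0 \<or> \<tau> \<le> x \<longrightarrow> p x = 0) \<and> (\<forall>x. \<bar>p x\<bar> \<le> M * exp (C / \<tau> ^ 4)) \<and>
      (\<forall>k. integral {0..\<tau>} (\<lambda>s. exp (- \<mu> k * (\<tau> - s)) * p s) = exp (- \<mu> k * \<tau>) * v k)"
    if \<tau>: "0 < \<tau>" "\<tau> \<le> 1" and v: "\<And>k. \<bar>v k\<bar> \<le> M * (1 + \<mu> k) powr q" for \<tau> v M
  proof -
    have "\<forall>k. \<exists>q. continuous_on UNIV q \<and> (\<forall>x. x \<le> 0 \<or> \<tau> \<le> x \<longrightarrow> q x = 0) \<and>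
      (\<forall>x. \<bar>q x\<bar> \<le> 16 / \<tau> * exp (k + K / \<tau> ^ 4 + \<mu> k * \<tau> / 2)) \<and>
      (\<forall>j. integral {0..\<tau>} (\<lambda>s. exp (- \<mu> j * s) * q s) = (if j = k then 1 else 0))"
      by (intro allI bio[OF \<tau>(1)])
    from choice[OF this] obtain Q where Q_all: "\<forall>k. continuous_on UNIV (Q k) \<and> (\<forall>x. x \<le> 0 \<or> \<tau> \<le> x \<longrightarrow> Q k x = 0) \<and>
      (\<forall>x. \<bar>Q k x\<bar> \<le> 16 / \<tau> * exp (k + K / \<tau> ^ 4 + \<mu> k * \<tau> / 2)) \<and>
      (\<forall>j. integral {0..\<tau>} (\<lambda>s. exp (- \<mu> j * s) * Q k s) = (if j = k then 1 else 0))" ..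
    have Q: "continuous_on UNIV (Q k)" "x \<le> 0 \<or> \<tau> \<le> x \<Longrightarrow> Q k x = 0"
      "\<bar>Q k x\<bar> \<le> 16 / \<tau> * exp (k + K / \<tau> ^ 4 + \<mu> k * \<tau> / 2)"
      "integral {0..\<tau>} (\<lambda>s. exp (- \<mu> j * s) * Q k s) = (if j = k then 1 else 0)" for k x j
      using Q_all by (simp_all only:)
    define f where "f k x = exp (- \<mu> k * \<tau>) * v k * Q k x" for k x
    have M: "0 \<le> M"
    proof -
      have "0 < (1 + \<mu> 0) powr q" using pos[of 0] by simp
      moreover have "0 \<le> M * (1 + \<mu> 0) powr q" using v[of 0] by linarith
      ultimately show ?thesis by (simp add: zero_le_mult_iff)
    qed
    have fb: "norm (f k x) \<le> M * exp (C1 / \<tau> ^ 4) * (1/2) ^ k" for k x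
    proof -
      have \<mu>k: "\<alpha> * (real k)\<^sup>2 \<le> \<mu> k" using gap[of 0 k] pos[of 0] by simp
      have "norm (f k x) = exp (- \<mu> k * \<tau>) * \<bar>v k\<bar> * \<bar>Q k x\<bar>" by (simp add: f_def abs_mult)
      also have "\<dots> \<le> exp (- \<mu> k * \<tau>) * (M * (1 + \<mu> k) powr q) * (16 / \<tau> * exp (k + K / \<tau> ^ 4 + \<mu> k * \<tau> / 2))"
        using v Q(3) M by (intro mult_mono) auto
      also have "\<dots> = M * (exp (- \<mu> k * \<tau>) * (1 + \<mu> k) powr q * (16 / \<tau> * exp (k + K / \<tau> ^ 4 + \<mu> k * \<tau> / 2)))"
        by (simp only: mult_ac)
      also have "\<dots> \<le> M * (exp (C1 / \<tau> ^ 4) * (1/2) ^ k)"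
        unfolding C1_def using moment_weight_bound[OF \<tau> \<alpha> q K \<mu>k] M by (intro mult_left_mono) auto
      finally show ?thesis by (simp add: mult.assoc)
    qed
    have sumM: "summable (\<lambda>k. M * exp (C1 / \<tau> ^ 4) * (1/2) ^ k)"
      by (intro summable_mult summable_geometric) simp
    define P where "P x = (\<Sum>k. f k x)" for x
    have ul: "uniform_limit UNIV (\<lambda>n x. \<Sum>k<n. f k x) P sequentially"
      unfolding P_def[abs_def] by (rule Weierstrass_m_test[OF fb sumM])
    have fc: "continuous_on UNIV (f k)" for k
      unfolding f_def by (intro continuous_intros Q(1))
    have Pc: "continuous_on UNIV P"
      by (rule uniform_limit_theorem[OF _ ul]) (auto intro!: always_eventually continuous_on_sum fc)
    have P0: "P x = 0" if "x \<le> 0 \<or> \<tau> \<le> x" for x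
      using Q(2)[OF that] by (simp add: P_def f_def)
    have Pb: "\<bar>P x\<bar> \<le> M * exp (C / \<tau> ^ 4)" for x
    proof -
      have sn: "summable (\<lambda>k. norm (f k x))"
        by (rule summable_comparison_test'[OF sumM, of 0]) (use fb in auto)
      have "\<bar>P x\<bar> \<le> (\<Sum>k. norm (f k x))" unfolding P_def using summable_norm[OF sn] by simp
      also have "\<dots> \<le> (\<Sum>k. M * exp (C1 / \<tau> ^ 4) * (1/2) ^ k)"
        by (rule suminf_le[OF fb sn sumM])
      also have "\<dots> = M * exp (C1 / \<tau> ^ 4) * 2"
        by (subst suminf_mult) (auto simp: suminf_geometric intro!: summable_geometric)
      also have "\<dots> \<le> M * exp (C1 / \<tau> ^ 4) * exp (1 / \<tau> ^ 4)"
      proof (intro mult_left_mono)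
        have "1 \<le> 1 / \<tau> ^ 4" using \<tau> by (simp add: power_le_one)
        then show "2 \<le> exp (1 / \<tau> ^ 4)" using exp_ge_add_one_self[of "1 / \<tau> ^ 4"] by linarith
      qed (use M in auto)
      also have "\<dots> = M * exp (C / \<tau> ^ 4)"
        by (simp add: C_def add_divide_distrib exp_add)
      finally show ?thesis .
    qed
    have Pm: "integral {0..\<tau>} (\<lambda>s. exp (- \<mu> j * s) * P s) = exp (- \<mu> j * \<tau>) * v j" for j
    proof -
      have b1: "bounded ((\<lambda>s. exp (- \<mu> j * s)) ` {0..\<tau>})"
        by (intro compact_imp_bounded compact_continuous_image continuous_intros) auto
      have b2: "bounded (P ` {0..\<tau>})" using Pb by (auto simp: bounded_iff)
      have "uniform_limit {0..\<tau>} (\<lambda>n s. exp (- \<mu> j * s) * (\<Sum>k<n. f k s)) (\<lambda>s. exp (- \<mu> j * s) * P s) sequentially"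
        using uniform_limit_on_subset[OF ul, of "{0..\<tau>}"] b1 b2
        by (intro uniform_lim_mult uniform_limit_const) auto
      moreover have "continuous_on {0..\<tau>} (\<lambda>s. exp (- \<mu> j * s) * (\<Sum>k<n. f k s))" for n
        by (intro continuous_intros continuous_on_subset[OF fc]) auto
      ultimately have lim: "(\<lambda>n. integral {0..\<tau>} (\<lambda>s. exp (- \<mu> j * s) * (\<Sum>k<n. f k s)))
          \<longlonglongrightarrow> integral {0..\<tau>} (\<lambda>s. exp (- \<mu> j * s) * P s)"
        by (rule integral_uniform_limit)
      have "integral {0..\<tau>} (\<lambda>s. exp (- \<mu> j * s) * (\<Sum>k<n. f k s)) = exp (- \<mu> j * \<tau>) * v j" if "j < n" for n
      proof -
        have int: "(\<lambda>s. exp (- \<mu> k * \<tau>) * v k * (exp (- \<mu> j * s) * Q k s)) integrable_on {0..\<tau>}" for k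
          by (intro integrable_continuous_real continuous_intros continuous_on_subset[OF Q(1)]) auto
        have "integral {0..\<tau>} (\<lambda>s. exp (- \<mu> j * s) * (\<Sum>k<n. f k s))
            = integral {0..\<tau>} (\<lambda>s. \<Sum>k<n. exp (- \<mu> k * \<tau>) * v k * (exp (- \<mu> j * s) * Q k s))"
          by (intro integral_cong) (simp add: f_def sum_distrib_left mult_ac)
        also have "\<dots> = (\<Sum>k<n. integral {0..\<tau>} (\<lambda>s. exp (- \<mu> k * \<tau>) * v k * (exp (- \<mu> j * s) * Q k s)))"
          by (intro integral_sum int) auto
        also have "\<dots> = (\<Sum>k<n. if k = j then exp (- \<mu> j * \<tau>) * v j else 0)"
          by (intro sum.cong refl) (simp only: integral_mult_right Q(4), simp)
        also have "\<dots> = exp (- \<mu> j * \<tau>) * v j" using that by simp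
        finally show ?thesis .
      qed
      then have "\<forall>\<^sub>F n in sequentially. integral {0..\<tau>} (\<lambda>s. exp (- \<mu> j * s) * (\<Sum>k<n. f k s)) = exp (- \<mu> j * \<tau>) * v j"
        by (intro eventually_mono[OF eventually_gt_at_top[of j]])
      from LIMSEQ_unique[OF lim tendsto_eventually[OF this]] show ?thesis .
    qed
    \<comment> \<open>The biorthogonal functions pair with \<open>exp (- \<mu> k s)\<close>, the equation with \<open>exp (- \<mu> k (\<tau> - s))\<close>.\<close>
    define p where "p s = P (\<tau> - s)" for s
    have "integral {0..\<tau>} (\<lambda>s. exp (- \<mu> k * (\<tau> - s)) * p s) = exp (- \<mu> k * \<tau>) * v k" for k
    proof -
      let ?g = "\<lambda>s. exp (- \<mu> k * (\<tau> + s)) * P (\<tau> + s)"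
      have "integral {0..\<tau>} (\<lambda>s. exp (- \<mu> k * (\<tau> - s)) * p s) = integral {0..\<tau>} (\<lambda>s. ?g (- s))"
        by (simp add: p_def)
      also have "\<dots> = integral {-\<tau>..0} ?g" using Henstock_Kurzweil_Integration.integral_reflect_real[of 0 "-\<tau>" ?g] by simp
      also have "\<dots> = integral {0..\<tau>} (\<lambda>s. exp (- \<mu> k * s) * P s)"
        using integral_shift_real_ivl[of 0 \<tau> \<tau> "\<lambda>s. exp (- \<mu> k * s) * P s"] by (simp add: add.commute)
      finally show ?thesis by (simp only: Pm)
    qed
    moreover have "continuous_on UNIV p"
      unfolding p_def by (intro continuous_on_compose2[OF Pc] continuous_intros) auto
    moreover have "p x = 0" if "x \<le> 0 \<or> \<tau> \<le> x" for x
      unfolding p_def using that by (intro P0) auto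
    ultimately show ?thesis
      using Pb by (intro exI[of _ p]) (auto simp: p_def)
  qed
  with C show ?thesis using that[of C] by blast
qed

section \<open>Mild solutions for bilinear controls\<close>

locale contraction_semigroup =
  fixes E :: "real \<Rightarrow> 'a::banach \<Rightarrow> 'a"
  assumes E_linear: "0 \<le> t \<Longrightarrow> linear (E t)"
    and E_norm: "0 \<le> t \<Longrightarrow> norm (E t x) \<le> norm x"
    and E_0: "E 0 x = x"
    and E_add: "0 \<le> s \<Longrightarrow> 0 \<le> t \<Longrightarrow> E (s + t) x = E s (E t x)"
    and E_cont: "continuous_on {0..} (\<lambda>t. E t x)"
begin

lemma E_bounded_linear: "0 \<le> t \<Longrightarrow> bounded_linear (E t)"
  by (rule bounded_linear_intro[where K = 1]) (use E_norm E_linear in \<open>auto simp: linear_add linear_scale\<close>)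

lemma E_diff: "0 \<le> t \<Longrightarrow> E t (x - y) = E t x - E t y"
  using E_linear by (rule linear_diff)

lemma E_continuous:
  assumes \<tau>: "continuous_on S \<tau>" "\<And>x. x \<in> S \<Longrightarrow> 0 \<le> \<tau> x" and f: "continuous_on S f"
  shows "continuous_on S (\<lambda>x. E (\<tau> x) (f x))"
  unfolding continuous_on_def
proof
  fix x assume x: "x \<in> S"
  have "continuous_on S (\<lambda>y. E (\<tau> y) (f x))"
    using \<tau> by (intro continuous_on_compose2[OF E_cont \<tau>(1)]) auto
  then have 1: "((\<lambda>y. E (\<tau> y) (f x)) \<longlongrightarrow> E (\<tau> x) (f x)) (at x within S)"
    using x by (auto simp: continuous_on_def)
  have "((\<lambda>y. norm (f y - f x)) \<longlongrightarrow> 0) (at x within S)"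
    using f x by (intro tendsto_norm_zero) (simp add: continuous_on_def LIM_zero)
  moreover have "\<forall>\<^sub>F y in at x within S. norm (E (\<tau> y) (f y) - E (\<tau> y) (f x)) \<le> norm (f y - f x)"
    unfolding eventually_at_topological
    by (intro exI[of _ UNIV]) (auto simp: \<tau>(2) E_diff[symmetric] intro!: E_norm)
  ultimately have 2: "((\<lambda>y. E (\<tau> y) (f y) - E (\<tau> y) (f x)) \<longlongrightarrow> 0) (at x within S)"
    by (rule Lim_null_comparison[rotated])
  show "((\<lambda>y. E (\<tau> y) (f y)) \<longlongrightarrow> E (\<tau> x) (f x)) (at x within S)"
    using tendsto_add[OF 2 1] by simp
qed

definition duhamel :: "(real \<Rightarrow> 'a) \<Rightarrow> real \<Rightarrow> 'a" where
  "duhamel f t = integral {0..t} (\<lambda>s. E (t - s) (f s))"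

lemma duhamel_integrand_continuous:
  assumes "continuous_on {0..t} f"
  shows "continuous_on {0..t} (\<lambda>s. E (t - s) (f s))"
  by (intro E_continuous assms continuous_intros) auto

lemma duhamel_integrable:
  assumes "continuous_on {0..t} f"
  shows "(\<lambda>s. E (t - s) (f s)) integrable_on {0..t}"
  by (intro integrable_continuous_real duhamel_integrand_continuous assms)

text \<open>
  Replacing \<open>t - s\<close> by \<open>max 0 (t - s)\<close> extends the integrand to a fixed interval \<open>[0, T]\<close>, on which a
  parameter integral of a jointly continuous function is continuous; the part beyond \<open>t\<close> that this adds
  is the integral of \<open>f\<close> itself.
\<close>

lemma duhamel_continuous:
  assumes f: "continuous_on {0..T} f"
  shows "continuous_on {0..T} (duhamel f)"
proof -
  let ?G = "\<lambda>t. integral (cbox 0 T) (\<lambda>s. E (max 0 (t - s)) (f s))"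
  have "continuous_on ({0..T} \<times> cbox 0 T) (\<lambda>(t, s). E (max 0 (t - s)) (f s))"
    unfolding case_prod_beta
    by (intro E_continuous continuous_intros continuous_on_compose2[OF f]) auto
  then have G: "continuous_on {0..T} ?G"
    by (rule integral_continuous_on_param)
  have I: "continuous_on {0..T} (\<lambda>t. integral {t..T} f)"
    by (intro indefinite_integral_continuous_1' integrable_continuous_real f)
  have "continuous_on {0..T} (\<lambda>t. ?G t - integral {t..T} f)"
    by (intro continuous_on_diff G I)
  moreover have "?G t - integral {t..T} f = duhamel f t" if t: "t \<in> {0..T}" for t
  proof -
    have int: "(\<lambda>s. E (max 0 (t - s)) (f s)) integrable_on {0..T}"
      by (intro integrable_continuous_real E_continuous f continuous_intros) auto
    have "?G t = integral {0..t} (\<lambda>s. E (max 0 (t - s)) (f s)) + integral {t..T} (\<lambda>s. E (max 0 (t - s)) (f s))"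
      using t int by (simp add: Henstock_Kurzweil_Integration.integral_combine)
    also have "integral {0..t} (\<lambda>s. E (max 0 (t - s)) (f s)) = duhamel f t"
      unfolding duhamel_def by (intro integral_cong) (auto simp: max_def)
    also have "integral {t..T} (\<lambda>s. E (max 0 (t - s)) (f s)) = integral {t..T} f"
      by (intro integral_cong) (auto simp: max_def E_0)
    finally show ?thesis by simp
  qed
  ultimately show ?thesis by (rule continuous_on_eq)
qed

lemma duhamel_norm_le:
  assumes f: "continuous_on {0..t} f" and g: "g integrable_on {0..t}"
    and le: "\<And>s. s \<in> {0..t} \<Longrightarrow> norm (f s) \<le> g s"
  shows "norm (duhamel f t) \<le> integral {0..t} g"
  unfolding duhamel_def
proof (rule integral_norm_bound_integral[OF duhamel_integrable[OF f] g])
  fix s assume "s \<in> {0..t}"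
  then show "norm (E (t - s) (f s)) \<le> g s" using E_norm[of "t - s" "f s"] le[of s] by simp
qed

lemma duhamel_diff:
  assumes "continuous_on {0..t} f" "continuous_on {0..t} g"
  shows "duhamel (\<lambda>s. f s - g s) t = duhamel f t - duhamel g t"
proof -
  have "duhamel (\<lambda>s. f s - g s) t = integral {0..t} (\<lambda>s. E (t - s) (f s) - E (t - s) (g s))"
    unfolding duhamel_def by (intro integral_cong) (auto simp: E_diff)
  also have "\<dots> = duhamel f t - duhamel g t"
    unfolding duhamel_def by (intro Henstock_Kurzweil_Integration.integral_diff duhamel_integrable assms)
  finally show ?thesis .
qed

lemma duhamel_cong:
  assumes "\<And>s. s \<in> {0..t} \<Longrightarrow> f s = g s"
  shows "duhamel f t = duhamel g t"
  unfolding duhamel_def using assms by (intro integral_cong) auto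

lemma duhamel_zero: "duhamel (\<lambda>s. 0) t = 0"
proof -
  have "duhamel (\<lambda>s. 0) t = integral {0..t} (\<lambda>s. 0)"
    unfolding duhamel_def by (intro integral_cong) (simp add: linear_0[OF E_linear])
  then show ?thesis by simp
qed

lemma duhamel_add_time:
  assumes s: "0 \<le> s" and t: "0 \<le> t" and f: "continuous_on {0..s + t} f"
  shows "duhamel f (s + t) = E t (duhamel f s) + duhamel (\<lambda>r. f (s + r)) t"
proof -
  let ?g = "\<lambda>r. E (s + t - r) (f r)"
  have int: "?g integrable_on {0..s + t}" by (rule duhamel_integrable[OF f])
  have "duhamel f (s + t) = integral {0..s} ?g + integral {s..s + t} ?g"
    unfolding duhamel_def
    using s t int by (simp add: Henstock_Kurzweil_Integration.integral_combine)
  also have "integral {0..s} ?g = integral {0..s} (\<lambda>r. E t (E (s - r) (f r)))"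
  proof (intro integral_cong)
    fix r assume "r \<in> {0..s}"
    then show "?g r = E t (E (s - r) (f r))"
      using E_add[of t "s - r" "f r"] t by (simp add: algebra_simps)
  qed
  also have "\<dots> = E t (duhamel f s)"
    unfolding duhamel_def
    using integral_linear[OF duhamel_integrable E_bounded_linear[OF t], of s f] continuous_on_subset[OF f, of "{0..s}"] t
    by (auto simp: o_def)
  also have "integral {s..s + t} ?g = duhamel (\<lambda>r. f (s + r)) t"
    unfolding duhamel_def
    using integral_shift_real_ivl[of s s "s + t" ?g] by (simp add: algebra_simps)
  finally show ?thesis .
qed

end

text \<open>
  The system \<open>v' + G v + F p v = 0\<close>, where \<open>-G\<close> generates the contraction semigroup \<open>E\<close>. Writing the
  control term as one bounded bilinear map \<open>F\<close> lets the controls take values in any Banach space.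
\<close>

locale bilinear_control = contraction_semigroup E + F: bounded_bilinear F
  for E :: "real \<Rightarrow> 'a::banach \<Rightarrow> 'a" and F :: "'c::banach \<Rightarrow> 'a \<Rightarrow> 'a"
begin

definition mild :: "(real \<Rightarrow> 'c) \<Rightarrow> 'a \<Rightarrow> real \<Rightarrow> (real \<Rightarrow> 'a) \<Rightarrow> bool" where
  "mild p x T v \<longleftrightarrow> continuous_on {0..T} v \<and> (\<forall>t\<in>{0..T}. v t = E t x - duhamel (\<lambda>s. F (p s) (v s)) t)"

lemma F_bound:
  obtains b where "0 < b" "\<And>c x. norm (F c x) \<le> b * (norm c * norm x)"
proof -
  obtain K where "0 < K" "\<forall>a b. norm (F a b) \<le> norm a * norm b * K"
    using F.pos_bounded by blast
  then show ?thesis using that[of K] by (simp add: mult_ac)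
qed

lemma control_bound:
  fixes p :: "real \<Rightarrow> 'c"
  assumes "continuous_on {0..T} p"
  obtains M where "0 < M" "\<And>s x. s \<in> {0..T} \<Longrightarrow> norm (F (p s) x) \<le> M * norm x"
proof -
  obtain b where b: "0 < b" "\<And>c x. norm (F c x) \<le> b * (norm c * norm x)" using F_bound by blast
  have "bounded (p ` {0..T})"
    by (intro compact_imp_bounded compact_continuous_image assms) auto
  then obtain P where P: "0 < P" "\<And>s. s \<in> {0..T} \<Longrightarrow> norm (p s) \<le> P"
    by (auto simp: bounded_pos)
  have "norm (F (p s) x) \<le> b * P * norm x" if "s \<in> {0..T}" for s x
  proof -
    have "norm (F (p s) x) \<le> b * (norm (p s) * norm x)" by (rule b(2))
    also have "\<dots> \<le> b * (P * norm x)"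
      using P(2)[OF that] b(1) by (intro mult_left_mono mult_right_mono) auto
    finally show ?thesis by (simp add: mult.assoc)
  qed
  then show ?thesis using that[of "b * P"] b(1) P(1) by simp
qed

lemma integral_exp_weight_le:
  fixes M t :: real
  assumes "0 < M" "0 \<le> t" "0 \<le> K"
  shows "(\<lambda>s. M * (K * exp (2 * M * s))) integrable_on {0..t}"
    and "integral {0..t} (\<lambda>s. M * (K * exp (2 * M * s))) \<le> K / 2 * exp (2 * M * t)"
proof -
  have *: "((\<lambda>s. M * (K * exp (2 * M * s))) has_integral (K / 2 * exp (2 * M * t) - K / 2 * exp (2 * M * 0))) {0..t}"
    using assms
    by (intro fundamental_theorem_of_calculus)
      (auto intro!: derivative_eq_intros simp flip: has_real_derivative_iff_has_vector_derivative)
  then show "(\<lambda>s. M * (K * exp (2 * M * s))) integrable_on {0..t}" by blast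
  show "integral {0..t} (\<lambda>s. M * (K * exp (2 * M * s))) \<le> K / 2 * exp (2 * M * t)"
    unfolding integral_unique[OF *] using assms by simp
qed

text \<open>
  In the norm weighted by \<open>exp (- 2 M t)\<close> the control term is a contraction with constant \<open>1/2\<close>. This
  replaces Gronwall's inequality, and it serves uniqueness as well as the convergence of the Picard series.
\<close>

lemma duhamel_weight_le:
  assumes t: "0 \<le> t" and M: "0 < M" "\<And>s x. s \<in> {0..t} \<Longrightarrow> norm (F (p s) x) \<le> M * norm x"
    and p: "continuous_on {0..t} p" and v: "continuous_on {0..t} v"
    and K: "0 \<le> K" "\<And>s. s \<in> {0..t} \<Longrightarrow> norm (v s) \<le> K * exp (2 * M * s)"
  shows "norm (duhamel (\<lambda>s. F (p s) (v s)) t) \<le> K / 2 * exp (2 * M * t)"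
proof -
  have "norm (duhamel (\<lambda>s. F (p s) (v s)) t) \<le> integral {0..t} (\<lambda>s. M * (K * exp (2 * M * s)))"
  proof (rule duhamel_norm_le)
    show "continuous_on {0..t} (\<lambda>s. F (p s) (v s))"
      by (intro F.continuous_on p v)
    fix s assume s: "s \<in> {0..t}"
    show "norm (F (p s) (v s)) \<le> M * (K * exp (2 * M * s))"
      using M(2)[OF s, of "v s"] mult_left_mono[OF K(2)[OF s], of M] M(1) by linarith
  qed (use integral_exp_weight_le M t K in auto)
  then show ?thesis using integral_exp_weight_le(2)[OF M(1) t K(1)] by linarith
qed

lemma mild_unique:
  assumes p: "continuous_on {0..T} p" and v: "mild p x T v" and w: "mild p x T w" and t: "t \<in> {0..T}"
  shows "v t = w t"
proof -
  obtain M where M: "0 < M" "\<And>s x. s \<in> {0..T} \<Longrightarrow> norm (F (p s) x) \<le> M * norm x"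
    using control_bound[OF p] by blast
  have vc: "continuous_on {0..T} v" and wc: "continuous_on {0..T} w"
    using v w by (auto simp: mild_def)
  let ?d = "\<lambda>s. v s - w s"
  have dc: "continuous_on {0..T} ?d" by (intro continuous_intros vc wc)
  have "continuous_on {0..T} (\<lambda>s. norm (?d s) * exp (- (2 * M * s)))"
    by (intro continuous_intros dc vc wc)
  then obtain m where m: "m \<in> {0..T}"
    and max: "\<And>s. s \<in> {0..T} \<Longrightarrow> norm (?d s) * exp (- (2 * M * s)) \<le> norm (?d m) * exp (- (2 * M * m))"
    using continuous_attains_sup[of "{0..T}" "\<lambda>s. norm (?d s) * exp (- (2 * M * s))"] t by auto
  define K where "K = norm (?d m) * exp (- (2 * M * m))"
  have K: "norm (?d s) \<le> K * exp (2 * M * s)" if "s \<in> {0..T}" for s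
    using max[OF that] by (simp add: K_def exp_minus field_simps)
  have K0: "0 \<le> K" by (simp add: K_def)
  have "norm (?d m) \<le> K / 2 * exp (2 * M * m)"
  proof -
    have sub: "{0..m} \<subseteq> {0..T}" using m by auto
    have "duhamel (\<lambda>s. F (p s) (?d s)) m = duhamel (\<lambda>s. F (p s) (v s)) m - duhamel (\<lambda>s. F (p s) (w s)) m"
      unfolding F.diff_right
      by (intro duhamel_diff F.continuous_on continuous_on_subset[OF p sub]
          continuous_on_subset[OF vc sub] continuous_on_subset[OF wc sub])
    also have "\<dots> = - ?d m"
      using v w m by (auto simp: mild_def)
    finally have "norm (?d m) = norm (duhamel (\<lambda>s. F (p s) (?d s)) m)"
      by (metis norm_minus_cancel)
    also have "\<dots> \<le> K / 2 * exp (2 * M * m)"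
      using m sub M K K0 continuous_on_subset[OF p sub] continuous_on_subset[OF dc sub]
      by (intro duhamel_weight_le) auto
    finally show ?thesis .
  qed
  then have "K \<le> K / 2"
    by (simp add: K_def exp_minus field_simps)
  then have "K = 0" using K0 by linarith
  then show ?thesis using K[OF t] by simp
qed

lemma mild_exists:
  assumes T: "0 \<le> T" and p: "continuous_on {0..T} p"
  obtains v where "mild p x T v"
proof -
  obtain M where M: "0 < M" "\<And>s x. s \<in> {0..T} \<Longrightarrow> norm (F (p s) x) \<le> M * norm x"
    using control_bound[OF p] by blast
  \<comment> \<open>The terms of the Picard (Dyson) series; the \<open>n\<close>-th one is of degree \<open>n\<close> in the control.\<close>
  define d where "d = rec_nat (\<lambda>t. E t x) (\<lambda>n f. \<lambda>t. - duhamel (\<lambda>s. F (p s) (f s)) t)"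
  have d0: "d 0 = (\<lambda>t. E t x)" and dS: "d (Suc n) = (\<lambda>t. - duhamel (\<lambda>s. F (p s) (d n s)) t)" for n
    by (simp_all add: d_def)
  have dc: "continuous_on {0..T} (d n)" for n
  proof (induction n)
    case 0
    then show ?case unfolding d0 by (rule continuous_on_subset[OF E_cont]) auto
  next
    case (Suc n)
    then show ?case unfolding dS by (intro continuous_intros duhamel_continuous F.continuous_on p)
  qed
  have db: "norm (d n t) \<le> norm x * (1/2)^n * exp (2 * M * t)" if "t \<in> {0..T}" for n t
    using that
  proof (induction n arbitrary: t)
    case 0
    then show ?case using E_norm[of t x] M(1) mult_left_mono[of 1 "exp (2 * M * t)" "norm x"] by (simp add: d0)
  next
    case (Suc n)
    have sub: "{0..t} \<subseteq> {0..T}" using Suc.prems by auto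
    have "norm (duhamel (\<lambda>s. F (p s) (d n s)) t) \<le> norm x * (1/2)^n / 2 * exp (2 * M * t)"
      using Suc M sub continuous_on_subset[OF p sub] continuous_on_subset[OF dc sub]
      by (intro duhamel_weight_le) auto
    then show ?case by (simp add: dS)
  qed
  define V where "V n t = (\<Sum>i<n. d i t)" for n t
  define v where "v t = (\<Sum>i. d i t)" for t
  have ul: "uniform_limit {0..T} V v sequentially"
    unfolding V_def[abs_def] v_def[abs_def]
  proof (rule Weierstrass_m_test)
    fix n t assume t: "t \<in> {0..T}"
    have "norm x * (1/2)^n * exp (2 * M * t) \<le> norm x * (1/2)^n * exp (2 * M * T)"
      using t M(1) by (intro mult_left_mono) auto
    then show "norm (d n t) \<le> norm x * exp (2 * M * T) * (1/2)^n"
      using db[OF t, of n] by (simp add: mult_ac)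
  qed (intro summable_mult summable_geometric, simp)
  have Vc: "continuous_on {0..T} (V n)" for n
    unfolding V_def by (intro continuous_on_sum dc)
  have vc: "continuous_on {0..T} v"
    by (rule uniform_limit_theorem[OF _ ul]) (use Vc in auto)
  have Veq: "V (Suc n) t = E t x - duhamel (\<lambda>s. F (p s) (V n s)) t" if t: "t \<in> {0..T}" for n t
  proof -
    have sub: "{0..t} \<subseteq> {0..T}" using t by auto
    have Fd: "continuous_on {0..t} (\<lambda>s. F (p s) (d i s))" for i
      by (intro F.continuous_on continuous_on_subset[OF p sub] continuous_on_subset[OF dc sub])
    have FV: "continuous_on {0..t} (\<lambda>s. F (p s) (V i s))" for i
      by (intro F.continuous_on continuous_on_subset[OF p sub] continuous_on_subset[OF Vc sub])
    show ?thesis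
    proof (induction n)
      case 0
      then show ?case by (simp add: V_def d0 F.zero_right duhamel_zero)
    next
      case (Suc n)
      have "duhamel (\<lambda>s. F (p s) (V (Suc n) s)) t - duhamel (\<lambda>s. F (p s) (V n s)) t
          = duhamel (\<lambda>s. F (p s) (V (Suc n) s) - F (p s) (V n s)) t"
        by (rule duhamel_diff[symmetric]) (intro FV)+
      also have "\<dots> = duhamel (\<lambda>s. F (p s) (d n s)) t"
        by (intro duhamel_cong) (simp add: V_def F.diff_right[symmetric])
      also have "\<dots> = - d (Suc n) t" by (simp add: dS)
      finally have "d (Suc n) t = duhamel (\<lambda>s. F (p s) (V n s)) t - duhamel (\<lambda>s. F (p s) (V (Suc n) s)) t"
        by (metis minus_diff_eq minus_minus)
      moreover have "V (Suc (Suc n)) t = V (Suc n) t + d (Suc n) t" by (simp add: V_def)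
      ultimately show ?case using Suc by simp
    qed
  qed
  have "v t = E t x - duhamel (\<lambda>s. F (p s) (v s)) t" if t: "t \<in> {0..T}" for t
  proof -
    have sub: "{0..t} \<subseteq> {0..T}" using t by auto
    have Fv: "continuous_on {0..t} (\<lambda>s. F (p s) (v s))"
      by (intro F.continuous_on continuous_on_subset[OF p sub] continuous_on_subset[OF vc sub])
    have FV: "continuous_on {0..t} (\<lambda>s. F (p s) (V i s))" for i
      by (intro F.continuous_on continuous_on_subset[OF p sub] continuous_on_subset[OF Vc sub])
    have lim1: "(\<lambda>n. V (Suc n) t) \<longlonglongrightarrow> v t"
      using tendsto_uniform_limitI[OF ul t] by (rule LIMSEQ_Suc)
    have lim2: "(\<lambda>n. duhamel (\<lambda>s. F (p s) (V n s)) t) \<longlonglongrightarrow> duhamel (\<lambda>s. F (p s) (v s)) t"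
    proof (rule metric_LIMSEQ_I)
      fix e :: real assume e: "0 < e"
      define e' where "e' = e / (2 * (M * (t + 1)))"
      have e': "0 < e'" using e M(1) t by (simp add: e'_def)
      obtain N where N: "\<forall>n\<ge>N. \<forall>s\<in>{0..T}. dist (V n s) (v s) < e'"
        using uniform_limitD[OF ul e'] by (auto simp: eventually_sequentially)
      have "dist (duhamel (\<lambda>s. F (p s) (V n s)) t) (duhamel (\<lambda>s. F (p s) (v s)) t) < e" if n: "n \<ge> N" for n
      proof -
        have "dist (duhamel (\<lambda>s. F (p s) (V n s)) t) (duhamel (\<lambda>s. F (p s) (v s)) t)
            = norm (duhamel (\<lambda>s. F (p s) (V n s) - F (p s) (v s)) t)"
          unfolding dist_norm by (subst duhamel_diff[OF FV Fv]) simp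
        also have "\<dots> \<le> integral {0..t} (\<lambda>s. M * e')"
        proof (rule duhamel_norm_le)
          fix s assume s: "s \<in> {0..t}"
          then have "norm (F (p s) (V n s - v s)) \<le> M * norm (V n s - v s)" using sub by (intro M(2)) auto
          also have "\<dots> \<le> M * e'"
            using N n s sub M(1) by (intro mult_left_mono) (auto simp: dist_norm intro: less_imp_le)
          finally show "norm (F (p s) (V n s) - F (p s) (v s)) \<le> M * e'" by (simp add: F.diff_right)
        qed (auto intro!: continuous_on_diff FV Fv)
        also have "\<dots> = t * (M * e')" using t by simp
        also have "\<dots> < e"
        proof -
          have "t * (M * e') = e * (t / (2 * (t + 1)))" using M(1) t by (simp add: e'_def)
          also have "\<dots> < e * 1" using e t by (intro mult_strict_left_mono) auto
          finally show ?thesis by simp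
        qed
        finally show ?thesis .
      qed
      then show "\<exists>N. \<forall>n\<ge>N. dist (duhamel (\<lambda>s. F (p s) (V n s)) t) (duhamel (\<lambda>s. F (p s) (v s)) t) < e"
        by blast
    qed
    have "(\<lambda>n. V (Suc n) t) \<longlonglongrightarrow> E t x - duhamel (\<lambda>s. F (p s) (v s)) t"
      unfolding Veq[OF t] by (intro tendsto_diff tendsto_const lim2)
    with lim1 show ?thesis by (rule LIMSEQ_unique)
  qed
  then show ?thesis using that[of v] vc by (auto simp: mild_def)
qed

lemma mild_restrict: "mild p x T v \<Longrightarrow> T' \<le> T \<Longrightarrow> mild p x T' v"
  by (auto simp: mild_def intro: continuous_on_subset)

lemma mild_cong:
  assumes "mild p x T v" "\<And>s. s \<in> {0..T} \<Longrightarrow> p s = q s" "\<And>s. s \<in> {0..T} \<Longrightarrow> v s = w s"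
  shows "mild q x T w"
  unfolding mild_def
proof (intro conjI ballI)
  show "continuous_on {0..T} w"
    by (rule continuous_on_eq[of _ v]) (use assms in \<open>auto simp: mild_def\<close>)
  fix t assume t: "t \<in> {0..T}"
  have "duhamel (\<lambda>s. F (p s) (v s)) t = duhamel (\<lambda>s. F (q s) (w s)) t"
    using assms t by (intro duhamel_cong) auto
  then show "w t = E t x - duhamel (\<lambda>s. F (q s) (w s)) t"
    using assms t by (auto simp: mild_def)
qed

text \<open>
  For a linear system, symmetries of the coefficients act on solutions. The use below is
  multiplication by a scalar.
\<close>

lemma mild_map:
  assumes G: "bounded_linear G" and GE: "\<And>t x. 0 \<le> t \<Longrightarrow> E t (G x) = G (E t x)"
    and GF: "\<And>c x. F c (G x) = G (F c x)" and p: "continuous_on {0..T} p" and m: "mild p x T v"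
  shows "mild p (G x) T (\<lambda>t. G (v t))"
  unfolding mild_def
proof (intro conjI ballI)
  have v: "continuous_on {0..T} v" using m by (simp add: mild_def)
  then show "continuous_on {0..T} (\<lambda>t. G (v t))" by (rule bounded_linear.continuous_on[OF G])
  fix t assume t: "t \<in> {0..T}"
  have fc: "continuous_on {0..t} (\<lambda>s. F (p s) (v s))"
    using t by (intro F.continuous_on continuous_on_subset[OF p] continuous_on_subset[OF v]) auto
  have "duhamel (\<lambda>s. F (p s) (G (v s))) t = integral {0..t} (\<lambda>s. G (E (t - s) (F (p s) (v s))))"
    unfolding duhamel_def by (intro integral_cong) (simp add: GE GF)
  also have "\<dots> = G (duhamel (\<lambda>s. F (p s) (v s)) t)"
    unfolding duhamel_def using integral_linear[OF duhamel_integrable[OF fc] G] by (simp add: o_def)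
  finally show "G (v t) = E t (G x) - duhamel (\<lambda>s. F (p s) (G (v s))) t"
    using m t by (simp add: mild_def GE linear_diff[OF bounded_linear.linear[OF G]])
qed

text \<open>
  The state at time \<open>t\<close>. A mild solution on \<open>[0, t]\<close> is determined by its data, so the choice is immaterial
  for continuous controls.
\<close>

definition flow :: "(real \<Rightarrow> 'c) \<Rightarrow> 'a \<Rightarrow> real \<Rightarrow> 'a" where
  "flow p x t = (SOME v. mild p x t v) t"

lemma flow_eq:
  assumes "continuous_on {0..T} p" "mild p x T v" "t \<in> {0..T}"
  shows "flow p x t = v t"
proof -
  have m: "mild p x t v" using mild_restrict[OF assms(2)] assms(3) by auto
  then have "mild p x t (SOME v. mild p x t v)" by (rule someI[of "mild p x t"])
  moreover have "continuous_on {0..t} p" using assms(1,3) by (auto intro: continuous_on_subset)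
  ultimately show ?thesis
    unfolding flow_def using m assms(3) by (intro mild_unique[of t p x]) auto
qed

lemma flow_mild:
  assumes "0 \<le> T" "continuous_on {0..T} p"
  shows "mild p x T (flow p x)"
proof -
  obtain v where v: "mild p x T v" using mild_exists[OF assms] by blast
  then show ?thesis
    by (rule mild_cong) (use flow_eq[OF assms(2) v] in auto)
qed

text \<open>
  Stated for a second control \<open>q\<close> that agrees with the shifted \<open>p\<close> only on \<open>[0, t]\<close>: this is the form in
  which controls are concatenated.
\<close>

lemma flow_add:
  assumes s: "0 \<le> s" and t: "0 \<le> t" and p: "continuous_on UNIV p" 
    and q: "\<And>r. r \<in> {0..t} \<Longrightarrow> q r = p (s + r)"
  shows "flow p x (s + t) = flow q (flow p x s) t"
proof -
  let ?v = "flow p x"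
  have pc: "continuous_on S p" for S using p by (rule continuous_on_subset) auto
  have m: "mild p x (s + t) ?v" using s t pc by (intro flow_mild) auto
  then have vc: "continuous_on {0..s + t} ?v" by (simp add: mild_def)
  have "mild (\<lambda>r. p (s + r)) (?v s) t (\<lambda>r. ?v (s + r))"
    unfolding mild_def
  proof (intro conjI ballI)
    show "continuous_on {0..t} (\<lambda>r. ?v (s + r))"
      using s by (intro continuous_on_compose2[OF vc] continuous_intros) auto
    fix r assume r: "r \<in> {0..t}"
    have fc: "continuous_on {0..s + r} (\<lambda>r. F (p r) (?v r))"
      using r by (intro F.continuous_on pc continuous_on_subset[OF vc]) auto
    have "?v (s + r) = E (r + s) x - duhamel (\<lambda>r. F (p r) (?v r)) (s + r)"
      using m r s by (simp add: mild_def add.commute)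
    also have "\<dots> = E r (E s x - duhamel (\<lambda>r. F (p r) (?v r)) s) - duhamel (\<lambda>r'. F (p (s + r')) (?v (s + r'))) r"
      using r s fc by (subst duhamel_add_time) (auto simp: E_add E_diff)
    also have "E s x - duhamel (\<lambda>r. F (p r) (?v r)) s = ?v s"
      using m s t by (simp add: mild_def)
    finally show "?v (s + r) = E r (?v s) - duhamel (\<lambda>r'. F (p (s + r')) (?v (s + r'))) r" .
  qed
  then have "mild q (?v s) t (\<lambda>r. ?v (s + r))"
    by (rule mild_cong) (use q in auto)
  moreover have "continuous_on {0..t} q"
  proof -
    have "continuous_on {0..t} (\<lambda>r. p (s + r))"
      by (intro continuous_on_compose2[OF p] continuous_intros) auto
    then show ?thesis by (rule continuous_on_eq) (use q in auto)
  qed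
  ultimately show ?thesis using t by (intro flow_eq[symmetric]) auto
qed

section \<open>Local exact controllability by quadratic iteration\<close>

text \<open>
  Null controllability of the system linearised at \<open>\<phi>\<close>, in every time \<open>\<tau> \<le> 1\<close>, with cost
  \<open>exp (C / \<tau>\<^sup>4)\<close>. The controls vanish at both ends so that they can be concatenated continuously.
\<close>

definition null_controllable :: "'a \<Rightarrow> real \<Rightarrow> bool" where
  "null_controllable \<phi> C \<longleftrightarrow> (\<forall>\<tau> w. 0 < \<tau> \<longrightarrow> \<tau> \<le> 1 \<longrightarrow>
     (\<exists>p. continuous_on UNIV p \<and> (\<forall>x. x \<le> 0 \<or> \<tau> \<le> x \<longrightarrow> p x = 0) \<and>
        (\<forall>x. norm (p x) \<le> exp (C / \<tau> ^ 4) * norm w) \<and> E \<tau> w = duhamel (\<lambda>s. F (p s) \<phi>) \<tau>))"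

text \<open>
  Use the control of the linearised system in the bilinear one. With \<open>y\<close> the deviation from \<open>\<phi>\<close>, the
  terms of \<open>y \<tau>\<close> that are linear in \<open>w\<close> cancel and \<open>y \<tau>\<close> equals minus the Duhamel integral of
  \<open>F (p s) (y s)\<close>. Both \<open>p\<close> and \<open>y\<close> are of order \<open>exp (C / \<tau>\<^sup>4) \<parallel>w\<parallel>\<close>, hence the square. The
  constants are absorbed by enlarging \<open>C\<close> to \<open>G\<close>.
\<close>

lemma control_step:
  assumes \<phi>: "\<And>t. 0 \<le> t \<Longrightarrow> E t \<phi> = \<phi>" and C: "0 < C"
    and null: "null_controllable \<phi> C"
  obtains G where "0 < G"
    "\<And>\<tau> w. 0 < \<tau> \<Longrightarrow> \<tau> \<le> 1 \<Longrightarrow> exp (G / \<tau> ^ 4) * norm w \<le> 1 \<Longrightarrow>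
      \<exists>p. continuous_on UNIV p \<and> (\<forall>x. x \<le> 0 \<or> \<tau> \<le> x \<longrightarrow> p x = 0) \<and>
        (\<forall>x. norm (p x) \<le> exp (G / \<tau> ^ 4) * norm w) \<and>
        norm (flow p (\<phi> + w) \<tau> - \<phi>) \<le> (exp (G / \<tau> ^ 4) * norm w)\<^sup>2"
proof -
  obtain b where b: "0 < b" "\<And>c x. norm (F c x) \<le> b * (norm c * norm x)" using F_bound by blast
  define \<kappa> where "\<kappa> = 1 + 2 * b + 2 * b * (1 + b * norm \<phi>)"
  have \<kappa>: "1 \<le> \<kappa>" "2 * b \<le> \<kappa>" "2 * b * (1 + b * norm \<phi>) \<le> \<kappa>"
    using b(1) by (auto simp: \<kappa>_def intro!: add_nonneg_nonneg mult_nonneg_nonneg)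
  define G where "G = C + \<kappa>"
  have "0 < G" using C \<kappa> by (simp add: G_def)
  moreover have "\<exists>p. continuous_on UNIV p \<and> (\<forall>x. x \<le> 0 \<or> \<tau> \<le> x \<longrightarrow> p x = 0) \<and>
        (\<forall>x. norm (p x) \<le> exp (G / \<tau> ^ 4) * norm w) \<and>
        norm (flow p (\<phi> + w) \<tau> - \<phi>) \<le> (exp (G / \<tau> ^ 4) * norm w)\<^sup>2"
    if \<tau>: "0 < \<tau>" "\<tau> \<le> 1" and small: "exp (G / \<tau> ^ 4) * norm w \<le> 1" for \<tau> w
  proof -
    define P where "P = exp (C / \<tau> ^ 4) * norm w"
    obtain p where p: "continuous_on UNIV p" "\<And>x. x \<le> 0 \<or> \<tau> \<le> x \<Longrightarrow> p x = 0"
      "\<And>x. norm (p x) \<le> P" and nc: "E \<tau> w = duhamel (\<lambda>s. F (p s) \<phi>) \<tau>"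
      using null \<tau> unfolding null_controllable_def P_def by blast
    have P0: "0 \<le> P" by (simp add: P_def)
    have wP: "norm w \<le> P"
      using C \<tau> mult_right_mono[of 1 "exp (C / \<tau> ^ 4)" "norm w"] by (simp add: P_def)
    have \<kappa>P: "\<kappa> * P \<le> exp (G / \<tau> ^ 4) * norm w"
    proof -
      have "\<kappa> \<le> exp \<kappa>" using exp_ge_add_one_self[of \<kappa>] by linarith
      also have "\<dots> \<le> exp (\<kappa> / \<tau> ^ 4)"
        using \<kappa>(1) \<tau> by (simp add: field_simps power_le_one)
      finally have "\<kappa> * P \<le> exp (\<kappa> / \<tau> ^ 4) * P" using P0 by (intro mult_right_mono) auto
      also have "\<dots> = exp (G / \<tau> ^ 4) * norm w"
        by (simp add: P_def G_def add_divide_distrib exp_add)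
      finally show ?thesis .
    qed
    have bP: "b * P \<le> 1/2"
      using mult_right_mono[OF \<kappa>(2) P0] \<kappa>P small by linarith
    have pb: "norm (p x) \<le> exp (G / \<tau> ^ 4) * norm w" for x
      using p(3)[of x] \<kappa>P mult_right_mono[OF \<kappa>(1) P0] by linarith
    have pc: "continuous_on S p" for S using p(1) by (rule continuous_on_subset) auto
    have m: "mild p (\<phi> + w) \<tau> (flow p (\<phi> + w))" using \<tau> pc by (intro flow_mild) auto
    define y where "y t = flow p (\<phi> + w) t - \<phi>" for t
    have yc: "continuous_on {0..\<tau>} y"
      unfolding y_def using m by (intro continuous_intros) (simp add: mild_def)
    have Fy: "continuous_on {0..t} (\<lambda>s. F (p s) (y s))" if "t \<le> \<tau>" for t
      using that by (intro F.continuous_on pc continuous_on_subset[OF yc]) auto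
    have Ff: "continuous_on {0..t} (\<lambda>s. F (p s) \<phi>)" for t
      by (intro F.continuous_on pc continuous_intros)
    have Fs: "continuous_on {0..t} (\<lambda>s. F (p s) (\<phi> + y s))" if "t \<le> \<tau>" for t
      using that by (intro F.continuous_on pc continuous_intros continuous_on_subset[OF yc]) auto
    have yeq: "y t = E t w - duhamel (\<lambda>s. F (p s) (\<phi> + y s)) t" if t: "t \<in> {0..\<tau>}" for t
    proof -
      have "flow p (\<phi> + w) t = E t (\<phi> + w) - duhamel (\<lambda>s. F (p s) (flow p (\<phi> + w) s)) t"
        using m t by (simp add: mild_def)
      then show ?thesis using t \<phi>[of t] linear_add[OF E_linear, of t \<phi> w] by (simp add: y_def)
    qed
    obtain s0 where s0: "s0 \<in> {0..\<tau>}" and max: "\<And>s. s \<in> {0..\<tau>} \<Longrightarrow> norm (y s) \<le> norm (y s0)"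
    proof -
      have "\<exists>x\<in>{0..\<tau>}. \<forall>s\<in>{0..\<tau>}. norm (y s) \<le> norm (y x)"
        by (rule continuous_attains_sup) (use yc \<tau> in \<open>auto intro: continuous_on_norm\<close>)
      then show ?thesis using that by blast
    qed
    define mx where "mx = norm (y s0)"
    have mx0: "0 \<le> mx" by (simp add: mx_def)
    have "mx \<le> norm w + b * P * (norm \<phi> + mx)"
    proof -
      have "norm (duhamel (\<lambda>s. F (p s) (\<phi> + y s)) s0) \<le> integral {0..s0} (\<lambda>s. b * P * (norm \<phi> + mx))"
      proof (rule duhamel_norm_le)
        fix s assume "s \<in> {0..s0}"
        then have ys: "norm (y s) \<le> mx" using s0 max by (auto simp: mx_def)
        have "norm (F (p s) (\<phi> + y s)) \<le> b * (norm (p s) * norm (\<phi> + y s))" by (rule b(2))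
        also have "\<dots> \<le> b * (P * (norm \<phi> + mx))"
          using b(1) p(3)[of s] ys P0 norm_triangle_ineq[of \<phi> "y s"] by (intro mult_left_mono mult_mono) auto
        finally show "norm (F (p s) (\<phi> + y s)) \<le> b * P * (norm \<phi> + mx)" by (simp add: mult.assoc)
      qed (use Fs s0 in auto)
      also have "\<dots> = s0 * (b * P * (norm \<phi> + mx))" using s0 by simp
      also have "\<dots> \<le> 1 * (b * P * (norm \<phi> + mx))"
        using s0 \<tau> b(1) P0 mx0 by (intro mult_right_mono) auto
      finally have "norm (E s0 w - duhamel (\<lambda>s. F (p s) (\<phi> + y s)) s0) \<le> norm w + b * P * (norm \<phi> + mx)"
        using E_norm[of s0 w] s0 by (intro order.trans[OF norm_triangle_ineq4]) auto
      then show ?thesis using yeq[OF s0] by (simp add: mx_def)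
    qed
    also have "\<dots> \<le> P + b * P * norm \<phi> + 1/2 * mx"
      using wP mult_right_mono[OF bP mx0] by (simp add: algebra_simps)
    finally have mxP: "mx \<le> 2 * (1 + b * norm \<phi>) * P" by (simp add: algebra_simps)
    have "y \<tau> = - duhamel (\<lambda>s. F (p s) (y s)) \<tau>"
    proof -
      have "duhamel (\<lambda>s. F (p s) (y s)) \<tau> = duhamel (\<lambda>s. F (p s) (\<phi> + y s) - F (p s) \<phi>) \<tau>"
        by (intro duhamel_cong) (simp add: F.add_right)
      also have "\<dots> = duhamel (\<lambda>s. F (p s) (\<phi> + y s)) \<tau> - E \<tau> w"
        unfolding nc by (rule duhamel_diff) (use Fs Ff in auto)
      finally show ?thesis using yeq[of \<tau>] \<tau> by simp
    qed
    then have "norm (y \<tau>) = norm (duhamel (\<lambda>s. F (p s) (y s)) \<tau>)" by simp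
    also have "\<dots> \<le> integral {0..\<tau>} (\<lambda>s. b * P * mx)"
    proof (rule duhamel_norm_le)
      fix s assume "s \<in> {0..\<tau>}"
      then have ys: "norm (y s) \<le> mx" using max by (auto simp: mx_def)
      have "norm (F (p s) (y s)) \<le> b * (norm (p s) * norm (y s))" by (rule b(2))
      also have "\<dots> \<le> b * (P * mx)"
        using b(1) p(3)[of s] ys P0 by (intro mult_left_mono mult_mono) auto
      finally show "norm (F (p s) (y s)) \<le> b * P * mx" by (simp add: mult.assoc)
    qed (use Fy in auto)
    also have "\<dots> = \<tau> * (b * P * mx)" using \<tau> by simp
    also have "\<dots> \<le> 1 * (b * P * mx)"
      using \<tau> b(1) P0 mx0 by (intro mult_right_mono) auto
    also have "\<dots> \<le> b * P * (2 * (1 + b * norm \<phi>) * P)"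
      unfolding mult_1 using mxP b(1) P0 by (intro mult_left_mono) auto
    also have "\<dots> = 2 * b * (1 + b * norm \<phi>) * P\<^sup>2" by (simp add: power2_eq_square)
    also have "\<dots> \<le> \<kappa>\<^sup>2 * P\<^sup>2"
    proof (intro mult_right_mono)
      show "2 * b * (1 + b * norm \<phi>) \<le> \<kappa>\<^sup>2"
      proof -
        have "\<kappa> * 1 \<le> \<kappa> * \<kappa>" using \<kappa>(1) by (intro mult_left_mono) auto
        then show ?thesis using \<kappa>(3) by (simp add: power2_eq_square)
      qed
    qed simp
    also have "\<dots> = (\<kappa> * P)\<^sup>2" by (simp add: power_mult_distrib)
    also have "\<dots> \<le> (exp (G / \<tau> ^ 4) * norm w)\<^sup>2"
      using \<kappa>P \<kappa>(1) P0 by (intro power_mono) auto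
    finally show ?thesis using p(1,2) pb unfolding y_def by blast
  qed
  ultimately show ?thesis using that[of G] by blast
qed

text \<open>
  The steps have the lengths \<open>\<tau> j = \<rho> ^ j\<close> with \<open>\<rho> ^ 4 = 2/3\<close>, so that the cost of the \<open>j\<close>-th step is
  \<open>exp (G (3/2) ^ j)\<close> while the total time is finite. If the distance before the step is at most
  \<open>exp (- 4 G (3/2) ^ j)\<close>, then after it the distance is at most
  \<open>(exp (G (3/2) ^ j) exp (- 4 G (3/2) ^ j))\<^sup>2 = exp (- 6 G (3/2) ^ j)\<close>, which is
  \<open>exp (- 4 G (3/2) ^ (j + 1))\<close>, so the estimate reproduces itself. The controls of the steps tend to \<open>0\<close>
  geometrically, so their concatenation is continuous up to the final time, and the distance there
  is \<open>0\<close> by continuity of the state.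
\<close>

theorem local_exact_controllability:
  assumes \<phi>: "\<And>t. 0 \<le> t \<Longrightarrow> E t \<phi> = \<phi>" and C: "0 < C"
    and null: "null_controllable \<phi> C"
  obtains \<delta> T where "0 < \<delta>" "0 < T"
    "\<forall>w. norm w \<le> \<delta> \<longrightarrow> (\<exists>p. continuous_on UNIV p \<and> (\<forall>t\<le>0. p t = 0) \<and> flow p (\<phi> + w) T = \<phi>)"
proof -
  obtain G where G: "0 < G"
    and step: "\<And>\<tau> w. 0 < \<tau> \<Longrightarrow> \<tau> \<le> 1 \<Longrightarrow> exp (G / \<tau> ^ 4) * norm w \<le> 1 \<Longrightarrow>
      \<exists>p. continuous_on UNIV p \<and> (\<forall>x. x \<le> 0 \<or> \<tau> \<le> x \<longrightarrow> p x = 0) \<and>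
        (\<forall>x. norm (p x) \<le> exp (G / \<tau> ^ 4) * norm w) \<and>
        norm (flow p (\<phi> + w) \<tau> - \<phi>) \<le> (exp (G / \<tau> ^ 4) * norm w)\<^sup>2"
    by (rule control_step[OF \<phi> C null]) (assumption, rule that, blast+)
  define \<rho> :: real where "\<rho> = root 4 (2/3)"
  have \<rho>: "0 < \<rho>" "\<rho> < 1" "\<rho> ^ 4 = 2/3" by (auto simp: \<rho>_def)
  define \<tau> where "\<tau> j = \<rho> ^ j" for j
  have \<tau>: "0 < \<tau> j" "\<tau> j \<le> 1" for j using \<rho> by (auto simp: \<tau>_def power_le_one)
  have \<tau>4: "G / \<tau> j ^ 4 = G * (3/2) ^ j" for j
  proof -
    have "\<tau> j ^ 4 = (2/3) ^ j" unfolding \<tau>_def \<rho>(3)[symmetric] by (simp flip: power_mult add: mult.commute)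
    then show ?thesis by (simp add: power_divide)
  qed
  define t where "t j = (\<Sum>i<j. \<tau> i)" for j
  define T where "T = (\<Sum>i. \<tau> i)"
  have s\<tau>: "summable \<tau>" unfolding \<tau>_def using \<rho> by (intro summable_geometric) auto
  have tT: "t \<longlonglongrightarrow> T" unfolding t_def T_def using s\<tau> by (rule summable_LIMSEQ)
  have t_le: "t j \<le> T" for j unfolding t_def T_def using s\<tau> \<tau> by (intro sum_le_suminf) (auto intro: less_imp_le)
  have t0: "0 \<le> t j" for j unfolding t_def using \<tau> by (intro sum_nonneg) (auto intro: less_imp_le)
  have t_mono: "t i \<le> t j" if "i \<le> j" for i j
    unfolding t_def using \<tau> that by (intro sum_mono2) (auto intro: less_imp_le)
  have tS: "t (Suc j) = t j + \<tau> j" for j by (simp add: t_def)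
  have "0 < T" using t_le[of 1] \<tau>[of 0] by (simp add: t_def)
  moreover have "0 < exp (- 4 * G)" by simp
  moreover have "\<exists>p. continuous_on UNIV p \<and> (\<forall>s\<le>0. p s = 0) \<and> flow p (\<phi> + w) T = \<phi>"
    if w: "norm w \<le> exp (- 4 * G)" for w
  proof -
    define good where "good j x p \<longleftrightarrow> continuous_on UNIV p \<and> (\<forall>s. s \<le> 0 \<or> \<tau> j \<le> s \<longrightarrow> p s = 0) \<and>
        (\<forall>s. norm (p s) \<le> exp (G / \<tau> j ^ 4) * norm x) \<and>
        norm (flow p (\<phi> + x) (\<tau> j) - \<phi>) \<le> (exp (G / \<tau> j ^ 4) * norm x)\<^sup>2" for j x p
    define ctl where "ctl j x = (SOME p. good j x p)" for j x
    have ctl: "good j x (ctl j x)" if "exp (G / \<tau> j ^ 4) * norm x \<le> 1" for j x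
    proof -
      have "\<exists>p. good j x p" using step[OF \<tau> that] unfolding good_def by blast
      then show ?thesis unfolding ctl_def by (rule someI_ex)
    qed
    \<comment> \<open>\<open>W j\<close> is the deviation from \<open>\<phi>\<close> at time \<open>t j\<close>; \<open>p j\<close> is the control of the step that starts there.\<close>
    define W where "W = rec_nat w (\<lambda>j x. flow (ctl j x) (\<phi> + x) (\<tau> j) - \<phi>)"
    have W0: "W 0 = w" and WS: "W (Suc j) = flow (ctl j (W j)) (\<phi> + W j) (\<tau> j) - \<phi>" for j
      by (simp_all add: W_def)
    define p where "p j = ctl j (W j)" for j
    have Wsmall: "exp (G / \<tau> j ^ 4) * norm x \<le> exp (- 3 * G * (3/2) ^ j)"
      if "norm x \<le> exp (- 4 * G * (3/2) ^ j)" for j x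
    proof -
      have "exp (G / \<tau> j ^ 4) * norm x \<le> exp (G / \<tau> j ^ 4) * exp (- 4 * G * (3/2) ^ j)"
        using that by (intro mult_left_mono) auto
      also have "\<dots> = exp (- 3 * G * (3/2) ^ j)" unfolding \<tau>4 by (simp flip: exp_add)
      finally show ?thesis .
    qed
    have le1: "exp (- 3 * G * (3/2) ^ j) \<le> 1" for j using G by simp
    have Wb: "norm (W j) \<le> exp (- 4 * G * (3/2) ^ j)" for j
    proof (induction j)
      case 0
      then show ?case using w by (simp add: W0)
    next
      case (Suc j)
      have "norm (W (Suc j)) \<le> (exp (G / \<tau> j ^ 4) * norm (W j))\<^sup>2"
        using ctl[OF order.trans[OF Wsmall[OF Suc] le1]] by (simp add: WS good_def)
      also have "\<dots> \<le> (exp (- 3 * G * (3/2) ^ j))\<^sup>2"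
        using Wsmall[OF Suc] by (intro power_mono) auto
      also have "\<dots> = exp (- 4 * G * (3/2) ^ Suc j)"
        by (simp flip: exp_of_nat_mult exp_double)
      finally show ?case .
    qed
    have good: "good j (W j) (p j)" for j
      unfolding p_def by (rule ctl[OF order.trans[OF Wsmall[OF Wb] le1]])
    have pc: "continuous_on UNIV (p j)" and p0: "s \<le> 0 \<or> \<tau> j \<le> s \<Longrightarrow> p j s = 0" for j s
      using good by (auto simp: good_def)
    have geo: "exp (- 3 * G * (3/2) ^ j) \<le> exp (- (3 * G)) * exp (- (3 * G / 2)) ^ j" for j
    proof -
      have "1 + real j * (1/2) \<le> (1 + 1/2) ^ j" by (rule Bernoulli_inequality) simp
      then have "exp (- 3 * G * (3/2) ^ j) \<le> exp (- (3 * G) * (1 + real j * (1/2)))"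
        using G by simp
      also have "\<dots> = exp (- (3 * G)) * exp (- (3 * G / 2)) ^ j"
        by (simp add: exp_of_nat_mult[symmetric] algebra_simps flip: exp_add)
      finally show ?thesis .
    qed
    have pb: "norm (p j s) \<le> exp (- (3 * G)) * exp (- (3 * G / 2)) ^ j" for j s
    proof -
      have "norm (p j s) \<le> exp (G / \<tau> j ^ 4) * norm (W j)"
        using good[of j] by (simp add: good_def)
      also note Wsmall[OF Wb, of j]
      also note geo
      finally show ?thesis .
    qed
    define q where "q s = (\<Sum>j. p j (s - t j))" for s
    have sumq: "summable (\<lambda>j. exp (- (3 * G)) * exp (- (3 * G / 2)) ^ j)"
      using G by (intro summable_mult summable_geometric) auto
    have ul: "uniform_limit UNIV (\<lambda>n s. \<Sum>j<n. p j (s - t j)) q sequentially"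
      unfolding q_def[abs_def] by (rule Weierstrass_m_test[OF pb sumq])
    have "continuous_on UNIV (\<lambda>s. \<Sum>j<n. p j (s - t j))" for n
      by (intro continuous_on_sum continuous_on_compose2[OF pc] continuous_intros) auto
    then have qc: "continuous_on UNIV q"
      by (intro uniform_limit_theorem[OF _ ul] always_eventually) auto
    have q0: "q s = 0" if "s \<le> 0" for s
    proof -
      have "p j (s - t j) = 0" for j using that t0[of j] by (intro p0) auto
      then show ?thesis by (simp add: q_def)
    qed
    \<comment> \<open>The supports of the shifted controls overlap at most in end points, where all controls vanish.\<close>
    have qp: "p j r = q (t j + r)" if r: "r \<in> {0..\<tau> j}" for j r
    proof -
      have "p i (t j + r - t i) = 0" if "i \<noteq> j" for i
      proof (cases "i < j")
        case True
        then show ?thesis using t_mono[of "Suc i" j] tS[of i] r by (intro p0) auto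
      next
        case False
        then show ?thesis using t_mono[of "Suc j" i] tS[of j] r that by (intro p0) auto
      qed
      then have eq: "(\<lambda>i. p i (t j + r - t i)) = (\<lambda>i. if i = j then p i (t j + r - t i) else 0)" by auto
      have "(\<lambda>i. p i (t j + r - t i)) sums p j (t j + r - t j)"
        using sums_single[of j "\<lambda>i. p i (t j + r - t i)"] unfolding eq[symmetric] .
      then show ?thesis by (simp add: q_def sums_iff)
    qed
    have fl: "flow q (\<phi> + w) (t j) = \<phi> + W j" for j
    proof (induction j)
      case 0
      have "mild q (\<phi> + w) 0 (flow q (\<phi> + w))"
        by (intro flow_mild continuous_on_subset[OF qc]) auto
      then show ?case by (simp add: t_def W0 mild_def E_0 duhamel_def)
    next
      case (Suc j)
      have "flow q (\<phi> + w) (t j + \<tau> j) = flow (p j) (flow q (\<phi> + w) (t j)) (\<tau> j)"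
        using t0 \<tau> qp by (intro flow_add qc) (auto intro: less_imp_le)
      then show ?case by (simp add: tS Suc WS p_def)
    qed
    have "mild q (\<phi> + w) T (flow q (\<phi> + w))"
      using \<open>0 < T\<close> by (intro flow_mild continuous_on_subset[OF qc]) auto
    then have "continuous_on {0..T} (flow q (\<phi> + w))" by (simp add: mild_def)
    then have "(\<lambda>j. flow q (\<phi> + w) (t j)) \<longlonglongrightarrow> flow q (\<phi> + w) T"
      by (rule continuous_on_tendsto_compose[OF _ tT]) (use t0 t_le \<open>0 < T\<close> in auto)
    moreover have "(\<lambda>j. \<phi> + W j) \<longlonglongrightarrow> \<phi> + 0"
    proof (intro tendsto_add tendsto_const)
      have "norm (W j) \<le> exp (- (3 * G)) * exp (- (3 * G / 2)) ^ j" for j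
      proof -
        have "exp (- 4 * G * (3/2) ^ j) \<le> exp (- 3 * G * (3/2) ^ j)" using G by simp
        then show ?thesis using Wb[of j] geo[of j] by linarith
      qed
      then show "W \<longlonglongrightarrow> 0"
        by (intro Lim_null_comparison[OF _ summable_LIMSEQ_zero[OF sumq]] always_eventually) auto
    qed
    ultimately have "flow q (\<phi> + w) T = \<phi>"
      unfolding fl using LIMSEQ_unique by fastforce
    then show ?thesis using qc q0 by blast
  qed
  ultimately show ?thesis using that by blast
qed

end

section \<open>Diagonal semigroups\<close>

text \<open>
  A complete family of mutually orthogonal projections with respect to the real inner product. For real
  scalars the ranges will be real lines, for complex scalars complex lines; the arguments of this section
  are the same in both cases.
\<close>

locale orthogonal_resolution =
  fixes P :: "nat \<Rightarrow> 'a::{real_inner, banach} \<Rightarrow> 'a"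
  assumes P_linear: "linear (P k)"
    and P_sym: "P k x \<bullet> y = x \<bullet> P k y"
    and P_mult: "P j (P k x) = (if j = k then P k x else 0)"
    and P_total: "(\<And>k. P k x = 0) \<Longrightarrow> x = 0"
begin

lemma eqI: "(\<And>k. P k x = P k y) \<Longrightarrow> x = y"
  using P_total[of "x - y"] by (simp add: linear_diff[OF P_linear])

lemma P_bounded_linear: "bounded_linear (P k)"
proof (rule bounded_linear_intro[where K = 1])
  fix x
  have "(norm (P k x))\<^sup>2 = x \<bullet> P k x"
    by (simp add: power2_norm_eq_inner P_sym P_mult)
  also have "\<dots> \<le> norm x * norm (P k x)" by (rule norm_cauchy_schwarz)
  finally show "norm (P k x) \<le> norm x * 1"
    by (cases "P k x = 0") (simp_all add: power2_eq_square)
qed (auto simp: linear_add[OF P_linear] linear_scale[OF P_linear])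

lemma norm_partial_sum:
  assumes "finite I"
  shows "(norm (\<Sum>k\<in>I. c k *\<^sub>R P k x))\<^sup>2 = (\<Sum>k\<in>I. (c k)\<^sup>2 * (norm (P k x))\<^sup>2)"
proof -
  have "pairwise (\<lambda>i j. orthogonal (c i *\<^sub>R P i x) (c j *\<^sub>R P j x)) I"
    by (auto simp: pairwise_def orthogonal_def P_sym P_mult)
  from norm_sum_Pythagorean[OF assms this] show ?thesis
    by (simp add: power_mult_distrib)
qed

lemma bessel: "finite I \<Longrightarrow> (\<Sum>k\<in>I. (norm (P k x))\<^sup>2) \<le> (norm x)\<^sup>2"
proof -
  assume I: "finite I"
  define s where "s = (\<Sum>k\<in>I. P k x)"
  have s2: "(norm s)\<^sup>2 = (\<Sum>k\<in>I. (norm (P k x))\<^sup>2)"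
    using norm_partial_sum[OF I, of "\<lambda>_. 1" x] by (simp add: s_def)
  also have "\<dots> = x \<bullet> s"
    by (simp add: s_def inner_sum_right power2_norm_eq_inner P_sym P_mult)
  also have "\<dots> \<le> norm x * norm s" by (rule norm_cauchy_schwarz)
  finally have "norm s \<le> norm x"
    by (cases "s = 0") (simp_all add: power2_eq_square)
  then have "(norm s)\<^sup>2 \<le> (norm x)\<^sup>2" by (intro power_mono) auto
  then show ?thesis by (simp add: s2)
qed

lemma norm_weighted_sum_le:
  assumes "finite I" "\<And>k. \<bar>c k\<bar> \<le> C"
  shows "(norm (\<Sum>k\<in>I. c k *\<^sub>R P k x))\<^sup>2 \<le> C\<^sup>2 * (\<Sum>k\<in>I. (norm (P k x))\<^sup>2)"
proof -
  have "(c k)\<^sup>2 \<le> C\<^sup>2" for k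
    using power_mono[OF assms(2)[of k], of 2] by simp
  then show ?thesis
    unfolding norm_partial_sum[OF assms(1)] sum_distrib_left
    by (intro sum_mono mult_right_mono) auto
qed

lemma summable_weighted:
  assumes c: "\<And>k. \<bar>c k\<bar> \<le> C"
  shows "summable (\<lambda>k. c k *\<^sub>R P k x)"
  unfolding summable_Cauchy
proof (intro allI impI)
  fix e :: real assume e: "0 < e"
  have sq: "summable (\<lambda>k. (norm (P k x))\<^sup>2)"
    by (rule summableI_nonneg_bounded[of _ "(norm x)\<^sup>2"]) (auto intro: bessel)
  define e' where "e' = e\<^sup>2 / (C\<^sup>2 + 1)"
  have C1: "0 < C\<^sup>2 + 1" by (simp add: add_nonneg_pos)
  have "0 < e'" using e C1 by (simp add: e'_def)
  then obtain N where N: "\<And>m n. m \<ge> N \<Longrightarrow> norm (sum (\<lambda>k. (norm (P k x))\<^sup>2) {m..<n}) < e'"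
    using sq unfolding summable_Cauchy by blast
  have "norm (\<Sum>k=m..<n. c k *\<^sub>R P k x) < e" if m: "m \<ge> N" for m n
  proof -
    have "(norm (\<Sum>k=m..<n. c k *\<^sub>R P k x))\<^sup>2 \<le> C\<^sup>2 * (\<Sum>k=m..<n. (norm (P k x))\<^sup>2)"
      by (rule norm_weighted_sum_le) (auto intro: c)
    also have "\<dots> \<le> C\<^sup>2 * e'"
      using N[OF m, of n] by (intro mult_left_mono) auto
    also have "\<dots> < e\<^sup>2"
      using e C1 by (simp add: e'_def field_simps)
    finally show ?thesis using e by (simp add: power_less_imp_less_base)
  qed
  then show "\<exists>N. \<forall>m\<ge>N. \<forall>n. norm (\<Sum>k=m..<n. c k *\<^sub>R P k x) < e" by blast
qed

definition diag :: "(nat \<Rightarrow> real) \<Rightarrow> 'a \<Rightarrow> 'a" where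
  "diag c x = (\<Sum>k. c k *\<^sub>R P k x)"

lemma P_diag:
  assumes "\<And>k. \<bar>c k\<bar> \<le> C"
  shows "P j (diag c x) = c j *\<^sub>R P j x"
proof -
  have "P j (diag c x) = (\<Sum>k. P j (c k *\<^sub>R P k x))"
    unfolding diag_def by (rule bounded_linear.suminf[OF P_bounded_linear summable_weighted[OF assms]])
  also have "\<dots> = (\<Sum>k. if k = j then c j *\<^sub>R P j x else 0)"
    by (intro suminf_cong) (auto simp: linear_scale[OF P_linear] P_mult)
  also have "\<dots> = c j *\<^sub>R P j x"
    using sums_unique[OF sums_single[of j "\<lambda>_. c j *\<^sub>R P j x"]] by simp
  finally show ?thesis .
qed

lemma diag_norm_le:
  assumes c: "\<And>k. \<bar>c k\<bar> \<le> C"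
  shows "norm (diag c x) \<le> C * norm x"
proof -
  have C: "0 \<le> C" using c[of 0] by linarith
  have "norm (\<Sum>k<n. c k *\<^sub>R P k x) \<le> C * norm x" for n
  proof (rule power2_le_imp_le)
    have "(norm (\<Sum>k<n. c k *\<^sub>R P k x))\<^sup>2 \<le> C\<^sup>2 * (\<Sum>k<n. (norm (P k x))\<^sup>2)"
      by (rule norm_weighted_sum_le) (auto intro: c)
    also have "\<dots> \<le> C\<^sup>2 * (norm x)\<^sup>2" by (intro mult_left_mono bessel) auto
    finally show "(norm (\<Sum>k<n. c k *\<^sub>R P k x))\<^sup>2 \<le> (C * norm x)\<^sup>2"
      by (simp add: power_mult_distrib)
  qed (use C in simp)
  moreover have "(\<lambda>n. norm (\<Sum>k<n. c k *\<^sub>R P k x)) \<longlonglongrightarrow> norm (diag c x)"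
    unfolding diag_def by (intro tendsto_norm summable_LIMSEQ summable_weighted[OF c])
  ultimately show ?thesis by (intro LIMSEQ_le_const2) auto
qed

lemma expansion: "(\<lambda>n. \<Sum>k<n. P k x) \<longlonglongrightarrow> x"
proof -
  have "diag (\<lambda>_. 1) x = x"
    by (rule eqI) (subst P_diag[of _ 1], auto)
  moreover have "(\<lambda>n. \<Sum>k<n. 1 *\<^sub>R P k x) \<longlonglongrightarrow> diag (\<lambda>_. 1) x"
    unfolding diag_def by (intro summable_LIMSEQ summable_weighted[of _ 1]) auto
  ultimately show ?thesis by simp
qed

end

locale spectral_semigroup = orthogonal_resolution P
  for P :: "nat \<Rightarrow> 'a::{real_inner, banach} \<Rightarrow> 'a" +
  fixes \<mu> :: "nat \<Rightarrow> real"
  assumes \<mu>_nonneg: "0 \<le> \<mu> k"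
begin

definition E :: "real \<Rightarrow> 'a \<Rightarrow> 'a" where
  "E t = diag (\<lambda>k. exp (- \<mu> k * t))"

lemma weight_le_1: "0 \<le> t \<Longrightarrow> \<bar>exp (- \<mu> k * t)\<bar> \<le> 1"
  using \<mu>_nonneg by simp

lemma P_E: "0 \<le> t \<Longrightarrow> P k (E t x) = exp (- \<mu> k * t) *\<^sub>R P k x"
  unfolding E_def by (rule P_diag[OF weight_le_1])

lemma E_contraction: "0 \<le> t \<Longrightarrow> norm (E t x) \<le> norm x"
  unfolding E_def using diag_norm_le[OF weight_le_1] by simp

sublocale contraction_semigroup E
proof (rule contraction_semigroup.intro)
  fix t :: real assume t: "0 \<le> t"
  show "linear (E t)"
    by (rule linearI; rule eqI) (simp_all add: P_E[OF t] linear_add[OF P_linear] linear_scale[OF P_linear] algebra_simps)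
  show "norm (E t x) \<le> norm x" for x
    by (rule E_contraction[OF t])
next
  show "E 0 x = x" for x by (rule eqI) (simp add: P_E[OF order.refl])
next
  fix s t :: real and x assume st: "0 \<le> s" "0 \<le> t"
  show "E (s + t) x = E s (E t x)"
  proof (rule eqI)
    fix k
    have "exp (- \<mu> k * (s + t)) = exp (- \<mu> k * s) * exp (- \<mu> k * t)"
      by (simp only: ring_distribs exp_add)
    then show "P k (E (s + t) x) = P k (E s (E t x))"
      using st by (simp only: P_E add_nonneg_nonneg scaleR_scaleR)
  qed
next
  fix x
  \<comment> \<open>The tail of the series at time \<open>t\<close> is the image under \<open>E t\<close> of the tail at time \<open>0\<close>, hence small uniformly in \<open>t\<close>.\<close>
  have "uniform_limit {0..} (\<lambda>n t. \<Sum>k<n. exp (- \<mu> k * t) *\<^sub>R P k x) (\<lambda>t. E t x) sequentially"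
    unfolding uniform_limit_sequentially_iff
  proof (intro allI impI)
    fix e :: real assume e: "0 < e"
    obtain N where N: "\<And>n. n \<ge> N \<Longrightarrow> norm ((\<Sum>k<n. P k x) - x) < e"
      using LIMSEQ_D[OF expansion e] by blast
    have "dist (\<Sum>k<n. exp (- \<mu> k * t) *\<^sub>R P k x) (E t x) < e" if n: "n \<ge> N" and t: "t \<in> {0..}" for n t
    proof -
      let ?y = "(\<Sum>k<n. P k x) - x"
      have Psum: "P j (\<Sum>k<n. c k *\<^sub>R P k x) = (if j < n then c j *\<^sub>R P j x else 0)" for j c
        by (simp add: linear_sum[OF P_linear] linear_scale[OF P_linear] P_mult if_distrib cong: if_cong)
      have "(\<Sum>k<n. exp (- \<mu> k * t) *\<^sub>R P k x) - E t x = E t ?y"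
      proof (rule eqI)
        fix j show "P j ((\<Sum>k<n. exp (- \<mu> k * t) *\<^sub>R P k x) - E t x) = P j (E t ?y)"
          using t Psum[of j "\<lambda>_. 1"] Psum[of j "\<lambda>k. exp (- \<mu> k * t)"]
          by (simp add: P_E linear_diff[OF P_linear] algebra_simps)
      qed
      then have "dist (\<Sum>k<n. exp (- \<mu> k * t) *\<^sub>R P k x) (E t x) = norm (E t ?y)" by (simp add: dist_norm)
      also have "\<dots> \<le> norm ?y"
        using t by (intro E_contraction) auto
      finally show ?thesis using N[OF n] by linarith
    qed
    then show "\<exists>N. \<forall>n\<ge>N. \<forall>t\<in>{0..}. dist (\<Sum>k<n. exp (- \<mu> k * t) *\<^sub>R P k x) (E t x) < e" by blast
  qed
  moreover have "continuous_on {0..} (\<lambda>t. \<Sum>k<n. exp (- \<mu> k * t) *\<^sub>R P k x)" for n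
    by (intro continuous_intros)
  ultimately show "continuous_on {0..} (\<lambda>t. E t x)"
    by (intro uniform_limit_theorem[where F = sequentially] always_eventually) auto
qed

lemma E_decay:
  assumes t: "0 \<le> t" and d: "\<And>k. P k x \<noteq> 0 \<Longrightarrow> d \<le> \<mu> k"
  shows "norm (E t x) \<le> exp (- d * t) * norm x"
proof -
  define c where "c k = (if d \<le> \<mu> k then exp (- \<mu> k * t) else 0)" for k
  have c: "\<bar>c k\<bar> \<le> exp (- d * t)" for k
    using t by (auto simp: c_def mult_right_mono)
  have "E t x = diag c x"
  proof (rule eqI)
    fix k show "P k (E t x) = P k (diag c x)"
      unfolding P_E[OF t] P_diag[OF c] using d[of k] by (auto simp: c_def)
  qed
  then show ?thesis using diag_norm_le[OF c] by simp
qed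

lemma E_commute:
  assumes G: "\<And>k x. P k (G x) = G (P k x)" "linear G" and t: "0 \<le> t"
  shows "E t (G x) = G (E t x)"
  by (rule eqI) (simp add: P_E[OF t] G linear_scale[OF G(2)])

end

section \<open>Real and complex scalars\<close>

lemma to_complex_0 [simp]: "to_complex (0 :: 'k::real_or_complex) = 0"
  using norm_to_complex[of "0 :: 'k"] by simp

lemma to_complex_1 [simp]: "to_complex (1 :: 'k::real_or_complex) = 1"
proof -
  have "to_complex (1 :: 'k) * to_complex (1 :: 'k) = to_complex (1 :: 'k)"
    by (simp flip: to_complex_mult)
  moreover have "to_complex (1 :: 'k) \<noteq> 0"
    using norm_to_complex[of "1 :: 'k"] by auto
  ultimately show ?thesis by simp
qed

lemma to_complex_of_real [simp]: "to_complex (of_real r :: 'k::real_or_complex) = of_real r"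
  by (simp add: of_real_def to_complex_scaleR)

lemma to_complex_linear: "bounded_linear (to_complex :: 'k::real_or_complex \<Rightarrow> complex)"
  by (rule bounded_linear_intro[where K = 1]) (simp_all add: to_complex_add to_complex_scaleR norm_to_complex)

lemma to_complex_eq_iff [simp]:
  fixes a b :: "'k::real_or_complex"
  shows "to_complex a = to_complex b \<longleftrightarrow> a = b"
proof
  assume "to_complex a = to_complex b"
  then have "to_complex (a - b) = 0" by (simp add: linear_diff[OF bounded_linear.linear[OF to_complex_linear]])
  then show "a = b" using norm_to_complex[of "a - b"] by simp
qed simp

text \<open>
  Controls are constructed with values in the complex numbers and transported to the scalar field
  by this map. If the field is complex it inverts \<open>to_complex\<close>, and if it is real it takes real parts.
\<close>

lemma to_complex_retraction:
  obtains emb :: "complex \<Rightarrow> 'k::real_or_complex" where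
    "bounded_linear emb" "\<And>c. emb (to_complex c) = c"
proof -
  define J :: 'k where "J = (if range (to_complex :: 'k \<Rightarrow> complex) = UNIV then inv to_complex \<i> else 0)"
  define emb :: "complex \<Rightarrow> 'k" where "emb z = of_real (Re z) + of_real (Im z) * J" for z
  have "bounded_linear emb"
    unfolding emb_def
    by (intro bounded_linear_add bounded_linear_compose[OF bounded_linear_of_real]
        bounded_linear_compose[OF bounded_linear_mult_left] bounded_linear_Re bounded_linear_Im)
  moreover have "emb (to_complex c) = c" for c
  proof (cases "range (to_complex :: 'k \<Rightarrow> complex) = UNIV")
    case True
    then have "to_complex J = \<i>" by (simp add: J_def surj_f_inv_f)
    then have "to_complex (emb (to_complex c)) = to_complex c"
      by (simp add: emb_def to_complex_add to_complex_mult complex_eq_iff)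
    then show ?thesis by simp
  next
    case False
    then have "to_complex c \<in> \<real>" using range_to_complex[where 'a = 'k] by auto
    then have "to_complex (emb (to_complex c)) = to_complex c"
      using False by (auto simp: emb_def J_def complex_is_Real_iff complex_eq_iff)
    then show ?thesis by simp
  qed
  ultimately show ?thesis using that by blast
qed

context hilbert_over
begin

lemma ip_scale_right: "to_complex (ip x (scl c y)) = cnj (to_complex c) * to_complex (ip x y)"
  unfolding ip_conj_sym[of x "scl c y"] ip_scale_left to_complex_mult by (simp flip: ip_conj_sym)

lemma norm_scl: "norm (scl c x) = norm c * norm x"
proof -
  have "(norm (scl c x))\<^sup>2 = Re (to_complex (ip (scl c x) (scl c x)))"
    by (simp add: Re_ip power2_norm_eq_inner)
  also have "\<dots> = Re ((to_complex c * cnj (to_complex c)) * to_complex (ip x x))"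
    by (simp add: ip_scale_right ip_scale_left to_complex_mult mult_ac)
  also have "\<dots> = (norm c * norm x)\<^sup>2"
    unfolding complex_norm_square[symmetric] norm_to_complex
    by (simp add: Re_ip power2_norm_eq_inner power_mult_distrib flip: of_real_power)
  finally show ?thesis by (simp add: power2_eq_iff_nonneg)
qed

lemma scl_bilinear: "bounded_bilinear scl"
proof
  fix r c x
  show "scl (r *\<^sub>R c) x = r *\<^sub>R scl c x"
    by (simp add: scaleR_conv_of_real flip: scale_of_real)
  show "scl c (r *\<^sub>R x) = r *\<^sub>R scl c x"
    by (simp add: mult.commute flip: scale_of_real)
next
  show "\<exists>K. \<forall>c x. norm (scl c x) \<le> norm c * norm x * K"
    by (intro exI[of _ 1]) (simp add: norm_scl)
qed (simp_all add: scale_left_distrib scale_right_distrib)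

text \<open>
  Scaling \<open>x\<close> by \<open>ip y x\<close> makes the inner product with \<open>y\<close> equal to \<open>\<bar>ip x y\<bar>\<^sup>2\<close>, to which the
  Cauchy-Schwarz inequality of the real inner product applies.
\<close>

lemma norm_ip_le: "norm (ip x y) \<le> norm x * norm y"
proof -
  let ?z = "ip x y"
  have nyx: "norm (ip y x) = norm ?z"
    using ip_conj_sym[of y x] by (metis complex_mod_cnj norm_to_complex)
  have "(norm ?z)\<^sup>2 = Re (to_complex (ip (scl (ip y x) x) y))"
    unfolding ip_scale_left to_complex_mult ip_conj_sym[of y x]
    by (simp add: mult.commute[of "cnj _"] norm_to_complex flip: complex_norm_square of_real_power)
  also have "\<dots> = scl (ip y x) x \<bullet> y" by (rule Re_ip)
  also have "\<dots> \<le> norm ?z * (norm x * norm y)"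
    using norm_cauchy_schwarz[of "scl (ip y x) x" y] by (simp add: norm_scl nyx mult.assoc)
  finally show ?thesis
    by (cases "?z = 0") (auto simp: power2_eq_square)
qed

lemma ip_bounded_linear: "bounded_linear (\<lambda>x. ip x y)"
proof (rule bounded_linear_intro[where K = "norm y"])
  fix r x show "ip (r *\<^sub>R x) y = r *\<^sub>R ip x y"
    by (simp add: ip_scale_left scaleR_conv_of_real flip: scale_of_real)
qed (simp_all add: ip_add_left norm_ip_le)

lemma ip_right_bounded_linear: "bounded_linear (\<lambda>y. ip x y)"
proof (rule bounded_linear_intro[where K = "norm x"])
  fix y z
  have "to_complex (ip x (y + z)) = to_complex (ip x y + ip x z)"
    unfolding to_complex_add ip_conj_sym[of x] by (simp add: ip_add_left to_complex_add)
  then show "ip x (y + z) = ip x y + ip x z" by simp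
next
  fix r y
  have "to_complex (ip x (r *\<^sub>R y)) = to_complex (r *\<^sub>R ip x y)"
    unfolding scale_of_real[symmetric] ip_scale_right to_complex_scaleR by (simp add: scaleR_conv_of_real)
  then show "ip x (r *\<^sub>R y) = r *\<^sub>R ip x y" by simp
next
  fix y show "norm (ip x y) \<le> norm y * norm x" using norm_ip_le[of x y] by (simp add: mult.commute)
qed

lemmas ip_left = bounded_linear.linear[OF ip_bounded_linear]
lemmas ip_right = bounded_linear.linear[OF ip_right_bounded_linear]

lemma linear_scl_dense_eqI:
  assumes F: "bounded_operator scl F" and G: "bounded_operator scl G"
    and dense: "closure (span M) = UNIV" and eq: "\<And>x. x \<in> M \<Longrightarrow> F x = G x"
  shows "F x = G x"
proof -
  have lin: "F (x + y) = F x + F y" "F (scl c x) = scl c (F x)" "G (x + y) = G x + G y" "G (scl c x) = scl c (G x)" for x y c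
    using F G unfolding bounded_operator_def Vector_Spaces.linear_iff by auto
  have "subspace {x. F x = G x}"
  proof (rule subspaceI)
    show "0 \<in> {x. F x = G x}" using lin(2)[of 0 0] lin(4)[of 0 0] by simp
  qed (auto simp: lin)
  then have "span M \<subseteq> {x. F x = G x}" using eq by (intro span_minimal) auto
  moreover have "closed {x. F x = G x}"
    using F G unfolding bounded_operator_def
    by (intro closed_Collect_eq linear_continuous_on) auto
  ultimately have "closure (span M) \<subseteq> {x. F x = G x}" by (rule closure_minimal)
  then show ?thesis using dense by auto
qed

end

section \<open>The semigroup of an operator with an eigenbasis\<close>

locale eigen_setting = hilbert_over scl ip
  for scl :: "'k::real_or_complex \<Rightarrow> 'a::{real_inner, banach, second_countable_topology} \<Rightarrow> 'a"
    and ip :: "'a \<Rightarrow> 'a \<Rightarrow> 'k" +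
  fixes D :: "'a set" and A :: "'a \<Rightarrow> 'a" and lam :: "nat \<Rightarrow> real" and \<phi> :: "nat \<Rightarrow> 'a"
  assumes A_sa: "self_adjoint ip D A"
    and eig: "eigen_basis scl ip D A lam \<phi>"
    and lam_nonneg: "1 \<le> k \<Longrightarrow> 0 \<le> lam k"
    and lam_inj: "1 \<le> j \<Longrightarrow> 1 \<le> k \<Longrightarrow> lam j = lam k \<Longrightarrow> j = k"
begin

text \<open>
  The projection with index \<open>k\<close> belongs to the eigenvalue with index \<open>k + 1\<close>.
\<close>

definition P :: "nat \<Rightarrow> 'a \<Rightarrow> 'a" where
  "P k x = scl (ip x (\<phi> (Suc k))) (\<phi> (Suc k))"

lemma ip_\<phi>: "ip (\<phi> (Suc j)) (\<phi> (Suc k)) = (if j = k then 1 else 0)"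
  using eig by (simp add: eigen_basis_def orthonormal_basis_def)

lemma \<phi>_D: "\<phi> (Suc k) \<in> D" and A_\<phi>: "A (\<phi> (Suc k)) = lam (Suc k) *\<^sub>R \<phi> (Suc k)"
  using eig by (simp_all add: eigen_basis_def)

lemma \<phi>_dense: "closure (span (\<phi> ` {1..})) = UNIV"
  using eig by (simp add: eigen_basis_def orthonormal_basis_def)

lemma norm_\<phi>: "norm (\<phi> (Suc k)) = 1"
proof -
  have "(norm (\<phi> (Suc k)))\<^sup>2 = 1"
    using Re_ip[of "\<phi> (Suc k)" "\<phi> (Suc k)"] by (simp add: ip_\<phi> power2_norm_eq_inner)
  then show ?thesis by (simp add: power2_eq_1_iff) (metis norm_ge_zero neg_0_le_iff_le not_one_le_zero)
qed

lemma ip_eq_0_imp_0: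
  assumes "\<And>k. ip x (\<phi> (Suc k)) = 0"
  shows "x = 0"
proof -
  have ip0: "ip y x = 0 \<longleftrightarrow> ip x y = 0" for y
    using ip_conj_sym[of x y] ip_conj_sym[of y x] by (metis complex_cnj_zero to_complex_0 to_complex_eq_iff)
  have "subspace {y. ip y x = 0}"
    by (rule subspaceI) (auto simp: ip_add_left ip_scale_left linear_0[OF ip_left])
  moreover have "\<phi> ` {1..} \<subseteq> {y. ip y x = 0}"
    using assms by (auto simp: ip0) (metis Suc_pred' Suc_le_eq One_nat_def)
  ultimately have "span (\<phi> ` {1..}) \<subseteq> {y. ip y x = 0}" by (intro span_minimal)
  moreover have "closed {y. ip y x = 0}"
    by (intro closed_Collect_eq linear_continuous_on ip_bounded_linear continuous_on_const)
  ultimately have "closure (span (\<phi> ` {1..})) \<subseteq> {y. ip y x = 0}" by (rule closure_minimal)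
  then have "ip x x = 0" using \<phi>_dense by auto
  then show "x = 0" using Re_ip[of x x] by simp
qed

lemma P_eq_0_iff: "P k x = 0 \<longleftrightarrow> ip x (\<phi> (Suc k)) = 0"
  using norm_\<phi>[of k] by (auto simp: P_def)

lemma ip_P: "ip (P k x) (\<phi> (Suc j)) = (if j = k then ip x (\<phi> (Suc k)) else 0)"
  by (simp add: P_def ip_scale_left ip_\<phi>)

lemma ip_P_sym: "ip (P k x) y = ip x (P k y)"
proof -
  have "to_complex (ip (P k x) y) = to_complex (ip x (P k y))"
    unfolding P_def ip_scale_left ip_scale_right to_complex_mult ip_conj_sym[of y "\<phi> (Suc k)"] by simp
  then show ?thesis by simp
qed

sublocale orthogonal_resolution P
proof (rule orthogonal_resolution.intro)
  fix k
  show "linear (P k)"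
    unfolding P_def
    by (intro bounded_linear.linear bounded_linear_compose[OF bounded_bilinear.bounded_linear_left[OF scl_bilinear]] ip_bounded_linear)
  show "P k x \<bullet> y = x \<bullet> P k y" for x y
    unfolding Re_ip[symmetric] by (simp add: ip_P_sym)
  show "P j (P k x) = (if j = k then P k x else 0)" for j x
    unfolding P_def[of j] ip_P by (auto simp: P_def)
next
  fix x assume "\<And>k. P k x = 0"
  then show "x = 0" by (intro ip_eq_0_imp_0) (simp add: P_eq_0_iff)
qed

lemma P_scl: "P k (scl c x) = scl c (P k x)"
  by (simp add: P_def ip_scale_left)

lemma P_\<phi>: "P k (\<phi> (Suc j)) = (if j = k then \<phi> (Suc k) else 0)"
  by (simp add: P_def ip_\<phi>)

sublocale S: spectral_semigroup P "\<lambda>k. lam (Suc k)"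
  by unfold_locales (simp add: lam_nonneg)

abbreviation S :: "real \<Rightarrow> 'a \<Rightarrow> 'a" where "S \<equiv> S.E"

lemma A_sym: "x \<in> D \<Longrightarrow> y \<in> D \<Longrightarrow> ip (A x) y = ip x (A y)"
proof -
  assume "x \<in> D" "y \<in> D"
  moreover have "(y, A y) \<in> adjoint_graph ip D A"
    using \<open>y \<in> D\<close> A_sa by (auto simp: self_adjoint_def op_graph_def)
  ultimately show ?thesis by (simp add: adjoint_graph_def)
qed

lemma P_A:
  assumes "x \<in> D"
  shows "P k (A x) = lam (Suc k) *\<^sub>R P k x"
proof -
  have "ip (A x) (\<phi> (Suc k)) = ip x (lam (Suc k) *\<^sub>R \<phi> (Suc k))"
    using A_sym[OF assms \<phi>_D] by (simp add: A_\<phi>)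
  also have "\<dots> = of_real (lam (Suc k)) * ip x (\<phi> (Suc k))"
    by (simp add: linear_scale[OF ip_right] scaleR_conv_of_real)
  finally show ?thesis by (simp add: P_def flip: scale_of_real)
qed

lemma S_scl: "0 \<le> t \<Longrightarrow> S t (scl c x) = scl c (S t x)"
  by (rule S.E_commute) (simp_all add: P_scl bounded_linear.linear[OF bounded_bilinear.bounded_linear_right[OF scl_bilinear]])

lemma S_\<phi>: "0 \<le> t \<Longrightarrow> S t (\<phi> (Suc k)) = exp (- lam (Suc k) * t) *\<^sub>R \<phi> (Suc k)"
  by (rule eqI) (simp add: S.P_E P_\<phi> linear_scale[OF P_linear])

lemma S_bounded_operator: "0 \<le> t \<Longrightarrow> bounded_operator scl (S t)"
  unfolding bounded_operator_def Vector_Spaces.linear_iff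
  using S.E_bounded_linear[of t] vector_space_axioms
  by (auto simp: S_scl linear_add[OF S.E_linear])

lemma S_semigroup: "c0_semigroup scl S"
  unfolding c0_semigroup_def
proof (intro conjI allI impI)
  show "S 0 = id" by (auto simp: S.E_0)
  show "S (s + t) = S s \<circ> S t" if "0 \<le> s" "0 \<le> t" for s t
    using S.E_add[OF that] by auto
  show "((\<lambda>t. S t x) \<longlongrightarrow> x) (at_right 0)" for x
  proof -
    have "((\<lambda>t. S t x) \<longlongrightarrow> S 0 x) (at 0 within {0..})"
      using S.E_cont[of x] by (simp add: continuous_on_def)
    then show ?thesis
      by (auto simp: S.E_0 intro: tendsto_within_subset)
  qed
qed (rule S_bounded_operator)

text \<open>
  Coordinate by coordinate, \<open>S t x - x\<close> is minus the integral of \<open>S s (A x)\<close> over \<open>[0, t]\<close>. The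
  integrand is continuous with value \<open>A x\<close> at \<open>s = 0\<close>.
\<close>

lemma S_generator_sub:
  assumes x: "x \<in> D"
  shows "((\<lambda>t. (S t x - x) /\<^sub>R t) \<longlongrightarrow> - A x) (at_right 0)"
proof -
  define g where "g t = integral {0..t} (\<lambda>s. S s (A x))" for t
  have cont: "continuous_on {0..t} (\<lambda>s. S s (A x))" for t
    by (rule continuous_on_subset[OF S.E_cont]) auto
  have Sg: "S t x - x = - g t" if t: "0 \<le> t" for t
  proof (rule eqI)
    fix k
    have "P k (g t) = integral {0..t} (\<lambda>s. P k (S s (A x)))"
      unfolding g_def
      using integral_linear[OF integrable_continuous_real[OF cont] P_bounded_linear[of k], of t]
      by (simp add: o_def)
    also have "\<dots> = integral {0..t} (\<lambda>s. (exp (- lam (Suc k) * s) * lam (Suc k)) *\<^sub>R P k x)"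
      by (intro integral_cong) (simp add: S.P_E P_A[OF x])
    also have "\<dots> = (- exp (- lam (Suc k) * t) - - exp (- lam (Suc k) * 0)) *\<^sub>R P k x"
    proof (rule integral_unique, rule fundamental_theorem_of_calculus[where f = "\<lambda>s. - exp (- lam (Suc k) * s) *\<^sub>R P k x", simplified scaleR_diff_left[symmetric]])
      show "((\<lambda>s. - exp (- lam (Suc k) * s) *\<^sub>R P k x) has_vector_derivative (exp (- lam (Suc k) * s) * lam (Suc k)) *\<^sub>R P k x) (at s within {0..t})" for s
        by (intro has_vector_derivative_scaleR[THEN has_vector_derivative_eq_rhs] derivative_eq_intros | simp)+
    qed (use t in auto)
    finally show "P k (S t x - x) = P k (- g t)"
      using t by (simp add: linear_diff[OF P_linear] linear_neg[OF P_linear] S.P_E algebra_simps)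
  qed
  have "(g has_vector_derivative S 0 (A x)) (at 0 within {0..1})"
    unfolding g_def by (rule integral_has_vector_derivative[OF cont]) auto
  then have "((\<lambda>t. (1 / norm (t - 0)) *\<^sub>R (g t - (g 0 + (t - 0) *\<^sub>R A x))) \<longlongrightarrow> 0) (at 0 within {0..1})"
    unfolding has_vector_derivative_def has_derivative_within by (simp add: S.E_0)
  then have "((\<lambda>t. (1 / norm t) *\<^sub>R (g t - t *\<^sub>R A x)) \<longlongrightarrow> 0) (at_right 0)"
    by (simp add: g_def at_within_Icc_at_right)
  then have "((\<lambda>t. - A x - (1 / norm t) *\<^sub>R (g t - t *\<^sub>R A x)) \<longlongrightarrow> - A x - 0) (at_right 0)"
    by (intro tendsto_diff tendsto_const)
  then have "((\<lambda>t. - A x - (1 / norm t) *\<^sub>R (g t - t *\<^sub>R A x)) \<longlongrightarrow> - A x) (at_right 0)" by simp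
  then show ?thesis
  proof (rule Lim_transform_eventually)
    show "\<forall>\<^sub>F t in at_right 0. - A x - (1 / norm t) *\<^sub>R (g t - t *\<^sub>R A x) = (S t x - x) /\<^sub>R t"
      using eventually_at_right_less[of 0]
      by eventually_elim (simp add: Sg scaleR_diff_right inverse_eq_divide)
  qed
qed

lemma ip_S:
  assumes "0 \<le> t"
  shows "ip (S t x) y = ip x (S t y)"
proof -
  have SP: "S t (P k x) = exp (- lam (Suc k) * t) *\<^sub>R P k x" for k x
    by (rule eqI) (simp add: S.P_E[OF assms] P_mult linear_scale[OF P_linear])
  have "(\<lambda>n. ip (S t (\<Sum>k<n. P k x)) y) \<longlonglongrightarrow> ip (S t x) y"
    by (intro bounded_linear.tendsto[OF ip_bounded_linear]
        bounded_linear.tendsto[OF S.E_bounded_linear[OF assms]] expansion)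
  moreover have "(\<lambda>n. ip x (S t (\<Sum>k<n. P k y))) \<longlonglongrightarrow> ip x (S t y)"
    by (intro bounded_linear.tendsto[OF ip_right_bounded_linear]
        bounded_linear.tendsto[OF S.E_bounded_linear[OF assms]] expansion)
  moreover have "ip (S t (\<Sum>k<n. P k x)) y = ip x (S t (\<Sum>k<n. P k y))" for n
    by (simp add: linear_sum[OF S.E_linear[OF assms]] SP linear_sum[OF ip_left] linear_sum[OF ip_right]
        linear_scale[OF ip_left] linear_scale[OF ip_right] ip_P_sym)
  ultimately show ?thesis by (simp add: LIMSEQ_unique)
qed

text \<open>
  Conversely, if the difference quotients at \<open>x\<close> tend to \<open>y\<close>, then symmetry of \<open>S t\<close> moves them to any
  \<open>w\<close> in the domain and gives \<open>\<langle>A w, x\<rangle> = \<langle>w, - y\<rangle>\<close>. So \<open>(x, - y)\<close> lies in the graph of the adjoint,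
  which is the graph of \<open>A\<close>.
\<close>

lemma S_generator: "generator_graph S = op_graph D (\<lambda>z. - A z)"
proof (intro equalityI subsetI)
  fix z assume "z \<in> op_graph D (\<lambda>z. - A z)"
  then show "z \<in> generator_graph S" using S_generator_sub by (auto simp: op_graph_def generator_graph_def)
next
  fix z assume "z \<in> generator_graph S"
  then obtain x y where z: "z = (x, y)" and lim: "((\<lambda>t. (S t x - x) /\<^sub>R t) \<longlongrightarrow> y) (at_right 0)"
    by (auto simp: generator_graph_def)
  have "ip (A w) x = ip w (- y)" if w: "w \<in> D" for w
  proof -
    have 1: "((\<lambda>t. ip ((S t w - w) /\<^sub>R t) x) \<longlongrightarrow> ip (- A w) x) (at_right 0)"
      by (intro bounded_linear.tendsto[OF ip_bounded_linear] S_generator_sub w)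
    have 2: "((\<lambda>t. ip w ((S t x - x) /\<^sub>R t)) \<longlongrightarrow> ip w y) (at_right 0)"
      by (intro bounded_linear.tendsto[OF ip_right_bounded_linear] lim)
    have "\<forall>\<^sub>F t in at_right 0. ip ((S t w - w) /\<^sub>R t) x = ip w ((S t x - x) /\<^sub>R t)"
      using eventually_at_right_less[of 0]
    proof eventually_elim
      case (elim t)
      then show ?case
        by (simp add: linear_scale[OF ip_left] linear_scale[OF ip_right] linear_diff[OF ip_left] linear_diff[OF ip_right] ip_S)
    qed
    from Lim_transform_eventually[OF 1 this] 2 have "ip (- A w) x = ip w y"
      by (intro tendsto_unique) auto
    then show ?thesis
      by (simp add: linear_neg[OF ip_left] linear_neg[OF ip_right]) (metis minus_minus)
  qed
  then have "(x, - y) \<in> adjoint_graph ip D A" by (simp add: adjoint_graph_def)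
  then have "x \<in> D" "A x = - y"
    using A_sa by (auto simp: self_adjoint_def op_graph_def)
  then show "z \<in> op_graph D (\<lambda>z. - A z)"
    by (auto simp: op_graph_def z)
qed

text \<open>
  The next lemmas identify an arbitrary semigroup \<open>U\<close> with the generator \<open>-A\<close>.
\<close>

context
  fixes U :: "real \<Rightarrow> 'a \<Rightarrow> 'a"
  assumes U: "c0_semigroup scl U" and gen: "generator_graph U = op_graph D (\<lambda>z. - A z)"
begin

lemma U_operator: "0 \<le> t \<Longrightarrow> bounded_operator scl (U t)"
  and U_0: "U 0 x = x" and U_add: "0 \<le> s \<Longrightarrow> 0 \<le> t \<Longrightarrow> U (s + t) x = U s (U t x)"
  using U by (auto simp: c0_semigroup_def)

lemma U_bounded_linear: "0 \<le> t \<Longrightarrow> bounded_linear (U t)"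
  and U_scl: "0 \<le> t \<Longrightarrow> U t (scl c x) = scl c (U t x)"
  using U_operator unfolding bounded_operator_def Vector_Spaces.linear_iff by auto

lemma U_generator: "((\<lambda>h. (U h x - x) /\<^sub>R h) \<longlongrightarrow> - y) (at_right 0) \<longleftrightarrow> x \<in> D \<and> A x = y"
proof -
  have "((\<lambda>h. (U h x - x) /\<^sub>R h) \<longlongrightarrow> - y) (at_right 0) \<longleftrightarrow> (x, - y) \<in> generator_graph U"
    by (simp add: generator_graph_def)
  then show ?thesis unfolding gen by (auto simp: op_graph_def)
qed

lemma U_commutes_A:
  assumes x: "x \<in> D" and t: "0 \<le> t"
  shows "U t x \<in> D" and "A (U t x) = U t (A x)"
proof -
  have lin: "linear (U t)" by (rule bounded_linear.linear[OF U_bounded_linear[OF t]])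
  have "((\<lambda>h. U t ((U h x - x) /\<^sub>R h)) \<longlongrightarrow> U t (- A x)) (at_right 0)"
    using U_generator[of x "A x"] x by (intro bounded_linear.tendsto[OF U_bounded_linear[OF t]]) auto
  moreover have "\<forall>\<^sub>F h in at_right 0. U t ((U h x - x) /\<^sub>R h) = (U h (U t x) - U t x) /\<^sub>R h"
    using eventually_at_right_less[of 0]
  proof eventually_elim
    case (elim h)
    have "U t (U h x) = U h (U t x)"
      using U_add[of t h x] U_add[of h t x] t elim by (simp add: add.commute)
    then show ?case by (simp add: linear_scale[OF lin] linear_diff[OF lin])
  qed
  ultimately have "((\<lambda>h. (U h (U t x) - U t x) /\<^sub>R h) \<longlongrightarrow> U t (- A x)) (at_right 0)"
    by (rule Lim_transform_eventually)
  then have "((\<lambda>h. (U h (U t x) - U t x) /\<^sub>R h) \<longlongrightarrow> - U t (A x)) (at_right 0)"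
    by (simp only: linear_neg[OF lin])
  then show "U t x \<in> D" "A (U t x) = U t (A x)" using U_generator[of "U t x" "U t (A x)"] by auto
qed

text \<open>
  \<open>U t\<close> commutes with \<open>A\<close>, so it maps an eigenvector to an eigenvector for the same eigenvalue, and the
  eigenvalues are simple.
\<close>

lemma U_eigenvector:
  assumes t: "0 \<le> t"
  shows "U t (\<phi> (Suc k)) = scl (ip (U t (\<phi> (Suc k))) (\<phi> (Suc k))) (\<phi> (Suc k))"
proof -
  let ?v = "U t (\<phi> (Suc k))"
  have lin: "linear (U t)" by (rule bounded_linear.linear[OF U_bounded_linear[OF t]])
  have "A ?v = lam (Suc k) *\<^sub>R ?v"
    using U_commutes_A(2)[OF \<phi>_D t, of k] by (simp add: A_\<phi> linear_scale[OF lin])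
  then have "P j (A ?v) = lam (Suc k) *\<^sub>R P j ?v" for j
    by (simp only: linear_scale[OF P_linear])
  then have "lam (Suc j) *\<^sub>R P j ?v = lam (Suc k) *\<^sub>R P j ?v" for j
    using P_A[OF U_commutes_A(1)[OF \<phi>_D t, of k], of j] by auto
  then have "P j ?v = 0" if "j \<noteq> k" for j
    using lam_inj[of "Suc j" "Suc k"] that by auto
  then have "P j ?v = P j (P k ?v)" for j by (cases "j = k") (auto simp: P_mult)
  then have "?v = P k ?v" by (rule eqI)
  then show ?thesis by (simp add: P_def)
qed

text \<open>
  With \<open>f\<close> the eigenvector, the preceding lemma gives \<open>U t f = c t f\<close> for a scalar function \<open>c\<close> that is multiplicative and has the
  right derivative \<open>- l\<close> at \<open>0\<close>. Like \<open>b t = exp (- l t)\<close> it satisfies \<open>c t = c (t / n) ^ n\<close>, and the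
  \<open>n\<close>-th powers differ by at most \<open>n\<close> times \<open>\<bar>c (t / n) - b (t / n)\<bar> = o(1 / n)\<close>.
\<close>

lemma U_\<phi>:
  assumes t: "0 \<le> t"
  shows "U t (\<phi> (Suc k)) = exp (- lam (Suc k) * t) *\<^sub>R \<phi> (Suc k)"
proof (cases "t = 0")
  case True
  then show ?thesis by (simp add: U_0)
next
  case False
  then have tpos: "0 < t" using t by simp
  define l where "l = lam (Suc k)"
  define f where "f = \<phi> (Suc k)"
  define c where "c s = ip (U s f) f" for s
  define b :: "real \<Rightarrow> 'k" where "b s = of_real (exp (- l * s))" for s
  have l: "0 \<le> l" by (simp add: l_def lam_nonneg)
  have ff: "ip f f = 1" by (simp add: f_def ip_\<phi>)
  have Uf: "U s f = scl (c s) f" if "0 \<le> s" for s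
    unfolding c_def f_def by (rule U_eigenvector[OF that])
  have c_add: "c (r + s) = c r * c s" if "0 \<le> r" "0 \<le> s" for r s
  proof -
    have "U (r + s) f = U r (scl (c s) f)" by (simp only: U_add[OF that] Uf[OF that(2)])
    also have "\<dots> = scl (c s) (scl (c r) f)" by (simp only: U_scl[OF that(1)] Uf[OF that(1)])
    finally show ?thesis by (simp add: c_def[of "r + s"] ip_scale_left ff mult.commute)
  qed
  have c_mult: "c (real n * s) = c s ^ n" if "0 \<le> s" for n s
  proof (induction n)
    case 0
    then show ?case by (simp add: c_def U_0 ff)
  next
    case (Suc n)
    then show ?case using c_add[of s "real n * s"] that by (simp add: algebra_simps)
  qed
  have b_mult: "b (real n * s) = b s ^ n" for n s
  proof -
    have "- l * (real n * s) = real n * (- l * s)" by simp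
    then show ?thesis unfolding b_def by (simp only: exp_of_nat_mult of_real_power)
  qed
  have c_lim: "((\<lambda>h. (c h - 1) /\<^sub>R h) \<longlongrightarrow> of_real (- l)) (at_right 0)"
  proof -
    have "((\<lambda>h. ip ((U h f - f) /\<^sub>R h) f) \<longlongrightarrow> ip (- (l *\<^sub>R f)) f) (at_right 0)"
      using U_generator[of f "l *\<^sub>R f"] \<phi>_D A_\<phi>
      by (intro bounded_linear.tendsto[OF ip_bounded_linear]) (simp add: f_def l_def)
    then show ?thesis
      by (simp add: linear_scale[OF ip_left] linear_diff[OF ip_left] linear_neg[OF ip_left] c_def ff of_real_def)
  qed
  have b_lim: "((\<lambda>h. (b h - 1) /\<^sub>R h) \<longlongrightarrow> of_real (- l)) (at_right 0)"
  proof -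
    have "((\<lambda>h. exp (- l * h)) has_real_derivative - l) (at 0)"
      by (auto intro!: derivative_eq_intros)
    then have "((\<lambda>h. (exp (- l * h) - 1) / h) \<longlongrightarrow> - l) (at 0)"
      by (simp add: has_field_derivative_iff)
    then have "((\<lambda>h. (exp (- l * h) - 1) / h) \<longlongrightarrow> - l) (at_right 0)"
      by (rule tendsto_within_subset) auto
    then have "((\<lambda>h. of_real ((exp (- l * h) - 1) / h) :: 'k) \<longlongrightarrow> of_real (- l)) (at_right 0)"
      by (rule tendsto_of_real)
    then show ?thesis by (simp add: b_def scaleR_conv_of_real divide_inverse mult.commute)
  qed
  define e where "e h = (c h - b h) /\<^sub>R h" for h
  have e_lim: "(e \<longlongrightarrow> 0) (at_right 0)"
    using tendsto_diff[OF c_lim b_lim] by (simp add: e_def[abs_def] scaleR_diff_right[symmetric])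
  have h_lim: "filterlim (\<lambda>n. t / real n) (at_right 0) sequentially"
    unfolding filterlim_at
  proof
    show "\<forall>\<^sub>F n in sequentially. t / real n \<in> {0<..} \<and> t / real n \<noteq> 0"
      using eventually_gt_at_top[of 0] by eventually_elim (use tpos in auto)
  qed (rule lim_const_over_n)
  have est: "norm (c t - b t) * exp (- t) \<le> t * norm (e (t / real n))"
    if n: "0 < n" and small: "norm (e (t / real n)) \<le> 1" for n
  proof -
    define h where "h = t / real n"
    have h: "0 < h" "real n * h = t" using n tpos by (auto simp: h_def)
    \<comment> \<open>The factor \<open>exp (- h)\<close> brings both numbers into the unit disc, where the \<open>n\<close>-th power has Lipschitz constant \<open>n\<close>.\<close>
    let ?a = "c h * of_real (exp (- h))" and ?a' = "b h * of_real (exp (- h))"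
    have ce: "c h - b h = h *\<^sub>R e h" using h by (simp add: e_def)
    have bn: "norm (b h) \<le> 1" using l h by (simp add: b_def)
    have "norm (c h) \<le> norm (b h) + norm (h *\<^sub>R e h)"
      unfolding ce[symmetric] by (rule norm_triangle_sub)
    also have "\<dots> \<le> 1 + h"
    proof -
      have "h * norm (e h) \<le> h * 1" using small h(1) unfolding h_def[symmetric] by (intro mult_left_mono) auto
      moreover have "norm (h *\<^sub>R e h) = h * norm (e h)" using h(1) by simp
      ultimately show ?thesis using bn by linarith
    qed
    also have "\<dots> \<le> exp h" by (rule exp_ge_add_one_self)
    finally have ch: "norm (c h) \<le> exp h" .
    have "norm ?a = norm (c h) * exp (- h)" by (simp add: norm_mult)
    also have "\<dots> \<le> exp h * exp (- h)" using ch by (rule mult_right_mono) simp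
    also have "\<dots> = 1" by (simp flip: exp_add)
    finally have a1: "norm ?a \<le> 1" .
    have "norm ?a' = norm (b h) * exp (- h)" by (simp add: norm_mult)
    also have "\<dots> \<le> 1 * 1" using bn h by (intro mult_mono) auto
    finally have a2: "norm ?a' \<le> 1" by simp
    have pw: "of_real (exp (- h)) ^ n = (of_real (exp (- t)) :: 'k)"
    proof -
      have "exp (- h) ^ n = exp (real n * - h)" by (simp only: exp_of_nat_mult)
      also have "real n * - h = - t" using h(2) by simp
      finally show ?thesis by (simp only: of_real_power[symmetric])
    qed
    have "norm (c t - b t) * exp (- t) = norm ((c t - b t) * of_real (exp (- t)))"
      by (simp add: norm_mult)
    also have "(c t - b t) * of_real (exp (- t)) = ?a ^ n - ?a' ^ n"
    proof -
      have "c t = c h ^ n" "b t = b h ^ n" using c_mult[of h n] b_mult[of n h] h by auto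
      then show ?thesis by (simp only: power_mult_distrib pw left_diff_distrib)
    qed
    also have "norm \<dots> \<le> real n * norm (?a - ?a')" by (rule norm_power_diff[OF a1 a2])
    also have "?a - ?a' = h *\<^sub>R e h * of_real (exp (- h))" by (simp only: ce[symmetric] left_diff_distrib)
    also have "real n * norm \<dots> = t * norm (e h) * exp (- h)"
      using h by (simp add: norm_mult flip: mult.assoc)
    also have "\<dots> \<le> t * norm (e h) * 1" using h tpos by (intro mult_left_mono) auto
    finally show ?thesis by (simp add: h_def)
  qed
  have lim0: "(\<lambda>n. e (t / real n)) \<longlonglongrightarrow> 0" by (rule filterlim_compose[OF e_lim h_lim])
  have "\<forall>\<^sub>F n in sequentially. norm (e (t / real n)) < 1"
    using tendstoD[OF lim0, of 1] by (simp add: dist_norm)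
  then have "\<forall>\<^sub>F n in sequentially. norm (c t - b t) * exp (- t) \<le> t * norm (e (t / real n))"
    using eventually_gt_at_top[of 0] by eventually_elim (intro est, auto)
  moreover have "(\<lambda>n. t * norm (e (t / real n))) \<longlonglongrightarrow> t * 0"
    by (intro tendsto_mult tendsto_const tendsto_norm_zero lim0)
  ultimately have "norm (c t - b t) * exp (- t) \<le> t * 0"
    by (intro tendsto_lowerbound[of "\<lambda>n. t * norm (e (t / real n))" _ sequentially]) auto
  then have "c t = b t" by (simp add: mult_le_0_iff)
  then show ?thesis using Uf[OF t] by (simp add: b_def f_def l_def scale_of_real)
qed

lemma semigroup_unique: "0 \<le> t \<Longrightarrow> U t x = S t x"
proof (rule linear_scl_dense_eqI[OF U_operator S_bounded_operator \<phi>_dense])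
  fix y assume t: "0 \<le> t" and "y \<in> \<phi> ` {1..}"
  then obtain k where "y = \<phi> (Suc k)" by (auto simp: Suc_le_eq gr0_conv_Suc)
  then show "U t y = S t y" using t by (simp add: U_\<phi> S_\<phi>)
qed auto

end

text \<open>
  The definite description of \<open>exp_neg\<close> is met by \<open>S\<close> and only by \<open>S\<close>: a second semigroup with the same
  generator acts in the same way on the eigenvectors, whose span is dense.
\<close>

theorem exp_neg_eq:
  assumes t: "0 \<le> t"
  shows "exp_neg scl D A t x = S t x"
  unfolding exp_neg_def
proof (rule the_equality)
  show "\<exists>U. c0_semigroup scl U \<and> generator_graph U = op_graph D (\<lambda>z. - A z) \<and> S t x = U t x"
    by (rule exI[of _ S]) (simp only: S_semigroup S_generator simp_thms)
next
  fix y assume "\<exists>U. c0_semigroup scl U \<and> generator_graph U = op_graph D (\<lambda>z. - A z) \<and> y = U t x"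
  then show "y = S t x"
  proof (elim exE conjE)
    fix U assume U: "c0_semigroup scl U" "generator_graph U = op_graph D (\<lambda>z. - A z)" and y: "y = U t x"
    show "y = S t x" unfolding y by (rule semigroup_unique[OF U t])
  qed
qed

end

section \<open>Control of the eigensolution\<close>

text \<open>
  Both integrals commute with the functionals \<open>\<lambda>x. x \<bullet> y\<close>, which reduces the claim to real-valued functions.
\<close>

lemma set_lebesgue_integral_eq_integral_continuous:
  fixes g :: "real \<Rightarrow> 'a::{real_inner, banach, second_countable_topology}"
  assumes g: "continuous_on {a..b} g"
  shows "set_integrable lborel {a..b} g"
    and "set_lebesgue_integral lborel {a..b} g = integral {a..b} g"
proof -
  show int: "set_integrable lborel {a..b} g"
    unfolding set_integrable_def by (rule borel_integrable_compact[OF compact_Icc g])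
  have "set_lebesgue_integral lborel {a..b} g \<bullet> y = integral {a..b} g \<bullet> y" for y
  proof -
    have gy: "continuous_on {a..b} (\<lambda>s. g s \<bullet> y)" by (intro continuous_intros g)
    have "set_lebesgue_integral lborel {a..b} g \<bullet> y = set_lebesgue_integral lborel {a..b} (\<lambda>s. g s \<bullet> y)"
      using integral_inner_left[of y lborel "\<lambda>s. indicator {a..b} s *\<^sub>R g s"] int
      unfolding set_lebesgue_integral_def set_integrable_def by simp
    also have "\<dots> = integral {a..b} (\<lambda>s. g s \<bullet> y)"
      unfolding set_borel_integral_eq_integral(2)[OF borel_integrable_atLeastAtMost'[OF gy]] ..
    also have "\<dots> = integral {a..b} g \<bullet> y"
      using integral_linear[OF integrable_continuous_real[OF g] bounded_linear_inner_left[of y]] by (simp add: o_def)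
    finally show ?thesis .
  qed
  then show "set_lebesgue_integral lborel {a..b} g = integral {a..b} g"
    using vector_eq_rdot by blast
qed

text \<open>
  The map \<open>emb\<close> transports complex-valued controls to the scalar field; it is a left inverse of \<open>to_complex\<close>.
\<close>

locale controlled_eigen_setting = eigen_setting scl ip D A lam \<phi>
  for scl :: "'k::real_or_complex \<Rightarrow> 'a::{real_inner, banach, second_countable_topology} \<Rightarrow> 'a"
    and ip :: "'a \<Rightarrow> 'a \<Rightarrow> 'k" and D A lam \<phi> +
  fixes B :: "'a \<Rightarrow> 'a" and emb :: "complex \<Rightarrow> 'k" and \<alpha> b q :: real
  assumes \<alpha>: "0 < \<alpha>" and gap: "1 \<le> k \<Longrightarrow> \<alpha> \<le> sqrt (lam (k + 1)) - sqrt (lam k)"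
    and B_bdd: "bounded_operator scl B"
    and B_1: "ip (B (\<phi> 1)) (\<phi> 1) \<noteq> 0"
    and b: "0 < b" and q: "0 < q" and B_k: "1 < k \<Longrightarrow> b \<le> lam k powr q * norm (ip (B (\<phi> 1)) (\<phi> k))"
    and emb: "bounded_linear emb" "emb (to_complex c) = c"
begin

abbreviation "\<psi> \<equiv> \<phi> (Suc 0)"
abbreviation "lam1 \<equiv> lam (Suc 0)"

text \<open>
  The exponents of the normalised semigroup \<open>exp (lam1 t) S t\<close>, which fixes \<open>\<psi>\<close>.
\<close>

definition \<mu> :: "nat \<Rightarrow> real" where "\<mu> k = lam (Suc k) - lam1"

lemma sqrt_gap:
  assumes "i \<le> k"
  shows "\<alpha> * real (k - i) \<le> sqrt (lam (Suc k)) - sqrt (lam (Suc i))"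
  using assms
proof (induction k rule: dec_induct)
  case (step n)
  then show ?case using gap[of "Suc n"] by (simp add: Suc_diff_le algebra_simps)
qed simp

text \<open>
  With \<open>r \<le> s\<close> the square roots of the two eigenvalues, \<open>s\<^sup>2 - r\<^sup>2 = (s - r) (s + r) \<ge> (s - r)\<^sup>2\<close>.
\<close>

lemma \<mu>_gap:
  assumes "i \<le> k"
  shows "\<alpha>\<^sup>2 * (real (k - i))\<^sup>2 \<le> \<mu> k - \<mu> i"
proof -
  let ?r = "sqrt (lam (Suc i))" and ?s = "sqrt (lam (Suc k))"
  have r: "0 \<le> ?r" by (simp add: lam_nonneg)
  have d: "0 \<le> \<alpha> * real (k - i)" using \<alpha> by simp
  have "(\<alpha> * real (k - i))\<^sup>2 \<le> (?s - ?r)\<^sup>2"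
    using sqrt_gap[OF assms] d by (intro power_mono) auto
  also have "\<dots> \<le> (?s - ?r) * (?s + ?r)"
    unfolding power2_eq_square using sqrt_gap[OF assms] d r by (intro mult_left_mono) linarith+
  also have "\<dots> = ?s\<^sup>2 - ?r\<^sup>2" by (simp add: power2_eq_square algebra_simps)
  also have "\<dots> = \<mu> k - \<mu> i" by (simp add: \<mu>_def lam_nonneg)
  finally show ?thesis by (simp add: power_mult_distrib)
qed

lemma \<mu>_mono: "i \<le> k \<Longrightarrow> \<mu> i \<le> \<mu> k"
  using \<mu>_gap[of i k] by (meson diff_ge_0_iff_ge order.trans zero_le_mult_iff zero_le_power2)

lemma \<mu>_0: "\<mu> 0 = 0" by (simp add: \<mu>_def)

lemma \<mu>_pos: "0 \<le> \<mu> k" using \<mu>_mono[of 0 k] by (simp add: \<mu>_0)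

sublocale N: spectral_semigroup P \<mu>
  by unfold_locales (rule \<mu>_pos)

abbreviation N :: "real \<Rightarrow> 'a \<Rightarrow> 'a" where "N \<equiv> N.E"

lemma S_eq_N: "0 \<le> t \<Longrightarrow> S t x = exp (- lam1 * t) *\<^sub>R N t x"
proof (rule eqI)
  fix k assume t: "0 \<le> t"
  have "- lam (Suc k) * t = - lam1 * t + - \<mu> k * t" by (simp add: \<mu>_def algebra_simps)
  then have "exp (- lam (Suc k) * t) = exp (- lam1 * t) * exp (- \<mu> k * t)" by (simp only: exp_add)
  then show "P k (S t x) = P k (exp (- lam1 * t) *\<^sub>R N t x)"
    using t by (simp only: S.P_E N.P_E linear_scale[OF P_linear] scaleR_scaleR)
qed

lemma N_\<psi>: "0 \<le> t \<Longrightarrow> N t \<psi> = \<psi>"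
  by (rule eqI) (simp add: N.P_E P_\<phi> \<mu>_0)

definition F :: "complex \<Rightarrow> 'a \<Rightarrow> 'a" where "F z x = scl (emb z) (B x)"

lemma F_bilinear: "bounded_bilinear F"
  unfolding F_def using B_bdd emb(1)
  by (intro bounded_bilinear.comp[OF scl_bilinear]) (auto simp: bounded_operator_def)

lemma B_scl: "B (scl c x) = scl c (B x)"
  using B_bdd by (simp add: bounded_operator_def Vector_Spaces.linear_iff)

sublocale CN: bilinear_control N F
  by (rule bilinear_control.intro[OF N.contraction_semigroup_axioms F_bilinear])

sublocale CS: bilinear_control S F
  by (rule bilinear_control.intro[OF S.contraction_semigroup_axioms F_bilinear])

definition \<beta> :: "nat \<Rightarrow> 'k" where "\<beta> k = ip (B \<psi>) (\<phi> (Suc k))"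

text \<open>
  The constant in the bound of \<open>1 / \<bar>\<beta> k\<bar>\<close> by \<open>(1 + \<mu> k) powr q\<close>. Its first summand serves \<open>k = 0\<close>, where
  only \<open>\<beta> 0 \<noteq> 0\<close> is known, and its second one the indices \<open>k > 0\<close>.
\<close>

definition inv_bound :: real where "inv_bound = 1 / norm (\<beta> 0) + (1 + lam1) powr q / b"

lemma \<beta>_lower:
  shows "\<beta> k \<noteq> 0" and "1 / norm (\<beta> k) \<le> inv_bound * (1 + \<mu> k) powr q"
proof -
  have pw1: "1 \<le> (1 + \<mu> k) powr q"
    using \<mu>_pos[of k] q by (intro ge_one_powr_ge_zero) auto
  have b0: "\<beta> 0 \<noteq> 0" using B_1 by (simp add: \<beta>_def)
  have sum_nonneg: "0 \<le> 1 / norm (\<beta> 0)" "0 \<le> (1 + lam1) powr q / b" using b by auto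
  have "\<beta> k \<noteq> 0 \<and> 1 / norm (\<beta> k) \<le> inv_bound * (1 + \<mu> k) powr q"
  proof (cases k)
    case 0
    have "1 / norm (\<beta> 0) * 1 \<le> inv_bound * (1 + \<mu> 0) powr q"
      using pw1 0 sum_nonneg by (intro mult_mono) (auto simp: inv_bound_def)
    then show ?thesis using 0 b0 by simp
  next
    case (Suc j)
    have bk: "b \<le> lam (Suc k) powr q * norm (\<beta> k)"
      using B_k[of "Suc k"] Suc by (simp add: \<beta>_def)
    then have ne: "\<beta> k \<noteq> 0" using b by auto
    have "1 / norm (\<beta> k) \<le> lam (Suc k) powr q / b"
      using bk b ne by (simp add: field_simps)
    also have "\<dots> \<le> ((1 + lam1) * (1 + \<mu> k)) powr q / b"
    proof -
      have "(1 + lam1) * (1 + \<mu> k) = lam (Suc k) + 1 + lam1 * \<mu> k" by (simp add: \<mu>_def algebra_simps)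
      moreover have "0 \<le> lam1 * \<mu> k" using \<mu>_pos lam_nonneg[of "Suc 0"] by simp
      ultimately have "lam (Suc k) \<le> (1 + lam1) * (1 + \<mu> k)" by linarith
      then show ?thesis using b q lam_nonneg[of "Suc k"] by (intro divide_right_mono powr_mono2) auto
    qed
    also have "\<dots> = (1 + lam1) powr q / b * (1 + \<mu> k) powr q"
      using \<mu>_pos[of k] lam_nonneg[of "Suc 0"] by (simp add: powr_mult)
    also have "\<dots> \<le> inv_bound * (1 + \<mu> k) powr q"
      using sum_nonneg pw1 by (intro mult_right_mono) (auto simp: inv_bound_def)
    finally show ?thesis using ne by simp
  qed
  then show "\<beta> k \<noteq> 0" "1 / norm (\<beta> k) \<le> inv_bound * (1 + \<mu> k) powr q" by auto
qed

lemma P_B\<psi>: "P k (B \<psi>) = scl (\<beta> k) (\<phi> (Suc k))"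
  by (simp add: P_def \<beta>_def)

text \<open>
  Applying \<open>P k\<close> to the equation turns null controllability into the moment problem with the data
  \<open>\<langle>w, \<phi>\<^bsub>k+1\<^esub>\<rangle> / \<beta> k\<close>. Its real and imaginary parts are solved separately.
\<close>

lemma null_controllability_cost:
  obtains C where "0 < C" "CN.null_controllable \<psi> C"
proof -
  have a2: "0 < \<alpha>\<^sup>2" using \<alpha> by simp
  obtain C where C: "0 < C" and mom: "\<And>\<tau> v M. 0 < \<tau> \<Longrightarrow> \<tau> \<le> 1 \<Longrightarrow> (\<And>k. \<bar>v k\<bar> \<le> M * (1 + \<mu> k) powr q) \<Longrightarrow>
    \<exists>p. continuous_on UNIV p \<and> (\<forall>x. x \<le> 0 \<or> \<tau> \<le> x \<longrightarrow> p x = 0) \<and> (\<forall>x. \<bar>p x\<bar> \<le> M * exp (C / \<tau> ^ 4)) \<and>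
      (\<forall>k. integral {0..\<tau>} (\<lambda>s. exp (- \<mu> k * (\<tau> - s)) * p s) = exp (- \<mu> k * \<tau>) * v k)"
    by (rule moment_problem[OF a2 \<mu>_pos \<mu>_mono \<mu>_gap q]) (assumption, assumption, rule that, blast+)
  have K0: "0 \<le> inv_bound" using b by (simp add: inv_bound_def)
  define C' where "C' = C + 2 * inv_bound"
  have "0 < C'" using C K0 by (simp add: C'_def)
  moreover have "\<exists>p. continuous_on UNIV p \<and> (\<forall>x. x \<le> 0 \<or> \<tau> \<le> x \<longrightarrow> p x = 0) \<and>
        (\<forall>x. norm (p x) \<le> exp (C' / \<tau> ^ 4) * norm w) \<and> N \<tau> w = N.duhamel (\<lambda>s. F (p s) \<psi>) \<tau>"
    if \<tau>: "0 < \<tau>" "\<tau> \<le> 1" for \<tau> w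
  proof -
    define v where "v k = to_complex (ip w (\<phi> (Suc k)) / \<beta> k)" for k
    define M where "M = inv_bound * norm w"
    have vM: "norm (v k) \<le> M * (1 + \<mu> k) powr q" for k
    proof -
      have "norm (v k) = norm (ip w (\<phi> (Suc k))) * (1 / norm (\<beta> k))"
        by (simp add: v_def norm_to_complex norm_divide)
      also have "\<dots> \<le> norm w * (inv_bound * (1 + \<mu> k) powr q)"
        using norm_ip_le[of w "\<phi> (Suc k)"] \<beta>_lower(2)[of k] by (intro mult_mono) (auto simp: norm_\<phi>)
      finally show ?thesis by (simp add: M_def mult_ac)
    qed
    have vRe: "\<bar>Re (v k)\<bar> \<le> M * (1 + \<mu> k) powr q" for k
      using vM[of k] abs_Re_le_cmod[of "v k"] by linarith
    have vIm: "\<bar>Im (v k)\<bar> \<le> M * (1 + \<mu> k) powr q" for k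
      using vM[of k] abs_Im_le_cmod[of "v k"] by linarith
    obtain p1 where p1: "continuous_on UNIV p1" "\<forall>x. x \<le> 0 \<or> \<tau> \<le> x \<longrightarrow> p1 x = 0"
      "\<forall>x. \<bar>p1 x\<bar> \<le> M * exp (C / \<tau> ^ 4)"
      "\<forall>k. integral {0..\<tau>} (\<lambda>s. exp (- \<mu> k * (\<tau> - s)) * p1 s) = exp (- \<mu> k * \<tau>) * Re (v k)"
      using mom[OF \<tau> vRe] by blast
    obtain p2 where p2: "continuous_on UNIV p2" "\<forall>x. x \<le> 0 \<or> \<tau> \<le> x \<longrightarrow> p2 x = 0"
      "\<forall>x. \<bar>p2 x\<bar> \<le> M * exp (C / \<tau> ^ 4)"
      "\<forall>k. integral {0..\<tau>} (\<lambda>s. exp (- \<mu> k * (\<tau> - s)) * p2 s) = exp (- \<mu> k * \<tau>) * Im (v k)"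
      using mom[OF \<tau> vIm] by blast
    define p where "p s = of_real (p1 s) + \<i> * of_real (p2 s)" for s
    have pc: "continuous_on UNIV p" unfolding p_def by (intro continuous_intros p1(1) p2(1))
    have p0: "\<forall>x. x \<le> 0 \<or> \<tau> \<le> x \<longrightarrow> p x = 0" using p1(2) p2(2) by (simp add: p_def)
    have pb: "norm (p x) \<le> exp (C' / \<tau> ^ 4) * norm w" for x
    proof -
      have "norm (p x) \<le> \<bar>p1 x\<bar> + \<bar>p2 x\<bar>"
        unfolding p_def by (rule order.trans[OF norm_triangle_ineq]) (simp add: norm_mult)
      also have "\<dots> \<le> 2 * inv_bound * (exp (C / \<tau> ^ 4) * norm w)"
        using p1(3)[rule_format, of x] p2(3)[rule_format, of x] by (simp add: M_def mult_ac)
      also have "\<dots> \<le> exp (2 * inv_bound / \<tau> ^ 4) * (exp (C / \<tau> ^ 4) * norm w)"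
      proof (intro mult_right_mono)
        have "2 * inv_bound * 1 \<le> 2 * inv_bound * (1 / \<tau> ^ 4)"
          using K0 \<tau> by (intro mult_left_mono) (auto simp: power_le_one)
        also have "\<dots> \<le> exp (2 * inv_bound * (1 / \<tau> ^ 4))"
          by (rule order.trans[OF _ exp_ge_add_one_self]) simp
        finally show "2 * inv_bound \<le> exp (2 * inv_bound / \<tau> ^ 4)" by simp
      qed auto
      also have "\<dots> = exp (C' / \<tau> ^ 4) * norm w"
        by (simp add: C'_def add_divide_distrib exp_add)
      finally show ?thesis .
    qed
    have pm: "((\<lambda>s. exp (- \<mu> k * (\<tau> - s)) *\<^sub>R p s) has_integral exp (- \<mu> k * \<tau>) *\<^sub>R v k) {0..\<tau>}" for k
    proof -
      have i1: "((\<lambda>s. exp (- \<mu> k * (\<tau> - s)) * p1 s) has_integral exp (- \<mu> k * \<tau>) * Re (v k)) {0..\<tau>}"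
        unfolding p1(4)[rule_format, symmetric]
        by (intro integrable_integral integrable_continuous_real continuous_intros continuous_on_subset[OF p1(1)]) auto
      have i2: "((\<lambda>s. exp (- \<mu> k * (\<tau> - s)) * p2 s) has_integral exp (- \<mu> k * \<tau>) * Im (v k)) {0..\<tau>}"
        unfolding p2(4)[rule_format, symmetric]
        by (intro integrable_integral integrable_continuous_real continuous_intros continuous_on_subset[OF p2(1)]) auto
      have "((\<lambda>s. of_real (exp (- \<mu> k * (\<tau> - s)) * p1 s) + \<i> * of_real (exp (- \<mu> k * (\<tau> - s)) * p2 s)) has_integral
          of_real (exp (- \<mu> k * \<tau>) * Re (v k)) + \<i> * of_real (exp (- \<mu> k * \<tau>) * Im (v k))) {0..\<tau>}"
        by (intro has_integral_add has_integral_mult_right has_integral_of_real i1 i2)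
      moreover have "of_real (exp (- \<mu> k * \<tau>) * Re (v k)) + \<i> * of_real (exp (- \<mu> k * \<tau>) * Im (v k)) = exp (- \<mu> k * \<tau>) *\<^sub>R v k"
        by (simp add: complex_eq_iff)
      moreover have "of_real (exp (- \<mu> k * (\<tau> - s)) * p1 s) + \<i> * of_real (exp (- \<mu> k * (\<tau> - s)) * p2 s) = exp (- \<mu> k * (\<tau> - s)) *\<^sub>R p s" for s
        by (simp add: p_def complex_eq_iff)
      ultimately show ?thesis by simp
    qed
    have "N \<tau> w = N.duhamel (\<lambda>s. F (p s) \<psi>) \<tau>"
    proof (rule eqI)
      fix k
      define L where "L z = scl (emb z) (P k (B \<psi>))" for z
      have L: "bounded_linear L"
        unfolding L_def
        by (intro bounded_linear_compose[OF bounded_bilinear.bounded_linear_left[OF scl_bilinear] emb(1)])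
      have fc: "continuous_on {0..\<tau>} (\<lambda>s. F (p s) \<psi>)"
        by (intro CN.F.continuous_on continuous_intros continuous_on_subset[OF pc]) auto
      have "P k (N.duhamel (\<lambda>s. F (p s) \<psi>) \<tau>) = integral {0..\<tau>} (\<lambda>s. P k (N (\<tau> - s) (F (p s) \<psi>)))"
        unfolding N.duhamel_def
        using integral_linear[OF N.duhamel_integrable[OF fc] P_bounded_linear[of k]] by (simp add: o_def)
      also have "\<dots> = integral {0..\<tau>} (\<lambda>s. L (exp (- \<mu> k * (\<tau> - s)) *\<^sub>R p s))"
        by (intro integral_cong)
          (simp only: N.P_E L_def F_def P_scl linear_scale[OF bounded_linear.linear[OF L[unfolded L_def]]] atLeastAtMost_iff diff_ge_0_iff_ge)
      also have "\<dots> = L (exp (- \<mu> k * \<tau>) *\<^sub>R v k)"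
        using has_integral_linear[OF pm[of k] L] by (simp add: o_def integral_unique)
      also have "\<dots> = exp (- \<mu> k * \<tau>) *\<^sub>R L (v k)"
        by (rule linear_scale[OF bounded_linear.linear[OF L]])
      also have "L (v k) = P k w"
        using \<beta>_lower(1)[of k] by (simp add: L_def v_def emb(2) P_B\<psi> P_def[of k w])
      finally show "P k (N \<tau> w) = P k (N.duhamel (\<lambda>s. F (p s) \<psi>) \<tau>)"
        using \<tau> by (simp add: N.P_E)
    qed
    then show ?thesis using pc p0 pb by blast
  qed
  ultimately show ?thesis using that[of C'] by (simp add: CN.null_controllable_def)
qed

text \<open>
  Without control the component of the state orthogonal to \<open>\<psi>\<close> decays like \<open>exp (- \<mu> 1 t)\<close>, and \<open>\<mu> 1\<close> is
  positive by the gap condition. After a waiting time that depends on \<open>R\<close> only, local controllability applies.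
\<close>

lemma steering_to_eigenvector:
  assumes R: "0 < R"
  obtains T where "0 < T"
    "\<forall>w. P 0 w = 0 \<longrightarrow> norm w \<le> R \<longrightarrow> (\<exists>p. continuous_on UNIV p \<and> CN.flow p (\<psi> + w) T = \<psi>)"
proof -
  obtain C where C: "0 < C" "CN.null_controllable \<psi> C"
    by (rule null_controllability_cost)
  obtain \<delta> T where \<delta>: "0 < \<delta>" and T: "0 < T" and local:
    "\<forall>w. norm w \<le> \<delta> \<longrightarrow> (\<exists>p. continuous_on UNIV p \<and> (\<forall>t\<le>0. p t = 0) \<and> CN.flow p (\<psi> + w) T = \<psi>)"
    by (rule CN.local_exact_controllability[OF N_\<psi> C])
  have \<mu>1: "0 < \<mu> 1" using \<mu>_gap[of 0 1] \<alpha> by (simp add: \<mu>_0) (meson less_le_trans zero_less_power)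
  define t where "t = R / (\<delta> * \<mu> 1)"
  have t: "0 \<le> t" using R \<delta> \<mu>1 by (simp add: t_def)
  have decay: "exp (- \<mu> 1 * t) * R \<le> \<delta>"
  proof -
    have "R / \<delta> \<le> exp (R / \<delta>)" using exp_ge_add_one_self[of "R / \<delta>"] by linarith
    moreover have e: "exp (- \<mu> 1 * t) = 1 / exp (R / \<delta>)"
    proof -
      have "- \<mu> 1 * t = - (R / \<delta>)" using \<mu>1 by (simp add: t_def)
      then show ?thesis by (simp only: exp_minus inverse_eq_divide)
    qed
    ultimately show ?thesis unfolding e using \<delta> by (simp add: field_simps)
  qed
  have "\<exists>p. continuous_on UNIV p \<and> CN.flow p (\<psi> + w) (t + T) = \<psi>" if w: "P 0 w = 0" "norm w \<le> R" for w
  proof -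
    have "norm (N t w) \<le> exp (- \<mu> 1 * t) * norm w"
    proof (rule N.E_decay[OF t])
      fix k assume "P k w \<noteq> 0"
      then have "1 \<le> k" using w(1) by (cases k) auto
      then show "\<mu> 1 \<le> \<mu> k" by (rule \<mu>_mono)
    qed
    also have "\<dots> \<le> exp (- \<mu> 1 * t) * R" using w(2) by (intro mult_left_mono) auto
    also note decay
    finally obtain p where p: "continuous_on UNIV p" "\<forall>t\<le>0. p t = 0" "CN.flow p (\<psi> + N t w) T = \<psi>"
      using local by blast
    define p' where "p' s = p (s - t)" for s
    have p'c: "continuous_on UNIV p'"
      unfolding p'_def by (intro continuous_on_compose2[OF p(1)] continuous_intros) auto
    have p'c0: "continuous_on {0..t} p'" using p'c by (rule continuous_on_subset) auto
    have "CN.flow p' (\<psi> + w) t = N t (\<psi> + w) - N.duhamel (\<lambda>s. F (p' s) (CN.flow p' (\<psi> + w) s)) t"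
      using CN.flow_mild[OF t p'c0, of "\<psi> + w"] t by (simp add: CN.mild_def)
    also have "N.duhamel (\<lambda>s. F (p' s) (CN.flow p' (\<psi> + w) s)) t = N.duhamel (\<lambda>s. 0) t"
      by (intro N.duhamel_cong) (simp add: p'_def p(2) CN.F.zero_left)
    finally have start: "CN.flow p' (\<psi> + w) t = \<psi> + N t w"
      using t by (simp add: N.duhamel_zero linear_add[OF N.E_linear] N_\<psi>)
    have "CN.flow p' (\<psi> + w) (t + T) = CN.flow p (CN.flow p' (\<psi> + w) t) T"
      using t T by (intro CN.flow_add p'c) (auto simp: p'_def)
    then show ?thesis using p'c p(3) start by auto
  qed
  then show ?thesis using that[of "t + T"] t T by simp
qed

text \<open>
  The factor \<open>exp (- lam1 t)\<close> undoes the normalisation of the semigroup.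
\<close>

lemma mild_N_to_S:
  assumes m: "CN.mild p x T v"
  shows "CS.mild p x T (\<lambda>t. exp (- lam1 * t) *\<^sub>R v t)"
  unfolding CS.mild_def
proof (intro conjI ballI)
  show "continuous_on {0..T} (\<lambda>t. exp (- lam1 * t) *\<^sub>R v t)"
    using m by (intro continuous_intros) (simp add: CN.mild_def)
  fix t assume t: "t \<in> {0..T}"
  have "S.duhamel (\<lambda>s. F (p s) (exp (- lam1 * s) *\<^sub>R v s)) t
      = integral {0..t} (\<lambda>s. exp (- lam1 * t) *\<^sub>R N (t - s) (F (p s) (v s)))"
    unfolding S.duhamel_def
  proof (intro integral_cong)
    fix s assume s: "s \<in> {0..t}"
    have "- lam1 * (t - s) + - lam1 * s = - lam1 * t" by (simp add: algebra_simps)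
    then have "exp (- lam1 * (t - s)) * exp (- lam1 * s) = exp (- lam1 * t)"
      by (simp only: exp_add[symmetric])
    then show "S (t - s) (F (p s) (exp (- lam1 * s) *\<^sub>R v s)) = exp (- lam1 * t) *\<^sub>R N (t - s) (F (p s) (v s))"
      using s by (simp only: S_eq_N CN.F.scaleR_right linear_scale[OF N.E_linear] scaleR_scaleR atLeastAtMost_iff diff_ge_0_iff_ge)
  qed
  also have "\<dots> = exp (- lam1 * t) *\<^sub>R N.duhamel (\<lambda>s. F (p s) (v s)) t"
    by (simp add: N.duhamel_def)
  finally show "exp (- lam1 * t) *\<^sub>R v t = S t x - S.duhamel (\<lambda>s. F (p s) (exp (- lam1 * s) *\<^sub>R v s)) t"
    using m t by (simp add: CN.mild_def S_eq_N scaleR_diff_right)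
qed

lemma mild_equation_iff:
  assumes p: "continuous_on UNIV p"
  shows "mild_equation scl D A B (\<lambda>s. emb (p s)) x T u \<longleftrightarrow> CS.mild p x T u"
proof -
  have eq: "(set_integrable lborel {0..t} (\<lambda>s. exp_neg scl D A (t - s) (scl (emb (p s)) (B (u s)))) \<and>
        u t = exp_neg scl D A t x -
          set_lebesgue_integral lborel {0..t} (\<lambda>s. exp_neg scl D A (t - s) (scl (emb (p s)) (B (u s)))))
      \<longleftrightarrow> u t = S t x - S.duhamel (\<lambda>s. F (p s) (u s)) t"
    if u: "continuous_on {0..T} u" and t: "t \<in> {0..T}" for t
  proof -
    let ?g = "\<lambda>s. S (t - s) (F (p s) (u s))"
    have "continuous_on {0..t} (\<lambda>s. F (p s) (u s))"
      using t by (intro CN.F.continuous_on continuous_on_subset[OF p] continuous_on_subset[OF u]) auto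
    then have g: "continuous_on {0..t} ?g" by (rule S.duhamel_integrand_continuous)
    have e: "exp_neg scl D A (t - s) (scl (emb (p s)) (B (u s))) = ?g s" if "s \<in> {0..t}" for s
      using that by (simp add: exp_neg_eq F_def)
    have "set_integrable lborel {0..t} (\<lambda>s. exp_neg scl D A (t - s) (scl (emb (p s)) (B (u s)))) \<longleftrightarrow> set_integrable lborel {0..t} ?g"
      by (intro set_integrable_cong) (auto simp: e)
    moreover have "set_lebesgue_integral lborel {0..t} (\<lambda>s. exp_neg scl D A (t - s) (scl (emb (p s)) (B (u s))))
        = set_lebesgue_integral lborel {0..t} ?g"
      by (intro set_lebesgue_integral_cong) (auto simp: e)
    ultimately show ?thesis
      using set_lebesgue_integral_eq_integral_continuous[OF g] t by (simp add: exp_neg_eq S.duhamel_def)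
  qed
  show ?thesis unfolding mild_equation_def CS.mild_def
  proof (rule conj_cong[OF refl], rule ball_cong[OF refl])
    fix t assume "continuous_on {0..T} u" "t \<in> {0..T}"
    then show "(set_integrable lborel {0..t} (\<lambda>s. exp_neg scl D A (t - s) (scl (emb (p s)) (B (u s)))) \<and>
        u t = exp_neg scl D A t x -
          set_lebesgue_integral lborel {0..t} (\<lambda>s. exp_neg scl D A (t - s) (scl (emb (p s)) (B (u s)))))
      \<longleftrightarrow> u t = S t x - S.duhamel (\<lambda>s. F (p s) (u s)) t" by (rule eq)
  qed
qed

lemma mild_solution_if_mild:
  assumes p: "continuous_on UNIV p" and m: "CS.mild p x T u"
  shows "is_the_mild_solution scl D A B (\<lambda>s. emb (p s)) x T u"
  unfolding is_the_mild_solution_def mild_equation_iff[OF p]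
proof (intro conjI allI impI ballI)
  fix v t assume v: "CS.mild p x T v" and t: "t \<in> {0..T}"
  have "continuous_on {0..T} p" using p by (rule continuous_on_subset) simp
  then show "v t = u t" using v m t by (rule CS.mild_unique)
qed (rule m)

lemma L2_control_if_continuous:
  assumes p: "continuous_on UNIV p"
  shows "L2_control T (\<lambda>s. emb (p s))"
  unfolding L2_control_def
proof
  have "p \<in> borel_measurable lborel"
    using borel_measurable_continuous_onI[OF p] by simp
  then have "(\<lambda>s. indicator {0<..<T} s *\<^sub>R p s) \<in> borel_measurable lborel"
    by (intro borel_measurable_scaleR borel_measurable_indicator) auto
  moreover have "emb \<in> borel_measurable borel"
    by (intro borel_measurable_continuous_onI linear_continuous_on emb(1))
  ultimately have "(\<lambda>s. emb (indicator {0<..<T} s *\<^sub>R p s)) \<in> borel_measurable lborel"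
    by (rule measurable_compose)
  then show "set_borel_measurable lborel {0<..<T} (\<lambda>s. emb (p s))"
    by (simp add: set_borel_measurable_def linear_scale[OF bounded_linear.linear[OF emb(1)]])
  have "continuous_on {0..T} (\<lambda>s. (norm (emb (p s)))\<^sup>2)"
    by (intro continuous_intros bounded_linear.continuous_on[OF emb(1)] continuous_on_subset[OF p]) auto
  then have "set_integrable lborel {0..T} (\<lambda>s. (norm (emb (p s)))\<^sup>2)"
    by (rule borel_integrable_atLeastAtMost')
  then show "set_integrable lborel {0<..<T} (\<lambda>s. (norm (emb (p s)))\<^sup>2)"
    by (rule set_integrable_subset) auto
qed

text \<open>
  If \<open>\<langle>u\<^sub>0, \<psi>\<rangle> = 0\<close>, the hypothesis forces \<open>u\<^sub>0 = 0\<close> and \<open>w = 0\<close> will do.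
\<close>

lemma normalised_initial_state:
  assumes "norm (u\<^sub>0 - scl (ip u\<^sub>0 \<psi>) \<psi>) \<le> R * norm (ip u\<^sub>0 \<psi>)" and R: "0 < R"
  obtains w where "u\<^sub>0 = scl (ip u\<^sub>0 \<psi>) (\<psi> + w)" "P 0 w = 0" "norm w \<le> R"
proof (cases "ip u\<^sub>0 \<psi> = 0")
  case True
  then show ?thesis using assms that[of 0] by (simp add: linear_0[OF P_linear])
next
  case False
  let ?a = "ip u\<^sub>0 \<psi>"
  define w where "w = scl (inverse ?a) (u\<^sub>0 - scl ?a \<psi>)"
  have "scl ?a (\<psi> + w) = u\<^sub>0" using False by (simp add: w_def scale_right_distrib)
  moreover have "P 0 w = 0"
    by (simp add: P_eq_0_iff w_def ip_scale_left linear_diff[OF ip_left] ip_\<phi>)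
  moreover have "norm w \<le> R"
  proof -
    have "norm w = norm (u\<^sub>0 - scl ?a \<psi>) / norm ?a"
      unfolding w_def norm_scl norm_inverse by (simp only: divide_inverse mult.commute)
    then show ?thesis using assms(1) False by (simp only: pos_divide_le_eq zero_less_norm_iff not_False_eq_True)
  qed
  ultimately show ?thesis using that[of w] by simp
qed

text \<open>
  The control that steers \<open>\<psi> + w\<close> to \<open>\<psi>\<close> for the normalised semigroup steers \<open>u\<^sub>0\<close>, the multiple of
  \<open>\<psi> + w\<close> by \<open>\<langle>u\<^sub>0, \<psi>\<rangle>\<close>, to the eigensolution, since the original solution is obtained by the
  factors \<open>exp (- lam1 t)\<close> and \<open>\<langle>u\<^sub>0, \<psi>\<rangle>\<close>.
\<close>

theorem exact_controllability_to_eigensolution: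
  assumes R: "0 < R"
  obtains T where "0 < T"
    "\<forall>u\<^sub>0. norm (u\<^sub>0 - scl (ip u\<^sub>0 \<psi>) \<psi>) \<le> R * norm (ip u\<^sub>0 \<psi>) \<longrightarrow>
      (\<exists>p u. L2_control T p \<and> is_the_mild_solution scl D A B p u\<^sub>0 T u \<and>
        u T = scl (ip u\<^sub>0 \<psi>) (exp (- lam1 * T) *\<^sub>R \<psi>))"
proof -
  obtain T where T: "0 < T" and steer:
    "\<forall>w. P 0 w = 0 \<longrightarrow> norm w \<le> R \<longrightarrow> (\<exists>p. continuous_on UNIV p \<and> CN.flow p (\<psi> + w) T = \<psi>)"
    by (rule steering_to_eigenvector[OF R])
  have "\<exists>p u. L2_control T p \<and> is_the_mild_solution scl D A B p u\<^sub>0 T u \<and>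
        u T = scl (ip u\<^sub>0 \<psi>) (exp (- lam1 * T) *\<^sub>R \<psi>)"
    if u0: "norm (u\<^sub>0 - scl (ip u\<^sub>0 \<psi>) \<psi>) \<le> R * norm (ip u\<^sub>0 \<psi>)" for u\<^sub>0
  proof -
    obtain w where w: "u\<^sub>0 = scl (ip u\<^sub>0 \<psi>) (\<psi> + w)" "P 0 w = 0" "norm w \<le> R"
      by (rule normalised_initial_state[OF u0 R])
    obtain p where p: "continuous_on UNIV p" and hit: "CN.flow p (\<psi> + w) T = \<psi>"
      using steer w(2,3) by blast
    have pT: "continuous_on {0..T} p" using p by (rule continuous_on_subset) auto
    define a where "a = ip u\<^sub>0 \<psi>"
    define v where "v = CN.flow p (\<psi> + w)"
    define u where "u t = scl a (exp (- lam1 * t) *\<^sub>R v t)" for t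
    have "CN.mild p (\<psi> + w) T v"
      unfolding v_def using T pT by (intro CN.flow_mild) auto
    then have "CS.mild p (\<psi> + w) T (\<lambda>t. exp (- lam1 * t) *\<^sub>R v t)" by (rule mild_N_to_S)
    from CS.mild_map[OF bounded_bilinear.bounded_linear_right[OF scl_bilinear] S_scl _ pT this, of a]
    have "CS.mild p (scl a (\<psi> + w)) T u"
      unfolding u_def by (simp add: F_def B_scl scale_left_commute)
    then have "is_the_mild_solution scl D A B (\<lambda>s. emb (p s)) u\<^sub>0 T u"
      using mild_solution_if_mild[OF p] w(1) by (simp add: a_def)
    moreover have "u T = scl (ip u\<^sub>0 \<psi>) (exp (- lam1 * T) *\<^sub>R \<psi>)"
      by (simp add: u_def v_def hit a_def)
    ultimately show ?thesis
      using L2_control_if_continuous[OF p]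
      by (intro exI[of _ "\<lambda>s. emb (p s)"] exI[of _ u] conjI)
  qed
  with T show ?thesis by (intro that[of T]) auto
qed

end

section \<open>Exact controllability to the first eigensolution\<close>

text \<open>
  Accretivity makes the eigenvalues nonnegative, and the gap condition makes them distinct.
\<close>

lemma eigen_setting_if_gap:
  fixes scl :: "'k::real_or_complex \<Rightarrow> 'a::{real_inner, banach, second_countable_topology} \<Rightarrow> 'a"
  assumes X: "hilbert_over scl ip"
    and A_sa: "self_adjoint ip D A" and A_acc: "accretive ip D A"
    and eig: "eigen_basis scl ip D A lam \<phi>"
    and \<alpha>: "0 < \<alpha>" and gap: "\<And>k. 1 \<le> k \<Longrightarrow> \<alpha> \<le> sqrt (lam (k + 1)) - sqrt (lam k)"
  shows "eigen_setting scl ip D A lam \<phi>"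
proof -
  interpret hilbert_over scl ip by (rule X)
  have "0 \<le> lam k" if k: "1 \<le> k" for k
  proof -
    have \<phi>: "\<phi> k \<in> D" "A (\<phi> k) = lam k *\<^sub>R \<phi> k" "ip (\<phi> k) (\<phi> k) = 1"
      using eig k by (auto simp: eigen_basis_def orthonormal_basis_def)
    obtain r where r: "0 \<le> r" "ip (A (\<phi> k)) (\<phi> k) = of_real r"
      using A_acc \<phi>(1) by (auto simp: accretive_def)
    have "of_real (lam k) = (of_real r :: 'k)"
      using r(2) \<phi> by (simp add: linear_scale[OF ip_left] scaleR_conv_of_real)
    then show ?thesis using r(1) by simp
  qed
  moreover have less: "lam j < lam k" if j: "1 \<le> j" and jk: "Suc j \<le> k" for j k
    using jk
  proof (induction k rule: dec_induct)
    case base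
    have "sqrt (lam j) < sqrt (lam (Suc j))" using gap[OF j] \<alpha> unfolding Suc_eq_plus1 by linarith
    then show ?case by simp
  next
    case (step n)
    have "\<alpha> \<le> sqrt (lam (Suc n)) - sqrt (lam n)" using gap[of n] j step by simp
    then have "sqrt (lam n) < sqrt (lam (Suc n))" using \<alpha> by linarith
    then show ?case using step by simp
  qed
  moreover have "j = k" if "1 \<le> j" "1 \<le> k" "lam j = lam k" for j k
    using less[of j k] less[of k j] that by (metis Suc_leI less_irrefl linorder_less_linear)
  ultimately show ?thesis
    by (intro eigen_setting.intro X eigen_setting_axioms.intro A_sa eig)
qed

theorem theorem1p3:
  fixes scl :: "'k::real_or_complex \<Rightarrow> 'a::{real_inner, banach, second_countable_topology} \<Rightarrow> 'a"
    and ip :: "'a \<Rightarrow> 'a \<Rightarrow> 'k"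
    and D :: "'a set" and A B :: "'a \<Rightarrow> 'a"
    and lam :: "nat \<Rightarrow> real" and \<phi> :: "nat \<Rightarrow> 'a"
  assumes X: "hilbert_over scl ip"
    and A_lin: "densely_defined_linear scl D A"
    and A_sa: "self_adjoint ip D A"
    and A_acc: "accretive ip D A"
    and A_comp: "\<exists>\<mu>>0. compact_resolvent_at scl D A \<mu>"
    and eig: "eigen_basis scl ip D A lam \<phi>"
    and gap: "\<exists>\<alpha>>0. \<forall>k\<ge>1. sqrt (lam (k + 1)) - sqrt (lam k) \<ge> \<alpha>"
    and B_bdd: "bounded_operator scl B"
    and B_1: "ip (B (\<phi> 1)) (\<phi> 1) \<noteq> 0"
    and B_k: "\<exists>b>0. \<exists>q>0. \<forall>k>1. lam k powr q * norm (ip (B (\<phi> 1)) (\<phi> k)) \<ge> b"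
  shows "\<forall>R>0. \<exists>T>0. \<forall>u\<^sub>0.
    norm (u\<^sub>0 - scl (ip u\<^sub>0 (\<phi> 1)) (\<phi> 1)) \<le> R * norm (ip u\<^sub>0 (\<phi> 1)) \<longrightarrow>
    (\<exists>p u. L2_control T p \<and> is_the_mild_solution scl D A B p u\<^sub>0 T u \<and>
       u T = scl (ip u\<^sub>0 (\<phi> 1)) (exp (- lam 1 * T) *\<^sub>R \<phi> 1))"
proof (intro allI impI)
  fix R :: real assume R: "0 < R"
  obtain \<alpha> where \<alpha>: "0 < \<alpha>" "\<forall>k\<ge>1. \<alpha> \<le> sqrt (lam (k + 1)) - sqrt (lam k)"
    using gap by blast
  obtain b q where bq: "0 < b" "0 < q" "\<forall>k>1. b \<le> lam k powr q * norm (ip (B (\<phi> 1)) (\<phi> k))"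
    using B_k by blast
  obtain emb :: "complex \<Rightarrow> 'k" where emb: "bounded_linear emb" "\<And>c. emb (to_complex c) = c"
    by (rule to_complex_retraction) (rule that, assumption, simp)
  interpret controlled_eigen_setting scl ip D A lam \<phi> B emb \<alpha> b q
    using \<alpha> bq emb
    by (intro controlled_eigen_setting.intro controlled_eigen_setting_axioms.intro
        eigen_setting_if_gap[OF X A_sa A_acc eig] B_bdd B_1) auto
  obtain T where "0 < T" and "\<forall>u\<^sub>0. norm (u\<^sub>0 - scl (ip u\<^sub>0 (\<phi> (Suc 0))) (\<phi> (Suc 0))) \<le> R * norm (ip u\<^sub>0 (\<phi> (Suc 0))) \<longrightarrow>
      (\<exists>p u. L2_control T p \<and> is_the_mild_solution scl D A B p u\<^sub>0 T u \<and>
        u T = scl (ip u\<^sub>0 (\<phi> (Suc 0))) (exp (- lam (Suc 0) * T) *\<^sub>R \<phi> (Suc 0)))"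
    by (rule exact_controllability_to_eigensolution[OF R])
  then show "\<exists>T>0. \<forall>u\<^sub>0.
    norm (u\<^sub>0 - scl (ip u\<^sub>0 (\<phi> 1)) (\<phi> 1)) \<le> R * norm (ip u\<^sub>0 (\<phi> 1)) \<longrightarrow>
    (\<exists>p u. L2_control T p \<and> is_the_mild_solution scl D A B p u\<^sub>0 T u \<and>
       u T = scl (ip u\<^sub>0 (\<phi> 1)) (exp (- lam 1 * T) *\<^sub>R \<phi> 1))"
    by (intro exI[of _ T]) simp
qed

end
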